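(* Let $R$ be a universally catenary integral domain with fraction field $K$. The following are equivalent: (a) $R$ is perinormal. (b) For each prime ideal $\mathfrak{p}$ of $R$, $R_{\mathfrak{p}}$ is the only ring $S$ with $R_{\mathfrak{p}} \subseteq S \subseteq K$ such that the induced map $\operatorname{Spec} S \to \operatorname{Spec} R_{\mathfrak{p}}$ is an order-reflecting bijection. (c) $R$ satisfies (R$_1$), and for each prime ideal $\mathfrak{p}$ of $R$, $R_{\mathfrak{p}}$ is the only ring $S$ lying between $R_{\mathfrak{p}}$ and its integral closure such that the induced map $\operatorname{Spec} S \to \operatorname{Spec} R_{\mathfrak{p}}$ is an order-reflecting bijection.
   Context: All rings are commutative with identity. "Local" means having a unique maximal ideal. An overring of a domain $R$ is a ring between $R$ and its fraction field. A ring extension $A \subseteq B$ satisfies going-down if whenever $\mathfrak{p} \subset \mathfrak{q}$ are primes of $A$ and $Q$ is a prime of $B$ with $Q \cap A = \mathfrak{q}$, there is a prime $P \subseteq Q$ of $B$ with $P \cap A = \mathfrak{p}$. A domain $R$ is perinormal if every local overring $S$ of $R$ such that $R \subseteq S$ satisfies going-down is a localization of $R$ (necessarily at a prime ideal). A ring $R$ satisfies (R$_1$) if $R_P$ is a valuation domain for every height one prime $P$ of $R$. A ring is catenary if for any primes $\mathfrak{p}_1 \subset \mathfrak{p}_2$ between which a saturated chain of primes exists, all saturated chains between them have the same length; a ring is universally catenary if it is Noetherian and every finitely generated algebra over it is catenary. A bijection $\operatorname{Spec} S \to \operatorname{Spec} A$ given by contraction is order-reflecting if whenever $\mathfrak{q}_1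 \subseteq \mathfrak{q}_2$ in $\operatorname{Spec} A$, the primes of $S$ corresponding to them satisfy $Q_1 \subseteq Q_2$. *)

theory Defs
  imports "HOL-Algebra.Algebra" "HOL-Library.Multiset"
begin

definition Spec :: "('a, 'b) ring_scheme \<Rightarrow> 'a set set" where
  "Spec A = {P. primeideal P A}"

definition saturated_chain :: "('a, 'b) ring_scheme \<Rightarrow> 'a set \<Rightarrow> 'a set \<Rightarrow> 'a set list \<Rightarrow> bool" where
  "saturated_chain A p q cs \<longleftrightarrow>
     cs \<noteq> [] \<and> hd cs = p \<and> last cs = q \<and> (\<forall>c \<in> set cs. c \<in> Spec A) \<and>
     (\<forall>i. Suc i < length cs \<longrightarrow>
        cs ! i \<subset> cs ! Suc i \<and> \<not> (\<exists>P \<in> Spec A. cs ! i \<subset> P \<and> P \<subset> cs ! Suc i))"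

definition catenary :: "('a, 'b) ring_scheme \<Rightarrow> bool" where
  "catenary A \<longleftrightarrow>
     (\<forall>p1 \<in> Spec A. \<forall>p2 \<in> Spec A. p1 \<subset> p2 \<longrightarrow>
        (\<forall>cs ds. saturated_chain A p1 p2 cs \<longrightarrow> saturated_chain A p1 p2 ds \<longrightarrow>
            length cs = length ds))"

text \<open>The polynomial ring A[x_0,...,x_(n-1)]: a polynomial is a finitely supported map from
  monomials (multisets of variable indices < n) to coefficients in A.\<close>
definition mpoly_ring :: "('a, 'b) ring_scheme \<Rightarrow> nat \<Rightarrow> (nat multiset \<Rightarrow> 'a) ring" where
  "mpoly_ring A n =
    \<lparr> carrier = {p. (\<forall>m. p m \<in> carrier A) \<and> finite {m. p m \<noteq> \<zero>\<^bsub>A\<^esub>}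
                   \<and> (\<forall>m. p m \<noteq> \<zero>\<^bsub>A\<^esub> \<longrightarrow> set_mset m \<subseteq> {..<n})},
      monoid.mult = (\<lambda>p q m. finsum A (\<lambda>a. p a \<otimes>\<^bsub>A\<^esub> q (m - a)) {a. a \<subseteq># m}),
      one = (\<lambda>m. if m = {#} then \<one>\<^bsub>A\<^esub> else \<zero>\<^bsub>A\<^esub>),
      ring.zero = (\<lambda>m. \<zero>\<^bsub>A\<^esub>),
      ring.add = (\<lambda>p q m. p m \<oplus>\<^bsub>A\<^esub> q m) \<rparr>"

text \<open>Universally catenary: Noetherian and every finitely generated A-algebra is catenary.
  Every finitely generated A-algebra is (up to isomorphism) a quotient A[x_0..x_(n-1)]/I.\<close>
definition universally_catenary :: "('a, 'b) ring_scheme \<Rightarrow> bool" where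
  "universally_catenary A \<longleftrightarrow> noetherian_ring A \<and>
     (\<forall>n I. ideal I (mpoly_ring A n) \<longrightarrow> catenary (mpoly_ring A n Quot I))"

text \<open>All rings below are subrings of the field K, viewed as rings via K(carrier := S).\<close>

abbreviation subr :: "('a, 'b) ring_scheme \<Rightarrow> 'a set \<Rightarrow> ('a, 'b) ring_scheme" where
  "subr K S \<equiv> K\<lparr>carrier := S\<rparr>"

definition is_fraction_field :: "('a, 'b) ring_scheme \<Rightarrow> 'a set \<Rightarrow> bool" where
  "is_fraction_field K R \<longleftrightarrow> field K \<and> subring R K \<and>
     (\<forall>x \<in> carrier K. \<exists>a \<in> R. \<exists>b \<in> R. b \<noteq> \<zero>\<^bsub>K\<^esub> \<and> x = a \<otimes>\<^bsub>K\<^esub> inv\<^bsub>K\<^esub> b)"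

definition local_ring :: "('a, 'b) ring_scheme \<Rightarrow> bool" where
  "local_ring A \<longleftrightarrow> (\<exists>!M. maximalideal M A)"

definition going_down :: "('a, 'b) ring_scheme \<Rightarrow> 'a set \<Rightarrow> 'a set \<Rightarrow> bool" where
  "going_down K A B \<longleftrightarrow>
     (\<forall>p \<in> Spec (subr K A). \<forall>q \<in> Spec (subr K A). \<forall>Q \<in> Spec (subr K B).
        p \<subset> q \<and> Q \<inter> A = q \<longrightarrow> (\<exists>P \<in> Spec (subr K B). P \<subseteq> Q \<and> P \<inter> A = p))"

definition loc :: "('a, 'b) ring_scheme \<Rightarrow> 'a set \<Rightarrow> 'a set \<Rightarrow> 'a set" where
  "loc K R M = {a \<otimes>\<^bsub>K\<^esub> inv\<^bsub>K\<^esub> b | a b. a \<in> R \<and> b \<in> M}"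

definition mult_closed :: "('a, 'b) ring_scheme \<Rightarrow> 'a set \<Rightarrow> 'a set \<Rightarrow> bool" where
  "mult_closed K R M \<longleftrightarrow> M \<subseteq> R \<and> \<one>\<^bsub>K\<^esub> \<in> M \<and> \<zero>\<^bsub>K\<^esub> \<notin> M \<and>
     (\<forall>x \<in> M. \<forall>y \<in> M. x \<otimes>\<^bsub>K\<^esub> y \<in> M)"

definition is_localization :: "('a, 'b) ring_scheme \<Rightarrow> 'a set \<Rightarrow> 'a set \<Rightarrow> bool" where
  "is_localization K R S \<longleftrightarrow> (\<exists>M. mult_closed K R M \<and> S = loc K R M)"

abbreviation loc_prime :: "('a, 'b) ring_scheme \<Rightarrow> 'a set \<Rightarrow> 'a set \<Rightarrow> 'a set" where
  "loc_prime K R p \<equiv> loc K R (R - p)"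

definition perinormal :: "('a, 'b) ring_scheme \<Rightarrow> 'a set \<Rightarrow> bool" where
  "perinormal K R \<longleftrightarrow>
     (\<forall>S. subring S K \<and> R \<subseteq> S \<and> local_ring (subr K S) \<and> going_down K R S
          \<longrightarrow> is_localization K R S)"

definition valuation_domain :: "('a, 'b) ring_scheme \<Rightarrow> 'a set \<Rightarrow> bool" where
  "valuation_domain K V \<longleftrightarrow> subring V K \<and>
     (\<forall>x \<in> carrier K. x \<noteq> \<zero>\<^bsub>K\<^esub> \<longrightarrow> x \<in> V \<or> inv\<^bsub>K\<^esub> x \<in> V)"

definition height_one :: "('a, 'b) ring_scheme \<Rightarrow> 'a set \<Rightarrow> 'a set \<Rightarrow> bool" where
  "height_one K R P \<longleftrightarrow> P \<in> Spec (subr K R) \<and> P \<noteq> {\<zero>\<^bsub>K\<^esub>} \<and>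
     \<not> (\<exists>Q \<in> Spec (subr K R). {\<zero>\<^bsub>K\<^esub>} \<subset> Q \<and> Q \<subset> P)"

definition R1 :: "('a, 'b) ring_scheme \<Rightarrow> 'a set \<Rightarrow> bool" where
  "R1 K R \<longleftrightarrow> (\<forall>P. height_one K R P \<longrightarrow> valuation_domain K (loc_prime K R P))"

definition spec_order_reflecting_bij :: "('a, 'b) ring_scheme \<Rightarrow> 'a set \<Rightarrow> 'a set \<Rightarrow> bool" where
  "spec_order_reflecting_bij K A S \<longleftrightarrow>
     bij_betw (\<lambda>Q. Q \<inter> A) (Spec (subr K S)) (Spec (subr K A)) \<and>
     (\<forall>Q1 \<in> Spec (subr K S). \<forall>Q2 \<in> Spec (subr K S). Q1 \<inter> A \<subseteq> Q2 \<inter> A \<longrightarrow> Q1 \<subseteq> Q2)"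

definition integral_closure :: "('a, 'b) ring_scheme \<Rightarrow> 'a set \<Rightarrow> 'a set" where
  "integral_closure K A = {x \<in> carrier K. \<exists>(n::nat) c. (\<forall>i < n. c i \<in> A) \<and>
      x [^]\<^bsub>K\<^esub> n \<oplus>\<^bsub>K\<^esub> finsum K (\<lambda>i. c i \<otimes>\<^bsub>K\<^esub> x [^]\<^bsub>K\<^esub> (i::nat)) {..<n} = \<zero>\<^bsub>K\<^esub>}"

end

theory Submission
  imports Defs
begin

text \<open>
  The crux is a statement about a prime \<open>u\<close> of height one of \<open>R[x]\<close>, for \<open>x\<close> in the fraction
  field, such that \<open>x \<in> u\<close>: its contraction to \<open>R\<close> has height one. Indeed, if \<open>U\<close> is the preimage
  of \<open>u\<close> in \<open>R[X]\<close>, then \<open>X \<in> U\<close>, and comparing the saturated chain through the kernel of \<open>X \<mapsto> x\<close>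
  with the one through the kernel of \<open>X \<mapsto> 0\<close> in the catenary ring \<open>R[X]\<close> shows that there is no
  room between \<open>0\<close> and \<open>u \<inter> R\<close>. By (R1) the localization at \<open>u \<inter> R\<close> is then a valuation domain,
  so some \<open>b \<in> R - u\<close> satisfies \<open>b x \<in> u \<inter> R\<close>.

  Let \<open>S\<close> be a local overring satisfying going-down, with maximal ideal over \<open>p\<close>. Choosing \<open>u\<close> inside
  a prime \<open>Q\<^sub>1\<close> of \<open>S\<close> containing \<open>x\<close>, going-down carries \<open>x\<close> into every prime \<open>Q\<^sub>2\<close> with
  \<open>Q\<^sub>1 \<inter> R \<subseteq> Q\<^sub>2 \<inter> R\<close>; so the map on spectra is an order-reflecting bijection. Applied to \<open>1/x\<close>
  for an \<open>x \<in> S\<close> that is not integral over \<open>R\<^sub>p\<close>, the same argument gives a contradiction, so \<open>S\<close> is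
  integral over \<open>R\<^sub>p\<close>. Conversely, (R1) follows from (b) because a subring that is maximal among the
  proper subrings of \<open>K\<close> containing the localization at a height one prime has the same spectrum as
  that localization.
\<close>

section \<open>The principal ideal theorem\<close>

text \<open>The overring \<open>S\<close> is arbitrary and need not be Noetherian, so no dimension
  theory is available in it. Everything that involves heights happens in the Noetherian rings
  \<open>R[x]\<close> and \<open>R[X]\<close>; \<open>S\<close> enters only through contractions of
  its primes and through going-down. This is why \<open>x\<close> is traded for two elements
  \<open>b\<close> and \<open>b x\<close> of \<open>R\<close>: a condition on \<open>R\<close> alone
  can be carried to any prime of \<open>S\<close> over a given prime of \<open>R\<close>.

  Krull's theory supplies two ingredients: a nonzero element of a prime lies in a height one prime
  below it, and strictly nested primes are joined by a saturated chain. Both come from the principal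
  ideal theorem in the form that a chain of primes whose top contains \<open>x\<close> can be
  rerouted, at the same length, so that its first step already contains \<open>x\<close>.

  For (R1), the union of a chain of proper subrings of \<open>K\<close> might be all of
  \<open>K\<close>. Fixing \<open>a \<noteq> 0\<close> in the height one prime cures this: an
  overring of the localization is proper exactly when it misses \<open>1/a\<close>, and missing a
  fixed element survives unions.\<close>

lemma (in cring) idealI_closed:
  assumes "I \<subseteq> carrier R" "\<zero> \<in> I"
    and "\<And>a b. a \<in> I \<Longrightarrow> b \<in> I \<Longrightarrow> a \<oplus> b \<in> I"
    and mult: "\<And>a c. a \<in> I \<Longrightarrow> c \<in> carrier R \<Longrightarrow> c \<otimes> a \<in> I"
  shows "ideal I R"
proof (rule idealI[OF ring_axioms])
  have "\<ominus> a \<in> I" if "a \<in> I" for a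
  proof -
    have "a \<in> carrier R" using that assms(1) by blast
    then have "\<ominus> a = (\<ominus> \<one>) \<otimes> a" by algebra
    with mult[OF that, of "\<ominus> \<one>"] show ?thesis by simp
  qed
  then show "subgroup I (add_monoid R)"
    using assms by (intro add.subgroupI) (auto simp: a_inv_def)
  show "x \<otimes> a \<in> I" if "a \<in> I" "x \<in> carrier R" for a x using mult that .
  show "a \<otimes> x \<in> I" if "a \<in> I" "x \<in> carrier R" for a x
    using mult[OF that] that assms(1) m_comm by (metis subsetD)
qed

lemma (in cring) idealD:
  assumes "ideal I R"
  shows "I \<subseteq> carrier R" "\<zero> \<in> I"
    and "\<And>a b. a \<in> I \<Longrightarrow> b \<in> I \<Longrightarrow> a \<oplus> b \<in> I"
    and "\<And>a b. a \<in> I \<Longrightarrow> b \<in> I \<Longrightarrow> a \<ominus> b \<in> I"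
    and "\<And>a c. a \<in> I \<Longrightarrow> c \<in> carrier R \<Longrightarrow> c \<otimes> a \<in> I"
    and "\<And>a c. a \<in> I \<Longrightarrow> c \<in> carrier R \<Longrightarrow> a \<otimes> c \<in> I"
proof -
  interpret I: ideal I R by fact
  show "I \<subseteq> carrier R" "\<zero> \<in> I"
    "\<And>a b. a \<in> I \<Longrightarrow> b \<in> I \<Longrightarrow> a \<oplus> b \<in> I"
    "\<And>a b. a \<in> I \<Longrightarrow> b \<in> I \<Longrightarrow> a \<ominus> b \<in> I"
    "\<And>a c. a \<in> I \<Longrightarrow> c \<in> carrier R \<Longrightarrow> c \<otimes> a \<in> I"
    "\<And>a c. a \<in> I \<Longrightarrow> c \<in> carrier R \<Longrightarrow> a \<otimes> c \<in> I"
    using I.a_subset I.I_l_closed I.I_r_closed by (auto simp: a_minus_def)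
qed

lemma (in cring) primeD:
  assumes "primeideal P R"
  shows "ideal P R" "P \<subseteq> carrier R" "\<one> \<notin> P"
    and "\<And>a b. a \<in> carrier R \<Longrightarrow> b \<in> carrier R \<Longrightarrow> a \<otimes> b \<in> P \<Longrightarrow> a \<in> P \<or> b \<in> P"
    and "\<And>a (n::nat). a \<in> carrier R \<Longrightarrow> a [^] n \<in> P \<Longrightarrow> a \<in> P"
proof -
  interpret P: primeideal P R by fact
  show "ideal P R" "P \<subseteq> carrier R" using P.is_ideal P.a_subset by auto
  show one: "\<one> \<notin> P" using P.one_imp_carrier P.I_notcarr by auto
  show pr: "\<And>a b. a \<in> carrier R \<Longrightarrow> b \<in> carrier R \<Longrightarrow> a \<otimes> b \<in> P \<Longrightarrow> a \<in> P \<or> b \<in> P"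
    by (rule P.I_prime)
  show "a \<in> P" if "a \<in> carrier R" "a [^] n \<in> P" for a and n :: nat
    using that(2)
  proof (induct n)
    case 0 then show ?case using one by simp
  next
    case (Suc n) then show ?case using pr[of "a [^] n" a] that(1) by auto
  qed
qed

definition add_multiples :: "('a, 'b) ring_scheme \<Rightarrow> 'a set \<Rightarrow> 'a \<Rightarrow> 'a set" where
  "add_multiples R I c = {i \<oplus>\<^bsub>R\<^esub> b \<otimes>\<^bsub>R\<^esub> c | i b. i \<in> I \<and> b \<in> carrier R}"

lemma (in cring) add_multiples_ideal:
  assumes "ideal I R" "c \<in> carrier R"
  shows "ideal (add_multiples R I c) R" "I \<subseteq> add_multiples R I c" "c \<in> add_multiples R I c"
proof -
  note I = idealD[OF assms(1)]
  show "ideal (add_multiples R I c) R"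
  proof (rule idealI_closed)
    show "add_multiples R I c \<subseteq> carrier R"
      using I(1) assms(2) by (auto simp: add_multiples_def)
    have "\<zero> = \<zero> \<oplus> \<zero> \<otimes> c" using assms(2) by simp
    then show "\<zero> \<in> add_multiples R I c"
      unfolding add_multiples_def using I(2) zero_closed by blast
  next
    fix a b assume "a \<in> add_multiples R I c" "b \<in> add_multiples R I c"
    then obtain i x j y where *: "i \<in> I" "x \<in> carrier R" "a = i \<oplus> x \<otimes> c"
      "j \<in> I" "y \<in> carrier R" "b = j \<oplus> y \<otimes> c"
      unfolding add_multiples_def by blast
    then have "a \<oplus> b = (i \<oplus> j) \<oplus> (x \<oplus> y) \<otimes> c"
      using I(1) assms(2) subsetD[OF I(1), of i] subsetD[OF I(1), of j] by simp algebra
    then show "a \<oplus> b \<in> add_multiples R I c"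
      unfolding add_multiples_def using I(3) * by blast
  next
    fix a d assume "a \<in> add_multiples R I c" "d \<in> carrier R"
    then obtain i x where *: "i \<in> I" "x \<in> carrier R" "a = i \<oplus> x \<otimes> c"
      unfolding add_multiples_def by blast
    then have "d \<otimes> a = d \<otimes> i \<oplus> (d \<otimes> x) \<otimes> c"
      using assms(2) subsetD[OF I(1), of i] \<open>d \<in> carrier R\<close> by simp algebra
    then show "d \<otimes> a \<in> add_multiples R I c"
      unfolding add_multiples_def using I(5) * \<open>d \<in> carrier R\<close> by blast
  qed
  show "I \<subseteq> add_multiples R I c"
  proof
    fix i assume "i \<in> I"
    then have "i = i \<oplus> \<zero> \<otimes> c" using I(1) assms(2) by auto
    then show "i \<in> add_multiples R I c"
      unfolding add_multiples_def using \<open>i \<in> I\<close> zero_closed by blast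
  qed
  have "c = \<zero> \<oplus> \<one> \<otimes> c" using assms(2) by simp
  then show "c \<in> add_multiples R I c"
    unfolding add_multiples_def using I(2) one_closed by blast
qed

lemma (in cring) add_multiples_mono: "I \<subseteq> J \<Longrightarrow> add_multiples R I c \<subseteq> add_multiples R J c"
  unfolding add_multiples_def by blast

lemma (in cring) add_multiples_least:
  assumes "ideal J R" "I \<subseteq> J" "c \<in> J"
  shows "add_multiples R I c \<subseteq> J"
proof
  fix a assume "a \<in> add_multiples R I c"
  then obtain i b where "i \<in> I" "b \<in> carrier R" "a = i \<oplus> b \<otimes> c" unfolding add_multiples_def by blast
  then show "a \<in> J" using idealD(3,5)[OF assms(1)] assms(2,3) by auto
qed

text \<open>The maximal condition, obtained from the chain form of the Noetherian property: the
  union of a nonempty chain of ideals belongs to the chain, so it is an upper bound inside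
  \<open>F\<close>.\<close>

lemma (in noetherian_ring) ex_maximal_ideal_in:
  assumes "\<And>I. I \<in> F \<Longrightarrow> ideal I R" "I0 \<in> F"
  shows "\<exists>M\<in>F. \<forall>I\<in>F. M \<subseteq> I \<longrightarrow> I = M"
proof (rule subset_Zorn)
  fix C assume C: "subset.chain F C"
  show "\<exists>U\<in>F. \<forall>I\<in>C. I \<subseteq> U"
  proof (cases "C = {}")
    case True then show ?thesis using assms(2) by blast
  next
    case False
    have "subset.chain {I. ideal I R} C"
      using C assms(1) by (simp add: pred_on.chain_def subset_iff)
    then have "\<Union>C \<in> C" using ideal_chain_is_trivial[OF False] by simp
    moreover from this have "\<Union>C \<in> F" using C unfolding pred_on.chain_def by (meson subsetD)
    ultimately show ?thesis by (meson Union_upper)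
  qed
qed

text \<open>For a prime \<open>u\<close> and an ideal \<open>I\<close>, this is the contraction to
  \<open>R\<close> of the extension of \<open>I\<close> to the localization at \<open>u\<close>.
  Inclusions into such sets express inclusions of ideals of the local ring without constructing that
  ring.\<close>

definition saturation :: "('a, 'b) ring_scheme \<Rightarrow> 'a set \<Rightarrow> 'a set \<Rightarrow> 'a set" where
  "saturation R u I = {a \<in> carrier R. \<exists>t \<in> carrier R - u. t \<otimes>\<^bsub>R\<^esub> a \<in> I}"

lemma saturation_mono: "I \<subseteq> J \<Longrightarrow> saturation R u I \<subseteq> saturation R u J"
  unfolding saturation_def by blast

lemma (in cring) saturation_ideal:
  assumes "primeideal u R" "ideal I R"
  shows "ideal (saturation R u I) R" "I \<subseteq> saturation R u I"
    and "\<And>a t. a \<in> carrier R \<Longrightarrow> t \<in> carrier R - u \<Longrightarrow> t \<otimes> a \<in> saturation R u I \<Longrightarrow> a \<in> saturation R u I"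
proof -
  note u = primeD[OF assms(1)] and I = idealD[OF assms(2)]
  have sat: "a \<in> saturation R u I" if "a \<in> carrier R" "t \<in> carrier R" "t \<notin> u" "t \<otimes> a \<in> I" for a t
    using that unfolding saturation_def by blast
  show incl: "I \<subseteq> saturation R u I"
    using sat[of _ \<one>] u(3) I(1) by auto
  show "ideal (saturation R u I) R"
  proof (rule idealI_closed)
    show "saturation R u I \<subseteq> carrier R" unfolding saturation_def by blast
    show "\<zero> \<in> saturation R u I" using incl I(2) by blast
  next
    fix a b assume "a \<in> saturation R u I" "b \<in> saturation R u I"
    then obtain s t where *: "a \<in> carrier R" "b \<in> carrier R" "s \<in> carrier R - u" "t \<in> carrier R - u"
      "s \<otimes> a \<in> I" "t \<otimes> b \<in> I" unfolding saturation_def by blast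
    have "s \<otimes> t \<otimes> (a \<oplus> b) = t \<otimes> (s \<otimes> a) \<oplus> s \<otimes> (t \<otimes> b)" using * by simp algebra
    then show "a \<oplus> b \<in> saturation R u I"
      using sat[of "a \<oplus> b" "s \<otimes> t"] * u(4)[of s t] I(3,5) by auto
  next
    fix a c assume "a \<in> saturation R u I" and c: "c \<in> carrier R"
    then obtain s where *: "a \<in> carrier R" "s \<in> carrier R - u" "s \<otimes> a \<in> I"
      unfolding saturation_def by blast
    have "s \<otimes> (c \<otimes> a) = c \<otimes> (s \<otimes> a)" using * c by simp algebra
    then show "c \<otimes> a \<in> saturation R u I" using sat[of "c \<otimes> a" s] * c I(5) by auto
  qed
  show "a \<in> saturation R u I" if as: "a \<in> carrier R" "t \<in> carrier R - u" "t \<otimes> a \<in> saturation R u I" for a t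
  proof -
    obtain s where s: "s \<in> carrier R - u" "s \<otimes> (t \<otimes> a) \<in> I" using as unfolding saturation_def by blast
    have "s \<otimes> t \<otimes> a = s \<otimes> (t \<otimes> a)" using s as by (simp add: m_assoc)
    then show ?thesis using sat[of a "s \<otimes> t"] s as u(4)[of s t] by auto
  qed
qed

text \<open>The localization at \<open>u\<close> of the quotient by \<open>I\<close> is Artinian as soon as \<open>u\<close> is its only
  prime: a maximal counterexample \<open>I\<close> has a socle element \<open>c\<close>, and a chain stabilizes modulo
  \<open>I + (c)\<close>, while between \<open>I\<close> and \<open>I + (c)\<close> there is no room.\<close>

lemma (in cring) descending_chain_saturation:
  assumes noeth: "noetherian_ring R" and u: "primeideal u R" and I0: "ideal I0 R"
    and only: "\<And>w. primeideal w R \<Longrightarrow> I0 \<subseteq> w \<Longrightarrow> w \<subseteq> u \<Longrightarrow> w = u"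
    and D: "\<And>n. ideal (D n) R" "\<And>n. I0 \<subseteq> D n" "\<And>n. D (Suc n) \<subseteq> D n"
  shows "\<exists>n. D n \<subseteq> saturation R u (D (Suc n))"
proof (rule ccontr)
  assume notstab: "\<not> ?thesis"
  interpret noetherian_ring R by fact
  note uD = primeD[OF u]
  \<comment> \<open>Asking for stability at all large \<open>n\<close>, not just at one, is what
    allows the property at \<open>I + (c)\<close> to be combined below with the condition
    \<open>n \<ge> m\<close>.\<close>
  define DC where "DC I \<longleftrightarrow> (\<forall>D. (\<forall>n. ideal (D n) R \<and> I \<subseteq> D n \<and> D (Suc n) \<subseteq> D n) \<longrightarrow>
       (\<exists>N. \<forall>n\<ge>N. D n \<subseteq> saturation R u (D (Suc n))))" for I :: "'a set"
  have "\<not> DC I0"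
  proof
    assume "DC I0"
    from this[unfolded DC_def, rule_format, of D] D notstab show False by blast
  qed
  define F where "F = {I. ideal I R \<and> I0 \<subseteq> I \<and> \<not> DC I}"
  have F_ideal: "ideal I R" if "I \<in> F" for I using that unfolding F_def by blast
  have "I0 \<in> F" using \<open>\<not> DC I0\<close> I0 unfolding F_def by blast
  from ex_maximal_ideal_in[OF F_ideal this]
  obtain I where IF: "I \<in> F" and Imax: "\<And>J. J \<in> F \<Longrightarrow> I \<subseteq> J \<Longrightarrow> J = I" by metis
  have I: "ideal I R" "I0 \<subseteq> I" "\<not> DC I" using IF unfolding F_def by auto
  note ID = idealD[OF I(1)]
  note satI = saturation_ideal[OF u I(1)]
  note satID = idealD[OF satI(1)]
  obtain D where D: "\<And>n. ideal (D n) R" "\<And>n. I \<subseteq> D n" "\<And>n. D (Suc n) \<subseteq> D n"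
    and bad: "\<And>N. \<exists>n\<ge>N. \<not> D n \<subseteq> saturation R u (D (Suc n))"
    using I(3) unfolding DC_def not_all not_imp by (elim exE) metis
  have anti: "D n \<subseteq> D m" if "m \<le> n" for m n
    using lift_Suc_antimono_le[of D, OF D(3) that] .
  have one_nin: "\<one> \<notin> saturation R u I"
  proof
    assume "\<one> \<in> saturation R u I"
    then have "\<one> \<in> saturation R u (D (Suc n))" for n
      using saturation_mono[OF D(2)] by blast
    then have "saturation R u (D (Suc n)) = carrier R" for n
      using ideal.one_imp_carrier[OF saturation_ideal(1)[OF u D(1)]] by blast
    then show False using bad idealD(1)[OF D(1)] by blast
  qed
  \<comment> \<open>\<open>col c\<close> is the annihilator of \<open>c\<close> modulo
    \<open>saturation R u I\<close>. A maximal one, over all \<open>c\<close> outside that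
    saturation, is prime: the usual construction of an associated prime.\<close>
  define col where "col c = {b \<in> carrier R. b \<otimes> c \<in> saturation R u I}" for c
  have col_ideal: "ideal (col c) R" if "c \<in> carrier R" for c
    using that satID by (intro idealI_closed) (auto simp: col_def l_distr m_assoc)
  define G where "G = {col c | c. c \<in> carrier R \<and> c \<notin> saturation R u I}"
  have "col \<one> \<in> G" using one_nin unfolding G_def by blast
  moreover have G_ideal: "ideal J R" if "J \<in> G" for J using that col_ideal unfolding G_def by blast
  ultimately obtain Q where QG: "Q \<in> G" and Qmax: "\<And>J. J \<in> G \<Longrightarrow> Q \<subseteq> J \<Longrightarrow> J = Q"
    using ex_maximal_ideal_in[OF G_ideal, of G "col \<one>"] by metis
  then obtain c where c: "c \<in> carrier R" "c \<notin> saturation R u I" "Q = col c"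
    unfolding G_def by blast
  have Qp: "primeideal Q R"
  proof (rule primeidealI[OF _ is_cring])
    show "ideal Q R" using col_ideal c by simp
    have "\<one> \<notin> Q" using c unfolding col_def by simp
    then show "carrier R \<noteq> Q" by auto
    fix a b assume ab: "a \<in> carrier R" "b \<in> carrier R" "a \<otimes> b \<in> Q"
    show "a \<in> Q \<or> b \<in> Q"
    proof (rule ccontr)
      assume n: "\<not> (a \<in> Q \<or> b \<in> Q)"
      then have "b \<otimes> c \<notin> saturation R u I" using ab c unfolding col_def by simp
      then have "col (b \<otimes> c) \<in> G" using ab c unfolding G_def by blast
      moreover have "Q \<subseteq> col (b \<otimes> c)"
      proof
        fix e assume "e \<in> Q"
        then have e: "e \<in> carrier R" "e \<otimes> c \<in> saturation R u I" using c unfolding col_def by auto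
        have "e \<otimes> (b \<otimes> c) = b \<otimes> (e \<otimes> c)" using e ab c by (simp add: m_lcomm)
        then show "e \<in> col (b \<otimes> c)" using e ab satID(5) unfolding col_def by simp
      qed
      ultimately have "col (b \<otimes> c) = Q" using Qmax by blast
      moreover have "a \<in> col (b \<otimes> c)"
        using ab c unfolding c(3) col_def by (simp add: m_assoc)
      ultimately show False using n by blast
    qed
  qed
  have "I \<subseteq> Q" using c ID(1) satI(2) satID(6) unfolding col_def
    using I(1) by (blast dest: ideal.I_r_closed)
  moreover have "Q \<subseteq> u"
  proof
    fix b assume "b \<in> Q"
    then show "b \<in> u" using satI(3)[of c b] c unfolding col_def by blast
  qed
  \<comment> \<open>So \<open>u\<close> annihilates \<open>c\<close> modulo the saturation of
    \<open>I\<close>, which makes \<open>c\<close> the socle element.\<close>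
  ultimately have Qu: "col c = u" using only[OF Qp] I(2) c(3) by blast
  let ?Ic = "add_multiples R I c"
  note Ic = add_multiples_ideal[OF I(1) c(1)]
  have "c \<notin> I" using c satI(2) by blast
  then have "DC ?Ic" using Imax[of ?Ic] Ic I(2) unfolding F_def by blast
  from this[unfolded DC_def, rule_format, of "\<lambda>n. add_multiples R (D n) c"]
  obtain N where N: "\<And>n. n \<ge> N \<Longrightarrow>
      add_multiples R (D n) c \<subseteq> saturation R u (add_multiples R (D (Suc n)) c)"
    using add_multiples_ideal(1)[OF D(1) c(1)] add_multiples_mono[OF D(2)] add_multiples_mono[OF D(3)]
    by blast
  \<comment> \<open>Either every \<open>D n\<close> contains \<open>c\<close> locally, and adding
    \<open>c\<close> changes nothing; or from some \<open>m\<close> on, \<open>D n\<close> contains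
    no \<open>b c\<close> with \<open>b \<notin> u\<close>, while those with
    \<open>b \<in> u\<close> already lie in the saturation of \<open>I\<close>.\<close>
  have "\<exists>M. \<forall>n\<ge>M. D n \<subseteq> saturation R u (D (Suc n))"
  proof (cases "\<forall>n. c \<in> saturation R u (D n)")
    case True
    have "D n \<subseteq> saturation R u (D (Suc n))" if "n \<ge> N" for n
    proof
      fix a assume a: "a \<in> D n"
      then have "a \<in> saturation R u (add_multiples R (D (Suc n)) c)"
        using N[OF that] add_multiples_ideal(2)[OF D(1) c(1)] by blast
      then obtain t where t: "a \<in> carrier R" "t \<in> carrier R - u" "t \<otimes> a \<in> add_multiples R (D (Suc n)) c"
        unfolding saturation_def by blast
      note S = saturation_ideal[OF u D(1)[of "Suc n"]]
      have "t \<otimes> a \<in> saturation R u (D (Suc n))"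
        using add_multiples_least[OF S(1,2), of c] True t(3) by blast
      then show "a \<in> saturation R u (D (Suc n))" using S(3) t by blast
    qed
    then show ?thesis by blast
  next
    case False
    then obtain m where m: "c \<notin> saturation R u (D m)" by blast
    have "D n \<subseteq> saturation R u (D (Suc n))" if n: "n \<ge> max N m" for n
    proof
      fix a assume a: "a \<in> D n"
      then have "a \<in> saturation R u (add_multiples R (D (Suc n)) c)"
        using N[of n] n add_multiples_ideal(2)[OF D(1) c(1)] by auto
      then obtain t where t: "a \<in> carrier R" "t \<in> carrier R - u" "t \<otimes> a \<in> add_multiples R (D (Suc n)) c"
        unfolding saturation_def by blast
      then obtain d b where db: "d \<in> D (Suc n)" "b \<in> carrier R" "t \<otimes> a = d \<oplus> b \<otimes> c"
        unfolding add_multiples_def by blast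
      have dc: "d \<in> carrier R" using idealD(1)[OF D(1)] db(1) by blast
      have "b \<otimes> c = t \<otimes> a \<ominus> d"
        unfolding db(3) using dc db(2) c(1) by algebra
      moreover have "t \<otimes> a \<in> D n" "d \<in> D n" using t a db D(3) idealD(5)[OF D(1)] by blast+
      ultimately have "b \<otimes> c \<in> D n" using idealD(4)[OF D(1)] by simp
      then have "b \<in> u"
        using db(2) c(1) m anti[of m n] n unfolding saturation_def by auto
      note S = saturation_ideal[OF u D(1)[of "Suc n"]]
      have "b \<in> col c" using \<open>b \<in> u\<close> Qu by simp
      then have "b \<otimes> c \<in> saturation R u (D (Suc n))"
        using saturation_mono[OF D(2), of R u "Suc n"] unfolding col_def by blast
      then have "t \<otimes> a \<in> saturation R u (D (Suc n))"
        unfolding db(3) using idealD(3)[OF S(1)] S(2) db(1) by blast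
      then show "a \<in> saturation R u (D (Suc n))" using S(3) t by blast
    qed
    then show ?thesis by blast
  qed
  then show False using bad by blast
qed

text \<open>Nakayama's lemma at \<open>u\<close>, where \<open>J = J' + x J\<close> holds after
  localization. Noetherian induction takes the place of generators and determinants: for a maximal
  bad \<open>B\<close> and an element \<open>c\<close> of \<open>J\<close> outside its saturation,
  \<open>J\<close> lies locally in \<open>B + (c)\<close>. Substituting this for \<open>d\<close>
  gives \<open>(t' t - x e) c \<in> B\<close>, with a multiplier outside \<open>u\<close> because
  \<open>x \<in> u\<close>.\<close>

lemma (in cring) nakayama_saturation:
  assumes noeth: "noetherian_ring R" and u: "primeideal u R" and x: "x \<in> u"
    and J: "ideal J R" and J': "ideal J' R" "J' \<subseteq> J"
    and J_le: "\<And>a. a \<in> J \<Longrightarrow> \<exists>t\<in>carrier R - u. \<exists>b\<in>J'. \<exists>d\<in>J. t \<otimes> a = b \<oplus> x \<otimes> d"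
  shows "J \<subseteq> saturation R u J'"
proof (rule ccontr)
  assume n: "\<not> ?thesis"
  interpret noetherian_ring R by fact
  note uD = primeD[OF u]
  note Jc = idealD(1)[OF J]
  define F where "F = {B. ideal B R \<and> J' \<subseteq> B \<and> \<not> J \<subseteq> saturation R u B}"
  have F_ideal: "ideal I R" if "I \<in> F" for I using that unfolding F_def by blast
  have "J' \<in> F" using n J' unfolding F_def by blast
  from ex_maximal_ideal_in[OF F_ideal this]
  obtain B where BF: "B \<in> F" and Bmax: "\<And>B'. B' \<in> F \<Longrightarrow> B \<subseteq> B' \<Longrightarrow> B' = B" by metis
  have B: "ideal B R" "J' \<subseteq> B" using BF unfolding F_def by auto
  note satB = saturation_ideal[OF u B(1)]
  obtain c where c: "c \<in> J" "c \<notin> saturation R u B" using BF unfolding F_def by blast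
  have cc: "c \<in> carrier R" using Jc c by blast
  note Bc = add_multiples_ideal[OF B(1) cc]
  have "c \<notin> B" using c satB(2) by blast
  then have le: "J \<subseteq> saturation R u (add_multiples R B c)"
    using Bmax[of "add_multiples R B c"] Bc B(2) unfolding F_def by blast
  obtain t b d where t: "t \<in> carrier R - u" "b \<in> J'" "d \<in> J" "t \<otimes> c = b \<oplus> x \<otimes> d"
    using J_le[OF c(1)] by blast
  obtain t' where t': "t' \<in> carrier R - u" "t' \<otimes> d \<in> add_multiples R B c"
    using le t(3) unfolding saturation_def by blast
  then obtain b' e where e: "b' \<in> B" "e \<in> carrier R" "t' \<otimes> d = b' \<oplus> e \<otimes> c"
    unfolding add_multiples_def by blast
  have car: "x \<in> carrier R" "b \<in> carrier R" "b' \<in> carrier R" "d \<in> carrier R" "t \<in> carrier R" "t' \<in> carrier R"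
    using x uD(2) t t' e idealD(1)[OF B(1)] B(2) Jc by auto
  have "(t' \<otimes> t \<ominus> x \<otimes> e) \<otimes> c = t' \<otimes> (t \<otimes> c) \<ominus> x \<otimes> (e \<otimes> c)"
    using car e(2) cc by algebra
  also have "\<dots> = t' \<otimes> b \<oplus> x \<otimes> (t' \<otimes> d) \<ominus> x \<otimes> (e \<otimes> c)"
    unfolding t(4) using car e(2) cc by algebra
  also have "\<dots> = t' \<otimes> b \<oplus> x \<otimes> b'"
    unfolding e(3) using car e(2) cc by algebra
  finally have "(t' \<otimes> t \<ominus> x \<otimes> e) \<otimes> c \<in> B"
    using idealD[OF B(1)] t(2) e(1) car B(2) by auto
  moreover have "t' \<otimes> t \<ominus> x \<otimes> e \<notin> u"
  proof
    assume a: "t' \<otimes> t \<ominus> x \<otimes> e \<in> u"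
    have "t' \<otimes> t = (t' \<otimes> t \<ominus> x \<otimes> e) \<oplus> x \<otimes> e" using car e(2) by algebra
    then have "t' \<otimes> t \<in> u" using a x e(2) idealD[OF uD(1)] by metis
    then show False using uD(4) t t' by blast
  qed
  ultimately have "c \<in> saturation R u B"
    unfolding saturation_def using cc car e(2) by auto
  then show False using c by blast
qed

text \<open>The usual argument with the symbolic powers of \<open>r\<close>, carried out modulo \<open>s\<close> and with the
  simpler ideals \<open>J k\<close>, the multiples of \<open>y\<^sup>k\<close> up to a power of \<open>x\<close>, for a fixed \<open>y \<in> r - s\<close>.\<close>

theorem (in cring) principal_ideal_theorem:
  assumes noeth: "noetherian_ring R"
    and primes: "primeideal s R" "primeideal r R" "primeideal u R"
    and strict: "s \<subset> r" "r \<subset> u" and x: "x \<in> u"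
  shows "\<exists>w. primeideal w R \<and> s \<subseteq> w \<and> x \<in> w \<and> w \<subset> u"
proof (rule ccontr)
  assume none: "\<not> ?thesis"
  note sD = primeD[OF primes(1)] and rD = primeD[OF primes(2)] and uD = primeD[OF primes(3)]
  have xr: "x \<notin> r" using none primes(2) strict by blast
  obtain y where y: "y \<in> r" "y \<notin> s" using strict by blast
  have car: "x \<in> carrier R" "y \<in> carrier R" using x uD(2) y rD(2) by auto
  define J where "J k = {a \<in> carrier R. \<exists>m::nat. x [^] m \<otimes> a \<in> add_multiples R s (y [^] k)}" for k :: nat
  have Am: "ideal (add_multiples R s (y [^] k)) R" for k :: nat
    using add_multiples_ideal(1)[OF sD(1)] car by simp
  have J_ideal: "ideal (J k) R" for k
  proof (rule idealI_closed)
    show "J k \<subseteq> carrier R" unfolding J_def by blast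
    show "\<zero> \<in> J k" using idealD(2)[OF Am] car unfolding J_def by auto
  next
    fix a b assume "a \<in> J k" "b \<in> J k"
    then obtain m n :: nat where *: "a \<in> carrier R" "b \<in> carrier R"
      "x [^] m \<otimes> a \<in> add_multiples R s (y [^] k)" "x [^] n \<otimes> b \<in> add_multiples R s (y [^] k)"
      unfolding J_def by blast
    have "x [^] (m + n) \<otimes> (a \<oplus> b) = x [^] n \<otimes> (x [^] m \<otimes> a) \<oplus> x [^] m \<otimes> (x [^] n \<otimes> b)"
      unfolding nat_pow_mult[OF car(1), symmetric] using car * nat_pow_closed[OF car(1), of m] nat_pow_closed[OF car(1), of n] by algebra
    then have "x [^] (m + n) \<otimes> (a \<oplus> b) \<in> add_multiples R s (y [^] k)"
      using idealD(3,5)[OF Am] * car by simp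
    then show "a \<oplus> b \<in> J k" using * unfolding J_def by blast
  next
    fix a c assume "a \<in> J k" and c: "c \<in> carrier R"
    then obtain m :: nat where *: "a \<in> carrier R" "x [^] m \<otimes> a \<in> add_multiples R s (y [^] k)"
      unfolding J_def by blast
    have "x [^] m \<otimes> (c \<otimes> a) = c \<otimes> (x [^] m \<otimes> a)" using car * c by (simp add: m_lcomm)
    then have "x [^] m \<otimes> (c \<otimes> a) \<in> add_multiples R s (y [^] k)" using idealD(5)[OF Am] * c by simp
    then show "c \<otimes> a \<in> J k" using * c unfolding J_def by blast
  qed
  have Am_le: "add_multiples R s (y [^] k) \<subseteq> J k" for k
  proof
    fix a assume a: "a \<in> add_multiples R s (y [^] k)"
    then have "a \<in> carrier R" using idealD(1)[OF Am] by blast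
    moreover from this a have "x [^] (0::nat) \<otimes> a \<in> add_multiples R s (y [^] k)" by simp
    ultimately show "a \<in> J k" unfolding J_def by blast
  qed
  have y_in_J: "y [^] k \<in> J k" for k
    using subsetD[OF Am_le add_multiples_ideal(3)[OF sD(1)]] car by simp
  have s_le_J: "s \<subseteq> J k" for k
    using subset_trans[OF add_multiples_ideal(2)[OF sD(1)] Am_le] car by simp
  have "add_multiples R s (y [^] Suc k) \<subseteq> add_multiples R s (y [^] k)" for k
  proof (rule add_multiples_least[OF Am])
    show "s \<subseteq> add_multiples R s (y [^] k)" using add_multiples_ideal(2)[OF sD(1)] car by simp
    show "y [^] Suc k \<in> add_multiples R s (y [^] k)"
      using add_multiples_ideal(3)[OF sD(1), of "y [^] k"] idealD(6)[OF Am] car by simp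
  qed
  then have J_desc: "J (Suc k) \<subseteq> J k" for k unfolding J_def by blast
  \<comment> \<open>Because powers of \<open>x\<close> are divided out in \<open>J k\<close>,
    multiplication by \<open>x\<close> is injective modulo \<open>J k\<close>. This puts the
    coefficient of \<open>x\<close> in an equation between \<open>D n\<close> and
    \<open>D (Suc n)\<close> back into \<open>J n\<close>, as Nakayama requires.\<close>
  have J_colon: "d \<in> J k" if d: "d \<in> carrier R" "x \<otimes> d \<in> J k" for d k
  proof -
    obtain m :: nat where "x [^] m \<otimes> (x \<otimes> d) \<in> add_multiples R s (y [^] k)"
      using d unfolding J_def by blast
    then have "x [^] Suc m \<otimes> d \<in> add_multiples R s (y [^] k)"
      using d car by (simp add: m_assoc)
    then show ?thesis using d unfolding J_def by blast
  qed
  define D where "D k = add_multiples R (J k) x" for k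
  note D_props = add_multiples_ideal[OF J_ideal car(1)]
  have "\<exists>n. D n \<subseteq> saturation R u (D (Suc n))"
  proof (rule descending_chain_saturation[OF noeth primes(3)])
    show "ideal (add_multiples R s x) R" using add_multiples_ideal[OF sD(1) car(1)] by blast
    show "w = u" if "primeideal w R" "add_multiples R s x \<subseteq> w" "w \<subseteq> u" for w
      using none that add_multiples_ideal[OF sD(1) car(1)] by blast
    show "ideal (D n) R" for n unfolding D_def using D_props by blast
    show "add_multiples R s x \<subseteq> D n" for n unfolding D_def by (rule add_multiples_mono[OF s_le_J])
    show "D (Suc n) \<subseteq> D n" for n unfolding D_def by (rule add_multiples_mono[OF J_desc])
  qed
  then obtain n where n: "D n \<subseteq> saturation R u (D (Suc n))" by blast
  have "J n \<subseteq> saturation R u (J (Suc n))"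
  proof (rule nakayama_saturation[OF noeth primes(3) x J_ideal J_ideal J_desc])
    fix a assume a: "a \<in> J n"
    then have ac: "a \<in> carrier R" unfolding J_def by blast
    have "a \<in> saturation R u (D (Suc n))" using n a D_props(2) unfolding D_def by blast
    then obtain t where t: "t \<in> carrier R - u" "t \<otimes> a \<in> D (Suc n)" unfolding saturation_def by blast
    then obtain b d where bd: "b \<in> J (Suc n)" "d \<in> carrier R" "t \<otimes> a = b \<oplus> d \<otimes> x"
      unfolding D_def add_multiples_def by blast
    have bc: "b \<in> carrier R" using bd unfolding J_def by blast
    have "x \<otimes> d = t \<otimes> a \<ominus> b" unfolding bd(3) using bc bd(2) car by algebra
    moreover have "t \<otimes> a \<in> J n" "b \<in> J n" using t a bd J_desc idealD(5)[OF J_ideal] by blast+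
    ultimately have "x \<otimes> d \<in> J n" using idealD(4)[OF J_ideal] by simp
    then have "d \<in> J n" using J_colon bd(2) by blast
    moreover have "t \<otimes> a = b \<oplus> x \<otimes> d" using bd car by (simp add: m_comm)
    ultimately show "\<exists>t\<in>carrier R - u. \<exists>b\<in>J (Suc n). \<exists>d\<in>J n. t \<otimes> a = b \<oplus> x \<otimes> d"
      using t bd by blast
  qed
  then obtain t where t: "t \<in> carrier R - u" "t \<otimes> y [^] n \<in> J (Suc n)"
    using y_in_J[of n] unfolding saturation_def by blast
  then obtain m :: nat and i a where *: "i \<in> s" "a \<in> carrier R"
     "x [^] m \<otimes> (t \<otimes> y [^] n) = i \<oplus> a \<otimes> y [^] Suc n"
    unfolding J_def add_multiples_def by blast
  have ic: "i \<in> carrier R" using * sD(2) by blast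
  have xm: "x [^] m \<in> carrier R" "y [^] n \<in> carrier R" using car by auto
  \<comment> \<open>Cancelling \<open>y^n\<close> modulo the prime \<open>s\<close> is allowed
    because \<open>y \<notin> s\<close>. Since \<open>y \<in> r\<close>, what remains puts
    \<open>x^m t\<close> into \<open>r\<close>, although neither \<open>x\<close> nor
    \<open>t\<close> lies there.\<close>
  have "(x [^] m \<otimes> t \<ominus> a \<otimes> y) \<otimes> y [^] n = x [^] m \<otimes> (t \<otimes> y [^] n) \<ominus> a \<otimes> y [^] Suc n"
    unfolding nat_pow_Suc using xm *(2) DiffD1[OF t(1)] car by algebra
  also have "\<dots> = i" unfolding *(3) nat_pow_Suc using ic *(2) car xm by algebra
  finally have "(x [^] m \<otimes> t \<ominus> a \<otimes> y) \<otimes> y [^] n \<in> s" using * by simp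
  then have "x [^] m \<otimes> t \<ominus> a \<otimes> y \<in> s"
    using sD(4,5) y car xm * t by (metis DiffD1 m_closed minus_closed)
  then have "x [^] m \<otimes> t \<ominus> a \<otimes> y \<in> r" using strict by blast
  moreover have "a \<otimes> y \<in> r" using y * idealD(5)[OF rD(1)] by blast
  moreover have "x [^] m \<otimes> t = (x [^] m \<otimes> t \<ominus> a \<otimes> y) \<oplus> a \<otimes> y" using xm *(2) DiffD1[OF t(1)] car by algebra
  ultimately have "x [^] m \<otimes> t \<in> r" using idealD(3)[OF rD(1)] by metis
  then have "x [^] m \<in> r \<or> t \<in> r" using rD(4) xm t by blast
  then show False using rD(5)[OF car(1)] xr t strict by blast
qed

section \<open>Chains of primes in Noetherian rings\<close>

text \<open>Relational powers of this relation and of \<open>prime_cover\<close> are chains,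
  respectively saturated chains, counted by their number of steps.\<close>

definition prime_lt :: "('a, 'b) ring_scheme \<Rightarrow> 'a set rel" where
  "prime_lt A = {(p, q). primeideal p A \<and> primeideal q A \<and> p \<subset> q}"

definition prime_cover :: "('a, 'b) ring_scheme \<Rightarrow> 'a set rel" where
  "prime_cover A = {(p, q) \<in> prime_lt A. \<not> (\<exists>r. (p, r) \<in> prime_lt A \<and> (r, q) \<in> prime_lt A)}"

lemma prime_coverD:
  assumes "(p, q) \<in> prime_cover A"
  shows "primeideal p A" "primeideal q A" "p \<subset> q"
    and "\<And>r. primeideal r A \<Longrightarrow> p \<subset> r \<Longrightarrow> \<not> r \<subset> q"
  using assms unfolding prime_cover_def prime_lt_def by auto

lemma prime_coverI:
  assumes "primeideal p A" "primeideal q A" "p \<subset> q"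
    and "\<And>r. primeideal r A \<Longrightarrow> p \<subset> r \<Longrightarrow> r \<subseteq> q \<Longrightarrow> r = q"
  shows "(p, q) \<in> prime_cover A"
  using assms unfolding prime_cover_def prime_lt_def by auto

lemma relpow_prime_lt_subset: "(p, q) \<in> prime_lt A ^^ n \<Longrightarrow> p \<subseteq> q"
  by (induct n arbitrary: q) (auto simp: prime_lt_def)

text \<open>The exchange argument behind Krull's height theorem: for two consecutive steps
  \<open>s \<subset> t \<subset> v\<close> with \<open>x \<in> v\<close>, the principal ideal
  theorem replaces the middle prime by one containing \<open>x\<close>. Repeating this from the top
  of the chain downwards moves \<open>x\<close> to the first step without losing length.\<close>

lemma (in cring) prime_chain_shift:
  assumes "noetherian_ring R"
  shows "(s, u) \<in> prime_lt R ^^ Suc m \<Longrightarrow> x \<in> u \<Longrightarrow>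
    \<exists>w. (s, w) \<in> prime_lt R \<and> x \<in> w \<and> (w, u) \<in> prime_lt R ^^ m"
proof (induct m arbitrary: s)
  case 0 then show ?case by auto
next
  case (Suc m)
  obtain t where t: "(s, t) \<in> prime_lt R" "(t, u) \<in> prime_lt R ^^ Suc m"
    using relpow_Suc_D2[OF Suc.prems(1)] by blast
  from Suc.hyps[OF t(2) Suc.prems(2)] obtain v
    where v: "(t, v) \<in> prime_lt R" "x \<in> v" "(v, u) \<in> prime_lt R ^^ m" by blast
  have pr: "primeideal s R" "primeideal t R" "primeideal v R" "s \<subset> t" "t \<subset> v"
    using t(1) v(1) unfolding prime_lt_def by auto
  show ?case
  proof (cases "x \<in> s")
    case True
    then have "x \<in> t" using pr(4) by blast
    then show ?thesis using t by blast
  next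
    case False
    obtain w where w: "primeideal w R" "s \<subseteq> w" "x \<in> w" "w \<subset> v"
      using principal_ideal_theorem[OF assms pr v(2)] by blast
    then have sw: "(s, w) \<in> prime_lt R" and wv: "(w, v) \<in> prime_lt R"
      using False pr unfolding prime_lt_def by auto
    have "(w, u) \<in> prime_lt R ^^ Suc m" using relpow_Suc_I2[OF wv v(3)] .
    then show ?thesis using w(3) sw by blast
  qed
qed

text \<open>Each element of \<open>F\<close> costs one step of the chain; the one step to spare
  keeps the final inclusion strict.\<close>

lemma (in cring) prime_chain_absorb:
  assumes "noetherian_ring R" "finite F"
  shows "F \<subseteq> u \<Longrightarrow> (s, u) \<in> prime_lt R ^^ Suc (card F) \<Longrightarrow>
    \<exists>w. primeideal w R \<and> s \<subseteq> w \<and> F \<subseteq> w \<and> w \<subset> u"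
  using assms(2)
proof (induct F arbitrary: s)
  case empty then show ?case by (auto simp: prime_lt_def)
next
  case (insert x F)
  then have "(s, u) \<in> prime_lt R ^^ Suc (Suc (card F))" "x \<in> u" by auto
  then obtain v where v: "(s, v) \<in> prime_lt R" "x \<in> v" "(v, u) \<in> prime_lt R ^^ Suc (card F)"
    using prime_chain_shift[OF assms(1)] by blast
  then obtain w where "primeideal w R" "v \<subseteq> w" "F \<subseteq> w" "w \<subset> u" using insert by blast
  then show ?case using v unfolding prime_lt_def by blast
qed

text \<open>Krull's height theorem: if the chain had more steps than \<open>u\<close> has generators
  in \<open>F\<close>, a strictly smaller prime would contain all of them.\<close>

lemma (in cring) prime_chain_bounded:
  assumes "noetherian_ring R" "primeideal u R"
  shows "\<exists>N. \<forall>s. (s, u) \<notin> prime_lt R ^^ Suc N"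
proof -
  interpret noetherian_ring R by fact
  obtain F where F: "F \<subseteq> carrier R" "finite F" "u = Idl F"
    using finetely_gen primeD(1)[OF assms(2)] by blast
  have "(s, u) \<notin> prime_lt R ^^ Suc (card F)" for s
  proof
    assume a: "(s, u) \<in> prime_lt R ^^ Suc (card F)"
    have "F \<subseteq> u" using F genideal_self by blast
    then obtain w where w: "primeideal w R" "F \<subseteq> w" "w \<subset> u"
      using prime_chain_absorb[OF assms(1) F(2) _ a] by blast
    have "Idl F \<subseteq> w" using genideal_minimal[OF primeD(1)[OF w(1)] w(2)] .
    then show False using w(3) F(3) by blast
  qed
  then show ?thesis by blast
qed

lemma (in cring) ex_longest_prime_chain:
  assumes "noetherian_ring R" "(p, q) \<in> prime_lt R"
  obtains k where "(p, q) \<in> prime_lt R ^^ Suc k" "(p, q) \<notin> prime_lt R ^^ Suc (Suc k)"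
proof -
  have "primeideal q R" using assms(2) unfolding prime_lt_def by blast
  then obtain N where N: "(p, q) \<notin> prime_lt R ^^ Suc N"
    using prime_chain_bounded[OF assms(1)] by blast
  have "\<exists>k. (p, q) \<in> prime_lt R ^^ Suc k \<and> (p, q) \<notin> prime_lt R ^^ Suc (Suc k)"
  proof (rule ccontr)
    assume none: "\<not> ?thesis"
    have "(p, q) \<in> prime_lt R ^^ Suc k" for k
      by (induct k) (use assms(2) none in auto)
    then show False using N by blast
  qed
  then show ?thesis using that by blast
qed

lemma longest_prime_chain_saturated:
  "(p, q) \<in> prime_lt A ^^ k \<Longrightarrow> (p, q) \<notin> prime_lt A ^^ Suc k \<Longrightarrow> (p, q) \<in> prime_cover A ^^ k"
proof (induct k arbitrary: q)
  case 0 then show ?case by simp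
next
  case (Suc k)
  then obtain r where r: "(p, r) \<in> prime_lt A ^^ k" "(r, q) \<in> prime_lt A" by auto
  have "(p, r) \<notin> prime_lt A ^^ Suc k" using r(2) Suc.prems(2) by auto
  then have "(p, r) \<in> prime_cover A ^^ k" using Suc.hyps r(1) by blast
  moreover have "(r, q) \<in> prime_cover A"
  proof (rule ccontr)
    assume "(r, q) \<notin> prime_cover A"
    then obtain m where "(r, m) \<in> prime_lt A" "(m, q) \<in> prime_lt A"
      using r(2) unfolding prime_cover_def by blast
    then have "(p, q) \<in> prime_lt A ^^ Suc (Suc k)" using r(1) by auto
    then show False using Suc.prems(2) by blast
  qed
  ultimately show ?case by auto
qed

lemma (in cring) prime_lt_imp_cover_chain:
  assumes "noetherian_ring R" "(p, q) \<in> prime_lt R"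
  shows "\<exists>k. (p, q) \<in> prime_cover R ^^ Suc k"
proof -
  obtain k where k: "(p, q) \<in> prime_lt R ^^ Suc k" "(p, q) \<notin> prime_lt R ^^ Suc (Suc k)"
    using ex_longest_prime_chain[OF assms] .
  show ?thesis using longest_prime_chain_saturated[OF k] by blast
qed

text \<open>A longest chain from zero to \<open>P\<close> is rerouted so that its first step
  contains \<open>x\<close>. Its length is still the greatest possible, so no prime fits below that
  first step.\<close>

lemma (in "domain") ex_height_one_prime:
  assumes "noetherian_ring R" "primeideal P R" "x \<in> P" "x \<noteq> \<zero>"
  shows "\<exists>u. ({\<zero>}, u) \<in> prime_cover R \<and> x \<in> u \<and> u \<subseteq> P"
proof -
  have "\<zero> \<in> P" using idealD(2)[OF primeD(1)[OF assms(2)]] .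
  then have "({\<zero>}, P) \<in> prime_lt R"
    using assms zeroprimeideal unfolding prime_lt_def by auto
  then obtain k where k: "({\<zero>}, P) \<in> prime_lt R ^^ Suc k" "({\<zero>}, P) \<notin> prime_lt R ^^ Suc (Suc k)"
    using ex_longest_prime_chain[OF assms(1)] by blast
  obtain w where w: "({\<zero>}, w) \<in> prime_lt R" "x \<in> w" "(w, P) \<in> prime_lt R ^^ k"
    using prime_chain_shift[OF assms(1) k(1) assms(3)] by blast
  have "({\<zero>}, w) \<in> prime_cover R"
  proof (rule ccontr)
    assume "({\<zero>}, w) \<notin> prime_cover R"
    then obtain m where m: "({\<zero>}, m) \<in> prime_lt R" "(m, w) \<in> prime_lt R"
      using w(1) unfolding prime_cover_def by blast
    have "({\<zero>}, P) \<in> prime_lt R ^^ Suc (Suc k)"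
      by (rule relpow_Suc_I2[OF m(1) relpow_Suc_I2[OF m(2) w(3)]])
    then show False using k(2) by blast
  qed
  then show ?thesis using w relpow_prime_lt_subset by blast
qed

section \<open>Subrings of a field and adjunction of one element\<close>

locale ambient_field = field K for K (structure)
begin

section \<open>Ideals and primes of a subring, expressed in the operations of the field\<close>

lemma subr_domain: "subring A K \<Longrightarrow> domain (subr K A)"
  by (rule subring_is_domain)

lemma subr_cring: "subring A K \<Longrightarrow> cring (subr K A)"
  using subr_domain by (simp add: domain_def)

lemma subr_minus_closed: "subring A K \<Longrightarrow> a \<in> A \<Longrightarrow> b \<in> A \<Longrightarrow> a \<ominus> b \<in> A"
  unfolding a_minus_def by (simp add: subringE)

lemma subr_pow_closed: "subring A K \<Longrightarrow> a \<in> A \<Longrightarrow> a [^] (n::nat) \<in> A"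
  by (induct n) (auto simp: subringE)

lemma subr_idealI:
  assumes "subring A K" "I \<subseteq> A" "\<zero> \<in> I"
    and "\<And>a b. a \<in> I \<Longrightarrow> b \<in> I \<Longrightarrow> a \<oplus> b \<in> I"
    and "\<And>a c. a \<in> I \<Longrightarrow> c \<in> A \<Longrightarrow> c \<otimes> a \<in> I"
  shows "ideal I (subr K A)"
  using cring.idealI_closed[OF subr_cring[OF assms(1)], of I] assms by simp

lemma subr_idealD:
  assumes "subring A K" "ideal I (subr K A)"
  shows "I \<subseteq> A" "I \<subseteq> carrier K" "\<zero> \<in> I"
    and "\<And>a b. a \<in> I \<Longrightarrow> b \<in> I \<Longrightarrow> a \<oplus> b \<in> I"
    and "\<And>a b. a \<in> I \<Longrightarrow> b \<in> I \<Longrightarrow> a \<ominus> b \<in> I"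
    and "\<And>a c. a \<in> I \<Longrightarrow> c \<in> A \<Longrightarrow> c \<otimes> a \<in> I"
    and "\<And>a c. a \<in> I \<Longrightarrow> c \<in> A \<Longrightarrow> a \<otimes> c \<in> I"
proof -
  note D = cring.idealD[OF subr_cring[OF assms(1)] assms(2), simplified]
  note A = subringE[OF assms(1)]
  show "I \<subseteq> A" "I \<subseteq> carrier K" "\<zero> \<in> I"
    "\<And>a b. a \<in> I \<Longrightarrow> b \<in> I \<Longrightarrow> a \<oplus> b \<in> I"
    "\<And>a c. a \<in> I \<Longrightarrow> c \<in> A \<Longrightarrow> c \<otimes> a \<in> I"
    "\<And>a c. a \<in> I \<Longrightarrow> c \<in> A \<Longrightarrow> a \<otimes> c \<in> I"
    using D A(1) by auto
  show "a \<ominus> b \<in> I" if "a \<in> I" "b \<in> I" for a b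
  proof -
    have "a \<in> carrier K" "b \<in> carrier K" using that D(1) A(1) by auto
    then have "a \<ominus> b = a \<oplus> (\<ominus> \<one>) \<otimes> b" by algebra
    moreover have "(\<ominus> \<one>) \<otimes> b \<in> I" using D(5) A(3,5) that by blast
    ultimately show ?thesis using D(3) that by simp
  qed
qed

lemma subr_primeI:
  assumes "subring A K" "P \<subseteq> A" "\<zero> \<in> P" "\<one> \<notin> P"
    and "\<And>a b. a \<in> P \<Longrightarrow> b \<in> P \<Longrightarrow> a \<oplus> b \<in> P"
    and "\<And>a c. a \<in> P \<Longrightarrow> c \<in> A \<Longrightarrow> c \<otimes> a \<in> P"
    and "\<And>a b. a \<in> A \<Longrightarrow> b \<in> A \<Longrightarrow> a \<otimes> b \<in> P \<Longrightarrow> a \<in> P \<or> b \<in> P"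
  shows "primeideal P (subr K A)"
proof (rule primeidealI[OF _ subr_cring[OF assms(1)]])
  show "ideal P (subr K A)" by (rule subr_idealI) (use assms in auto)
  show "carrier (subr K A) \<noteq> P" using assms(4) subringE(3)[OF assms(1)] by auto
qed (use assms in auto)

lemma subr_primeD:
  assumes "subring A K" "primeideal P (subr K A)"
  shows "P \<subseteq> A" "P \<subseteq> carrier K" "\<zero> \<in> P" "\<one> \<notin> P"
    and "\<And>a b. a \<in> P \<Longrightarrow> b \<in> P \<Longrightarrow> a \<oplus> b \<in> P"
    and "\<And>a b. a \<in> P \<Longrightarrow> b \<in> P \<Longrightarrow> a \<ominus> b \<in> P"
    and "\<And>a c. a \<in> P \<Longrightarrow> c \<in> A \<Longrightarrow> c \<otimes> a \<in> P"
    and "\<And>a c. a \<in> P \<Longrightarrow> c \<in> A \<Longrightarrow> a \<otimes> c \<in> P"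
    and "\<And>a b. a \<in> A \<Longrightarrow> b \<in> A \<Longrightarrow> a \<otimes> b \<in> P \<Longrightarrow> a \<in> P \<or> b \<in> P"
  using subr_idealD[OF assms(1) cring.primeD(1)[OF subr_cring[OF assms(1)] assms(2)]]
    cring.primeD[OF subr_cring[OF assms(1)] assms(2), simplified] by auto

lemma subr_prime_zero: "subring A K \<Longrightarrow> primeideal {\<zero>} (subr K A)"
  using domain.zeroprimeideal[OF subr_domain] by simp

lemma subr_prime_contract:
  assumes "subring A K" "subring B K" "A \<subseteq> B" "primeideal P (subr K B)"
  shows "primeideal (P \<inter> A) (subr K A)"
  using subr_primeD[OF assms(2,4)] subringE[OF assms(1)] assms(3)
  by (intro subr_primeI[OF assms(1)]) (auto simp: subset_iff)

text \<open>The \<open>A\<close>-span of the first \<open>n\<close> powers of \<open>x\<close>, with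
  exponents from 0 to \<open>n - 1\<close>. Its elements are values in \<open>K\<close> and not
  polynomials, so a representation need not be unique.\<close>

primrec poly_span :: "'a set \<Rightarrow> 'a \<Rightarrow> nat \<Rightarrow> 'a set" where
  "poly_span A x 0 = {\<zero>}"
| "poly_span A x (Suc n) = {t \<oplus> c \<otimes> x [^] n | t c. t \<in> poly_span A x n \<and> c \<in> A}"

definition adjoin :: "'a set \<Rightarrow> 'a \<Rightarrow> 'a set" where
  "adjoin A x = (\<Union>n. poly_span A x n)"

context
  fixes A x assumes A: "subring A K" and x: "x \<in> carrier K"
begin

lemma poly_span_carrier: "poly_span A x n \<subseteq> carrier K"
  using subringE(1)[OF A] x by (induct n) auto

lemma poly_span_zero: "\<zero> \<in> poly_span A x n"
proof (induct n)
  case (Suc n)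
  have "\<zero> = \<zero> \<oplus> \<zero> \<otimes> x [^] n" using x by simp
  then show ?case using Suc subringE(2)[OF A] by auto
qed simp

lemma poly_span_Suc_mono: "poly_span A x n \<subseteq> poly_span A x (Suc n)"
proof
  fix t assume "t \<in> poly_span A x n"
  moreover from this have "t = t \<oplus> \<zero> \<otimes> x [^] n" using subsetD[OF poly_span_carrier] x by simp
  ultimately show "t \<in> poly_span A x (Suc n)" using subringE(2)[OF A] by auto
qed

lemma poly_span_mono: "m \<le> n \<Longrightarrow> poly_span A x m \<subseteq> poly_span A x n"
  using lift_Suc_mono_le[of "poly_span A x", OF poly_span_Suc_mono] .

lemma poly_span_add: "s \<in> poly_span A x n \<Longrightarrow> t \<in> poly_span A x n \<Longrightarrow> s \<oplus> t \<in> poly_span A x n"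
proof (induct n arbitrary: s t)
  case (Suc n)
  then obtain s' c t' d where *: "s = s' \<oplus> c \<otimes> x [^] n" "t = t' \<oplus> d \<otimes> x [^] n"
    "s' \<in> poly_span A x n" "t' \<in> poly_span A x n" "c \<in> A" "d \<in> A" by auto
  have "s' \<in> carrier K" "t' \<in> carrier K" "c \<in> carrier K" "d \<in> carrier K" "x [^] n \<in> carrier K"
    using * poly_span_carrier subringE(1)[OF A] x by auto
  then have "s \<oplus> t = (s' \<oplus> t') \<oplus> (c \<oplus> d) \<otimes> x [^] n" unfolding * by algebra
  then show ?case using Suc.hyps[OF *(3,4)] subringE(7)[OF A *(5,6)] by auto
qed simp

lemma poly_span_smult: "t \<in> poly_span A x n \<Longrightarrow> d \<in> A \<Longrightarrow> d \<otimes> t \<in> poly_span A x n"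
proof (induct n arbitrary: t)
  case 0 then show ?case using subringE(1)[OF A] by auto
next
  case (Suc n)
  then obtain t' c where *: "t = t' \<oplus> c \<otimes> x [^] n" "t' \<in> poly_span A x n" "c \<in> A" by auto
  have "d \<in> carrier K" "t' \<in> carrier K" "c \<in> carrier K" "x [^] n \<in> carrier K"
    using * Suc.prems poly_span_carrier subringE(1)[OF A] x by auto
  then have "d \<otimes> t = d \<otimes> t' \<oplus> (d \<otimes> c) \<otimes> x [^] n" unfolding * by algebra
  then show ?case using Suc.hyps[OF *(2) Suc.prems(2)] subringE(6)[OF A Suc.prems(2) *(3)] by auto
qed

lemma poly_span_minus: "s \<in> poly_span A x n \<Longrightarrow> t \<in> poly_span A x n \<Longrightarrow> s \<ominus> t \<in> poly_span A x n"
proof -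
  assume *: "s \<in> poly_span A x n" "t \<in> poly_span A x n"
  then have "s \<in> carrier K" "t \<in> carrier K" using poly_span_carrier by auto
  then have "s \<ominus> t = s \<oplus> (\<ominus> \<one>) \<otimes> t" by algebra
  then show ?thesis using poly_span_add poly_span_smult * subringE(3,5)[OF A] by auto
qed

lemma poly_span_shift: "t \<in> poly_span A x n \<Longrightarrow> t \<otimes> x \<in> poly_span A x (Suc n)"
proof (induct n arbitrary: t)
  case 0 then show ?case using poly_span_zero[of 1] x by simp
next
  case (Suc n)
  then obtain t' c where *: "t = t' \<oplus> c \<otimes> x [^] n" "t' \<in> poly_span A x n" "c \<in> A" by auto
  have "t' \<in> carrier K" "c \<in> carrier K" "x [^] n \<in> carrier K"
    using * poly_span_carrier subringE(1)[OF A] x by auto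
  then have "t \<otimes> x = t' \<otimes> x \<oplus> c \<otimes> x [^] Suc n" unfolding * nat_pow_Suc using x by algebra
  then show ?case using Suc.hyps[OF *(2)] *(3) poly_span.simps(2)[of A x "Suc n"] by blast
qed

lemma poly_span_shift_pow: "t \<in> poly_span A x n \<Longrightarrow> t \<otimes> x [^] k \<in> poly_span A x (n + k)"
proof (induct k)
  case 0 then show ?case using poly_span_carrier[of n] by auto
next
  case (Suc k)
  have "t \<in> carrier K" using Suc.prems poly_span_carrier by auto
  then have "t \<otimes> x [^] Suc k = (t \<otimes> x [^] k) \<otimes> x" using x by (simp add: m_assoc)
  then show ?case using poly_span_shift[OF Suc.hyps[OF Suc.prems]] by simp
qed

lemma poly_span_mult: "s \<in> poly_span A x m \<Longrightarrow> t \<in> poly_span A x n \<Longrightarrow> s \<otimes> t \<in> poly_span A x (m + n)"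
proof (induct m arbitrary: s)
  case 0 then show ?case using poly_span_carrier[of n] poly_span_zero by auto
next
  case (Suc m)
  then obtain s' c where *: "s = s' \<oplus> c \<otimes> x [^] m" "s' \<in> poly_span A x m" "c \<in> A" by auto
  have "s' \<in> carrier K" "c \<in> carrier K" "t \<in> carrier K" "x [^] m \<in> carrier K"
    using * Suc.prems poly_span_carrier subringE(1)[OF A] x by auto
  then have eq: "s \<otimes> t = s' \<otimes> t \<oplus> c \<otimes> (t \<otimes> x [^] m)" unfolding * by algebra
  have "s' \<otimes> t \<in> poly_span A x (Suc m + n)"
    using Suc.hyps[OF *(2) Suc.prems(2)] poly_span_mono[of "m + n" "Suc m + n"] by auto
  moreover have "c \<otimes> (t \<otimes> x [^] m) \<in> poly_span A x (Suc m + n)"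
    by (rule subsetD[OF poly_span_mono poly_span_smult[OF poly_span_shift_pow[OF Suc.prems(2)] *(3)]]) simp
  ultimately show ?case unfolding eq by (rule poly_span_add)
qed

lemma poly_span_one: "c \<in> A \<Longrightarrow> c \<in> poly_span A x (Suc 0)"
proof -
  assume "c \<in> A"
  then have "c = \<zero> \<oplus> c \<otimes> x [^] (0::nat)" using subringE(1)[OF A] by auto
  then show ?thesis using \<open>c \<in> A\<close> by auto
qed

lemma adjoin_subring: "subring (adjoin A x) K"
proof (rule subringI)
  show "adjoin A x \<subseteq> carrier K" unfolding adjoin_def using poly_span_carrier by blast
  show "\<one> \<in> adjoin A x" unfolding adjoin_def using poly_span_one subringE(3)[OF A] by blast
  show "\<ominus> h \<in> adjoin A x" if h: "h \<in> adjoin A x" for h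
  proof -
    obtain n where n: "h \<in> poly_span A x n" using h unfolding adjoin_def by blast
    have "\<ominus> h = \<zero> \<ominus> h" using subsetD[OF poly_span_carrier n] by (simp add: a_minus_def)
    then show ?thesis using poly_span_minus[OF poly_span_zero n] unfolding adjoin_def by auto
  qed
  show "s \<otimes> t \<in> adjoin A x" if "s \<in> adjoin A x" "t \<in> adjoin A x" for s t
    using that poly_span_mult unfolding adjoin_def by blast
  show "s \<oplus> t \<in> adjoin A x" if st: "s \<in> adjoin A x" "t \<in> adjoin A x" for s t
  proof -
    obtain m n where "s \<in> poly_span A x m" "t \<in> poly_span A x n" using st unfolding adjoin_def by blast
    then have "s \<in> poly_span A x (max m n)" "t \<in> poly_span A x (max m n)"
      using poly_span_mono[of m "max m n"] poly_span_mono[of n "max m n"] by auto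
    then show ?thesis using poly_span_add unfolding adjoin_def by blast
  qed
qed

lemma adjoin_contains: "A \<subseteq> adjoin A x" "x \<in> adjoin A x"
proof -
  show "A \<subseteq> adjoin A x" using poly_span_one unfolding adjoin_def by blast
  have "x \<in> poly_span A x (Suc (Suc 0))"
    using poly_span_shift[OF poly_span_one[OF subringE(3)[OF A]]] x by (simp only: l_one)
  then show "x \<in> adjoin A x" unfolding adjoin_def by blast
qed

lemma adjoin_least:
  assumes "subring B K" "A \<subseteq> B" "x \<in> B"
  shows "adjoin A x \<subseteq> B"
proof -
  have "poly_span A x n \<subseteq> B" for n
  proof (induct n)
    case 0 then show ?case using subringE(2)[OF assms(1)] by simp
  next
    case (Suc n)
    have "t \<oplus> c \<otimes> x [^] n \<in> B" if "t \<in> poly_span A x n" "c \<in> A" for t c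
      using subringE(6,7)[OF assms(1)] subr_pow_closed[OF assms(1,3)] Suc assms(2) that by blast
    then show ?case by auto
  qed
  then show ?thesis unfolding adjoin_def by blast
qed

lemma poly_span_finsum:
  "t \<in> poly_span A x n \<Longrightarrow> \<exists>c. (\<forall>i. c i \<in> A) \<and> t = (\<Oplus>i\<in>{..<n}. c i \<otimes> x [^] i)"
proof (induct n arbitrary: t)
  case 0
  then show ?case using subringE(2)[OF A] by (intro exI[of _ "\<lambda>_. \<zero>"]) simp
next
  case (Suc n)
  then obtain t' d where *: "t = t' \<oplus> d \<otimes> x [^] n" "t' \<in> poly_span A x n" "d \<in> A" by auto
  obtain c where c: "\<forall>i. c i \<in> A" "t' = (\<Oplus>i\<in>{..<n}. c i \<otimes> x [^] i)" using Suc.hyps[OF *(2)] by blast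
  have cc: "c i \<in> carrier K" "d \<in> carrier K" for i using c(1) *(3) subringE(1)[OF A] by auto
  let ?c = "c(n := d)"
  have "(\<Oplus>i\<in>{..<n}. ?c i \<otimes> x [^] i) = t'"
    unfolding c(2) by (rule finsum_cong') (use cc x in auto)
  then have "t = (\<Oplus>i\<in>insert n {..<n}. ?c i \<otimes> x [^] i)"
    unfolding *(1) using cc x poly_span_carrier[of n] *(2)
    by (subst finsum_insert) (auto simp: a_comm)
  then show ?case using c(1) *(3) by (intro exI[of _ ?c]) (auto simp: lessThan_Suc)
qed

text \<open>Hilbert's basis theorem for an algebra generated by one element, by comparing the
  ideals of leading coefficients.\<close>

lemma adjoin_noetherian:
  assumes "noetherian_ring (subr K A)"
  shows "noetherian_ring (subr K (adjoin A x))"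
proof -
  interpret NA: noetherian_ring "subr K A" by fact
  note T = adjoin_subring
  interpret T: cring "subr K (adjoin A x)" using subr_cring[OF T] .
  \<comment> \<open>Representations by powers of \<open>x\<close> are not unique, so
    \<open>a\<close> counts as a leading coefficient as soon as one representation of an element of
    \<open>I\<close> has it in position \<open>n\<close>.\<close>
  define L where "L n I = {a \<in> A. \<exists>t\<in>poly_span A x n. t \<oplus> a \<otimes> x [^] n \<in> I}" for n I
  have L_mono: "L n I \<subseteq> L n J" if "I \<subseteq> J" for n I J using that unfolding L_def by blast
  have A_car: "a \<in> carrier K" if "a \<in> A" for a using that subringE(1)[OF A] by blast
  have L_ideal: "ideal (L n I) (subr K A)" if I: "ideal I (subr K (adjoin A x))" for n I
  proof (rule subr_idealI[OF A])
    note ID = subr_idealD[OF T I]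
    show "L n I \<subseteq> A" unfolding L_def by blast
    have "\<zero> \<oplus> \<zero> \<otimes> x [^] n \<in> I" using ID(3) x by simp
    then show "\<zero> \<in> L n I" unfolding L_def using poly_span_zero subringE(2)[OF A] by blast
  next
    note ID = subr_idealD[OF T I]
    fix a b assume "a \<in> L n I" "b \<in> L n I"
    then obtain s t where *: "a \<in> A" "b \<in> A" "s \<in> poly_span A x n" "t \<in> poly_span A x n"
      "s \<oplus> a \<otimes> x [^] n \<in> I" "t \<oplus> b \<otimes> x [^] n \<in> I" unfolding L_def by blast
    have "a \<in> carrier K" "b \<in> carrier K" "s \<in> carrier K" "t \<in> carrier K" "x [^] n \<in> carrier K"
      using * A_car poly_span_carrier x by auto
    then have "(s \<oplus> t) \<oplus> (a \<oplus> b) \<otimes> x [^] n = (s \<oplus> a \<otimes> x [^] n) \<oplus> (t \<oplus> b \<otimes> x [^] n)" by algebra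
    then have "(s \<oplus> t) \<oplus> (a \<oplus> b) \<otimes> x [^] n \<in> I" using ID(4) * by simp
    then show "a \<oplus> b \<in> L n I"
      unfolding L_def using subringE(7)[OF A] poly_span_add * by blast
  next
    note ID = subr_idealD[OF T I]
    fix a c assume "a \<in> L n I" and c: "c \<in> A"
    then obtain s where *: "a \<in> A" "s \<in> poly_span A x n" "s \<oplus> a \<otimes> x [^] n \<in> I"
      unfolding L_def by blast
    have "a \<in> carrier K" "c \<in> carrier K" "s \<in> carrier K" "x [^] n \<in> carrier K"
      using * A_car poly_span_carrier x c by auto
    then have "c \<otimes> s \<oplus> (c \<otimes> a) \<otimes> x [^] n = c \<otimes> (s \<oplus> a \<otimes> x [^] n)" by algebra
    then have "c \<otimes> s \<oplus> (c \<otimes> a) \<otimes> x [^] n \<in> I" using ID(6)[OF *(3)] adjoin_contains(1) c by auto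
    then show "c \<otimes> a \<in> L n I"
      unfolding L_def using subringE(6)[OF A] poly_span_smult * c by blast
  qed
  have L_Suc: "L n I \<subseteq> L (Suc n) I" if I: "ideal I (subr K (adjoin A x))" for n I
  proof
    fix a assume "a \<in> L n I"
    then obtain t where t: "a \<in> A" "t \<in> poly_span A x n" "t \<oplus> a \<otimes> x [^] n \<in> I"
      unfolding L_def by blast
    have "a \<in> carrier K" "t \<in> carrier K" "x [^] n \<in> carrier K"
      using t A_car poly_span_carrier x by auto
    then have "t \<otimes> x \<oplus> a \<otimes> x [^] Suc n = (t \<oplus> a \<otimes> x [^] n) \<otimes> x" unfolding nat_pow_Suc using x by algebra
    then have "t \<otimes> x \<oplus> a \<otimes> x [^] Suc n \<in> I" using subr_idealD(7)[OF T I t(3) adjoin_contains(2)] by simp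
    then show "a \<in> L (Suc n) I" unfolding L_def using t poly_span_shift by blast
  qed
  show ?thesis
  proof (rule T.trivial_ideal_chain_imp_noetherian)
    fix C assume ne: "C \<noteq> {}" and "subset.chain {I. ideal I (subr K (adjoin A x))} C"
    then have Ci: "ideal I (subr K (adjoin A x))" if "I \<in> C" for I
      using that unfolding pred_on.chain_def by blast
    have Cc: "I \<subseteq> J \<or> J \<subseteq> I" if "I \<in> C" "J \<in> C" for I J
      using \<open>subset.chain _ C\<close> that unfolding pred_on.chain_def by blast
    have "\<exists>I\<in>C. \<forall>J\<in>C. L n J \<subseteq> L n I" for n
    proof -
      have "subset.chain {I. ideal I (subr K A)} (L n ` C)"
        unfolding subset_chain_def
      proof (intro conjI ballI)
        show "L n ` C \<subseteq> {I. ideal I (subr K A)}" using Ci L_ideal by auto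
        fix Q Q' assume "Q \<in> L n ` C" "Q' \<in> L n ` C"
        then obtain I J where "I \<in> C" "J \<in> C" "Q = L n I" "Q' = L n J" by blast
        then show "Q \<subseteq> Q' \<or> Q' \<subseteq> Q" using Cc[of I J] L_mono[of I J n] L_mono[of J I n] by blast
      qed
      then have "\<Union>(L n ` C) \<in> L n ` C" using NA.ideal_chain_is_trivial[of "L n ` C"] ne by blast
      then obtain I where "I \<in> C" "L n I = \<Union>(L n ` C)" by force
      then show ?thesis by blast
    qed
    \<comment> \<open>In each degree one member of \<open>C\<close> attains the largest ideal of
      leading coefficients. These ideals stabilize at some \<open>N\<close>, so a single member
      \<open>I\<close> above \<open>Im 0, ..., Im N\<close> attains the largest one in every
      degree.\<close>
    then obtain Im where Im: "\<And>n. Im n \<in> C" "\<And>n J. J \<in> C \<Longrightarrow> L n J \<subseteq> L n (Im n)" by metis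
    define M where "M n = L n (Im n)" for n
    have M_mono: "M m \<subseteq> M n" if "m \<le> n" for m n
    proof (rule lift_Suc_mono_le[OF _ that])
      show "M n \<subseteq> M (Suc n)" for n
        using L_Suc[OF Ci[OF Im(1)], of n n] Im(2)[OF Im(1), of "Suc n" n] unfolding M_def by blast
    qed
    have "subset.chain {I. ideal I (subr K A)} (range M)"
      unfolding subset_chain_def
    proof (intro conjI ballI)
      show "range M \<subseteq> {I. ideal I (subr K A)}" using L_ideal Ci Im(1) unfolding M_def by auto
      fix Q Q' assume "Q \<in> range M" "Q' \<in> range M"
      then obtain m n where "Q = M m" "Q' = M n" by blast
      then show "Q \<subseteq> Q' \<or> Q' \<subseteq> Q" using M_mono[of m n] M_mono[of n m] linear[of m n] by blast
    qed
    then have "\<Union>(range M) \<in> range M" using NA.ideal_chain_is_trivial[of "range M"] by blast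
    then obtain N where N: "\<And>n. M n \<subseteq> M N" by (metis (no_types, lifting) UN_upper UNIV_I rangeE)
    have "\<exists>I\<in>C. \<forall>n\<le>k. Im n \<subseteq> I" for k
    proof (induct k)
      case 0 then show ?case using Im(1) by blast
    next
      case (Suc k)
      then obtain I where I: "I \<in> C" "\<forall>n\<le>k. Im n \<subseteq> I" by blast
      show ?case
      proof (cases "I \<subseteq> Im (Suc k)")
        case True then show ?thesis using I Im(1) by (metis le_Suc_eq order.refl subset_trans)
      next
        case False
        then have "Im (Suc k) \<subseteq> I" using Cc I(1) Im(1) by blast
        then show ?thesis using I by (metis le_Suc_eq)
      qed
    qed
    then obtain I where I: "I \<in> C" "\<And>n. n \<le> N \<Longrightarrow> Im n \<subseteq> I" by blast
    note ID = subr_idealD[OF T Ci[OF I(1)]]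
    have M_le: "M n \<subseteq> L n I" for n
    proof (cases "n \<le> N")
      case True then show ?thesis using I(2) L_mono unfolding M_def by blast
    next
      case False
      have "L N I \<subseteq> L n I"
        using False by (intro lift_Suc_mono_le[of "\<lambda>n. L n I", OF L_Suc[OF Ci[OF I(1)]]]) simp
      moreover have "M N \<subseteq> L N I" using I(2) L_mono unfolding M_def by blast
      ultimately show ?thesis using N by blast
    qed
    have "J \<subseteq> I" if J: "J \<in> C" for J
    proof (rule ccontr)
      assume "\<not> J \<subseteq> I"
      then have IJ: "I \<subseteq> J" using Cc I(1) J by blast
      note JD = subr_idealD[OF T Ci[OF J]]
      have "f \<in> J \<Longrightarrow> f \<in> poly_span A x n \<Longrightarrow> f \<in> I" for f n
      proof (induct n arbitrary: f)
        case 0 then show ?case using ID(3) by simp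
      next
        case (Suc n)
        then obtain t a where f: "f = t \<oplus> a \<otimes> x [^] n" "t \<in> poly_span A x n" "a \<in> A" by auto
        then have "a \<in> L n J" using Suc.prems(1) unfolding L_def by blast
        then have "a \<in> L n I" using Im(2)[OF J] M_le unfolding M_def by blast
        then obtain t' where t': "t' \<in> poly_span A x n" "t' \<oplus> a \<otimes> x [^] n \<in> I" unfolding L_def by blast
        have car: "a \<in> carrier K" "t \<in> carrier K" "t' \<in> carrier K" "x [^] n \<in> carrier K"
          using f t' A_car poly_span_carrier x by auto
        have "t \<ominus> t' = f \<ominus> (t' \<oplus> a \<otimes> x [^] n)" unfolding f using car by algebra
        then have "t \<ominus> t' \<in> J" using JD(5) Suc.prems(1) t'(2) IJ by auto
        then have "t \<ominus> t' \<in> I" using Suc.hyps poly_span_minus f t' by blast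
        moreover have "f = (t \<ominus> t') \<oplus> (t' \<oplus> a \<otimes> x [^] n)" unfolding f using car by algebra
        ultimately show ?case using ID(4) t'(2) by simp
      qed
      then have "J \<subseteq> I" using JD(1) unfolding adjoin_def by blast
      then show False using \<open>\<not> J \<subseteq> I\<close> by blast
    qed
    then have "\<Union>C = I" using I(1) by blast
    then show "\<Union>C \<in> C" using I(1) by simp
  qed
qed

end

end

section \<open>Saturated chains under surjective homomorphisms and the polynomial ring in one variable\<close>

definition hom_vimage :: "('a, 'c) ring_scheme \<Rightarrow> ('a \<Rightarrow> 'b) \<Rightarrow> 'b set \<Rightarrow> 'a set" where
  "hom_vimage B h P = {b \<in> carrier B. h b \<in> P}"

text \<open>Primes of \<open>C\<close> correspond to the primes of \<open>B\<close> above the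
  kernel. A prime between two preimages contains the kernel, so it is itself a preimage and nothing
  new can appear between them.\<close>

lemma prime_cover_vimage:
  assumes h: "ring_hom_ring B C h" and B: "cring B" and C: "cring C"
    and surj: "h ` carrier B = carrier C" and cover: "(p, q) \<in> prime_cover C"
  shows "(hom_vimage B h p, hom_vimage B h q) \<in> prime_cover B"
proof (rule prime_coverI)
  interpret h: ring_hom_ring B C h by fact
  note pq = prime_coverD[OF cover]
  note pD = cring.primeD[OF C pq(1)] and qD = cring.primeD[OF C pq(2)]
  show p': "primeideal (hom_vimage B h p) B" and q': "primeideal (hom_vimage B h q) B"
    using h.primeideal_vimage[OF B] pq unfolding hom_vimage_def by auto
  have "hom_vimage B h p \<noteq> hom_vimage B h q"
  proof -
    obtain c where c: "c \<in> q" "c \<notin> p" using pq(3) by blast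
    then obtain b where "b \<in> carrier B" "c = h b" using surj qD(2) by blast
    then show ?thesis using c unfolding hom_vimage_def by blast
  qed
  then show "hom_vimage B h p \<subset> hom_vimage B h q" using pq(3) unfolding hom_vimage_def by blast
  fix r assume r: "primeideal r B" "hom_vimage B h p \<subset> r" "r \<subseteq> hom_vimage B h q"
  note rD = cring.primeD[OF B r(1)]
  note rI = cring.idealD[OF B rD(1)]
  have zero_p: "\<zero>\<^bsub>C\<^esub> \<in> p" using cring.idealD(2)[OF C pD(1)] .
  \<comment> \<open>As \<open>r\<close> contains the kernel of \<open>h\<close>, it is a union of
    fibres of \<open>h\<close>; this is what lets primality pass to the image.\<close>
  have mem_r: "b \<in> r" if "b \<in> carrier B" "h b \<in> h ` r" for b
  proof -
    obtain a where a: "a \<in> r" "h b = h a" using \<open>h b \<in> h ` r\<close> by blast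
    have ac: "a \<in> carrier B" using a rD(2) by blast
    have "h (b \<ominus>\<^bsub>B\<^esub> a) = \<zero>\<^bsub>C\<^esub>"
      using that ac a by (simp add: a_minus_def h.S.r_neg)
    then have "b \<ominus>\<^bsub>B\<^esub> a \<in> r" using zero_p r(2) that ac unfolding hom_vimage_def by auto
    moreover have "b = (b \<ominus>\<^bsub>B\<^esub> a) \<oplus>\<^bsub>B\<^esub> a" using that ac
      by (simp add: a_minus_def h.R.a_assoc h.R.l_neg)
    ultimately show ?thesis using rI(3) a by metis
  qed
  have r_img: "primeideal (h ` r) C"
  proof (rule primeidealI[OF _ C])
    show "ideal (h ` r) C"
    proof (rule cring.idealI_closed[OF C])
      show "h ` r \<subseteq> carrier C" using rD(2) by auto
      show "\<zero>\<^bsub>C\<^esub> \<in> h ` r" using rI(2) h.hom_zero by (metis imageI)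
      show "a \<oplus>\<^bsub>C\<^esub> b \<in> h ` r" if "a \<in> h ` r" "b \<in> h ` r" for a b
      proof -
        from that obtain a' b' where "a' \<in> r" "b' \<in> r" "a = h a'" "b = h b'" by blast
        then have "a \<oplus>\<^bsub>C\<^esub> b = h (a' \<oplus>\<^bsub>B\<^esub> b')" using subsetD[OF rD(2)] by simp
        then show ?thesis using rI(3) \<open>a' \<in> r\<close> \<open>b' \<in> r\<close> by simp
      qed
      show "c \<otimes>\<^bsub>C\<^esub> a \<in> h ` r" if "a \<in> h ` r" "c \<in> carrier C" for a c
      proof -
        from that obtain a' c' where *: "a' \<in> r" "c' \<in> carrier B" "a = h a'" "c = h c'" using surj by blast
        then have "c \<otimes>\<^bsub>C\<^esub> a = h (c' \<otimes>\<^bsub>B\<^esub> a')" using subsetD[OF rD(2)] by simp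
        then show ?thesis using rI(5) * by simp
      qed
    qed
    have "\<one>\<^bsub>C\<^esub> \<notin> h ` r" using mem_r[of "\<one>\<^bsub>B\<^esub>"] rD(3) by auto
    then show "carrier C \<noteq> h ` r" by auto
    fix a b assume ab: "a \<in> carrier C" "b \<in> carrier C" "a \<otimes>\<^bsub>C\<^esub> b \<in> h ` r"
    then obtain a' b' where *: "a' \<in> carrier B" "b' \<in> carrier B" "a = h a'" "b = h b'" using surj by blast
    then have "h (a' \<otimes>\<^bsub>B\<^esub> b') \<in> h ` r" using ab by simp
    then have "a' \<otimes>\<^bsub>B\<^esub> b' \<in> r" using mem_r * by simp
    then have "a' \<in> r \<or> b' \<in> r" using rD(4) * by blast
    then show "a \<in> h ` r \<or> b \<in> h ` r" using * by blast
  qed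
  have "p \<subset> h ` r"
  proof
    show "p \<subseteq> h ` r"
    proof
      fix c assume "c \<in> p"
      then obtain b where b: "b \<in> carrier B" "c = h b" using surj pD(2) by blast
      then have "b \<in> r" using r(2) \<open>c \<in> p\<close> unfolding hom_vimage_def by blast
      then show "c \<in> h ` r" using b by blast
    qed
    obtain b where "b \<in> r" "b \<notin> hom_vimage B h p" using r(2) by blast
    then show "p \<noteq> h ` r" using rD(2) unfolding hom_vimage_def by blast
  qed
  moreover have "h ` r \<subseteq> q" using r(3) unfolding hom_vimage_def by blast
  ultimately have "h ` r = q" using pq(4)[OF r_img] by blast
  then show "r = hom_vimage B h q" using mem_r r(3) unfolding hom_vimage_def by blast
qed

lemma prime_cover_chain_vimage:
  assumes "ring_hom_ring B C h" "cring B" "cring C" "h ` carrier B = carrier C"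
  shows "(p, q) \<in> prime_cover C ^^ k \<Longrightarrow> (hom_vimage B h p, hom_vimage B h q) \<in> prime_cover B ^^ k"
proof (induct k arbitrary: q)
  case (Suc k)
  then obtain r where "(p, r) \<in> prime_cover C ^^ k" "(r, q) \<in> prime_cover C" by auto
  then show ?case using Suc.hyps prime_cover_vimage[OF assms] by auto
qed simp

lemma prime_cover_saturated_chain:
  assumes "primeideal p A"
  shows "(p, q) \<in> prime_cover A ^^ k \<Longrightarrow> \<exists>cs. saturated_chain A p q cs \<and> length cs = Suc k"
proof (induct k arbitrary: q)
  case 0
  then have "saturated_chain A p q [p]" using assms unfolding saturated_chain_def Spec_def by simp
  then show ?case by force
next
  case (Suc k)
  then obtain r where r: "(p, r) \<in> prime_cover A ^^ k" "(r, q) \<in> prime_cover A" by auto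
  then obtain cs where cs: "saturated_chain A p r cs" "length cs = Suc k" using Suc.hyps by blast
  note rq = prime_coverD[OF r(2)]
  have ne: "cs \<noteq> []" "cs ! k = r" using cs unfolding saturated_chain_def by (auto simp: last_conv_nth)
  have "saturated_chain A p q (cs @ [q])"
    unfolding saturated_chain_def
  proof (intro conjI allI impI)
    show "cs @ [q] \<noteq> []" "last (cs @ [q]) = q" by auto
    show "hd (cs @ [q]) = p" using cs ne(1) unfolding saturated_chain_def by simp
    show "\<forall>c\<in>set (cs @ [q]). c \<in> Spec A" using cs rq(2) unfolding saturated_chain_def Spec_def by auto
    fix i assume i: "Suc i < length (cs @ [q])"
    show "(cs @ [q]) ! i \<subset> (cs @ [q]) ! Suc i"
      "\<not> (\<exists>P\<in>Spec A. (cs @ [q]) ! i \<subset> P \<and> P \<subset> (cs @ [q]) ! Suc i)"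
    proof (atomize (full), cases "Suc i < length cs")
      case True
      then show "(cs @ [q]) ! i \<subset> (cs @ [q]) ! Suc i \<and>
        \<not> (\<exists>P\<in>Spec A. (cs @ [q]) ! i \<subset> P \<and> P \<subset> (cs @ [q]) ! Suc i)"
        using cs(1) unfolding saturated_chain_def by (simp add: nth_append)
    next
      case False
      then have "i = k" using i cs(2) by simp
      then show "(cs @ [q]) ! i \<subset> (cs @ [q]) ! Suc i \<and>
        \<not> (\<exists>P\<in>Spec A. (cs @ [q]) ! i \<subset> P \<and> P \<subset> (cs @ [q]) ! Suc i)"
        using rq cs(2) ne(2) unfolding Spec_def by (auto simp: nth_append)
    qed
  qed
  then show ?case using cs(2) by (intro exI[of _ "cs @ [q]"]) simp
qed

lemma prime_cover_chain_strict:
  assumes "(p, q) \<in> prime_cover A ^^ Suc k"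
  shows "primeideal p A" "primeideal q A" "p \<subset> q"
proof -
  have le: "r \<subseteq> q" if "(r, q) \<in> prime_cover A ^^ k" for r k q
    using that by (induct k arbitrary: q) (auto dest: prime_coverD(3))
  obtain r where r: "(p, r) \<in> prime_cover A" "(r, q) \<in> prime_cover A ^^ k"
    using relpow_Suc_D2[OF assms] by blast
  obtain t where t: "(t, q) \<in> prime_cover A" using assms by auto
  show "primeideal p A" "primeideal q A" "p \<subset> q"
    using prime_coverD[OF r(1)] prime_coverD[OF t] le[OF r(2)] by auto
qed

lemma catenary_prime_cover_chain:
  assumes "catenary A" "(p, q) \<in> prime_cover A ^^ Suc k" "(p, q) \<in> prime_cover A ^^ Suc l"
  shows "k = l"
proof -
  note pq = prime_cover_chain_strict[OF assms(2)]
  obtain cs where cs: "saturated_chain A p q cs" "length cs = Suc (Suc k)"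
    using prime_cover_saturated_chain[OF pq(1) assms(2)] by blast
  obtain ds where ds: "saturated_chain A p q ds" "length ds = Suc (Suc l)"
    using prime_cover_saturated_chain[OF pq(1) assms(3)] by blast
  have "length cs = length ds"
    using assms(1) pq cs(1) ds(1) unfolding catenary_def Spec_def by blast
  then show ?thesis using cs ds by simp
qed

section \<open>Polynomials in one variable: multiset monomials against exponents\<close>

lemma mpoly_ring_one_iso:
  assumes "cring A"
  shows "(\<lambda>p m. if set_mset m \<subseteq> {..<1} then p (size m) else \<zero>\<^bsub>A\<^esub>) \<in> ring_iso (UP A) (mpoly_ring A 1)"
    (is "?\<psi> \<in> _")
proof -
  interpret A: cring A by fact
  have rep: "m = replicate_mset (size m) 0" if "set_mset m \<subseteq> {..<1::nat}" for m
    using that by (metis One_nat_def lessThan_Suc lessThan_0 set_mset_subset_singletonD)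
  have sz: "set_mset (replicate_mset j 0) \<subseteq> {..<1::nat}" for j by (cases j) auto
  have closed: "?\<psi> p \<in> carrier (mpoly_ring A 1)" if "p \<in> carrier (UP A)" for p
  proof -
    have p: "p \<in> up A" using that by (simp add: UP_def)
    then obtain b where b: "bound \<zero>\<^bsub>A\<^esub> b p" by blast
    have "{m. ?\<psi> p m \<noteq> \<zero>\<^bsub>A\<^esub>} \<subseteq> (\<lambda>i. replicate_mset i 0) ` {..b}"
    proof
      fix m assume "m \<in> {m. ?\<psi> p m \<noteq> \<zero>\<^bsub>A\<^esub>}"
      then have m: "set_mset m \<subseteq> {..<1}" "p (size m) \<noteq> \<zero>\<^bsub>A\<^esub>" by (auto split: if_splits)
      then have "size m \<le> b" using bound_below[OF b] by blast
      then show "m \<in> (\<lambda>i. replicate_mset i 0) ` {..b}" using rep[OF m(1)] by blast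
    qed
    then have "finite {m. ?\<psi> p m \<noteq> \<zero>\<^bsub>A\<^esub>}" by (rule finite_subset) simp
    then show ?thesis unfolding mpoly_ring_def using mem_upD[OF p] by auto
  qed
  show ?thesis
  proof (rule ring_iso_memI)
    fix p assume "p \<in> carrier (UP A)"
    then show "?\<psi> p \<in> carrier (mpoly_ring A 1)" by (rule closed)
    from \<open>p \<in> carrier (UP A)\<close> have p: "p \<in> up A" by (simp add: UP_def)
    fix q assume "q \<in> carrier (UP A)"
    then have q: "q \<in> up A" by (simp add: UP_def)
    show "?\<psi> (p \<oplus>\<^bsub>UP A\<^esub> q) = ?\<psi> p \<oplus>\<^bsub>mpoly_ring A 1\<^esub> ?\<psi> q"
      using p q unfolding mpoly_ring_def UP_def by auto
    show "?\<psi> (p \<otimes>\<^bsub>UP A\<^esub> q) = ?\<psi> p \<otimes>\<^bsub>mpoly_ring A 1\<^esub> ?\<psi> q"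
    proof
      fix m :: "nat multiset"
      have rhs: "(?\<psi> p \<otimes>\<^bsub>mpoly_ring A 1\<^esub> ?\<psi> q) m =
        finsum A (\<lambda>a. ?\<psi> p a \<otimes>\<^bsub>A\<^esub> ?\<psi> q (m - a)) {a. a \<subseteq># m}"
        unfolding mpoly_ring_def by simp
      show "?\<psi> (p \<otimes>\<^bsub>UP A\<^esub> q) m = (?\<psi> p \<otimes>\<^bsub>mpoly_ring A 1\<^esub> ?\<psi> q) m"
      proof (cases "set_mset m \<subseteq> {..<1}")
        case True
        define n where "n = size m"
        have m: "m = replicate_mset n 0" unfolding n_def by (rule rep[OF True])
        have sub: "{a. a \<subseteq># m} = (\<lambda>i. replicate_mset i 0) ` {..n}"
        proof (intro Set.set_eqI iffI)
          fix a assume "a \<in> {a. a \<subseteq># m}"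
          then have "a \<subseteq># replicate_mset n 0" using m by simp
          then show "a \<in> (\<lambda>i. replicate_mset i 0) ` {..n}" by (elim msubseteq_replicate_msetE) auto
        next
          fix a assume "a \<in> (\<lambda>i. replicate_mset i (0::nat)) ` {..n}"
          then show "a \<in> {a. a \<subseteq># m}" unfolding m by (auto simp: subseteq_mset_def)
        qed
        have inj: "inj_on (\<lambda>i. replicate_mset i (0::nat)) {..n}"
          by (rule inj_onI) (metis size_replicate_mset)
        have "finsum A (\<lambda>a. ?\<psi> p a \<otimes>\<^bsub>A\<^esub> ?\<psi> q (m - a)) {a. a \<subseteq># m} =
          finsum A (\<lambda>i. ?\<psi> p (replicate_mset i 0) \<otimes>\<^bsub>A\<^esub> ?\<psi> q (m - replicate_mset i 0)) {..n}"
          unfolding sub using mem_upD[OF p] mem_upD[OF q] by (intro A.finsum_reindex inj) auto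
        also have "\<dots> = finsum A (\<lambda>i. p i \<otimes>\<^bsub>A\<^esub> q (n - i)) {..n}"
        proof (rule A.finsum_cong')
          show "(\<lambda>i. p i \<otimes>\<^bsub>A\<^esub> q (n - i)) \<in> {..n} \<rightarrow> carrier A" using mem_upD[OF p] mem_upD[OF q] by auto
          fix i assume "i \<in> {..n}"
          then have "m - replicate_mset i 0 = replicate_mset (n - i) 0" unfolding m
            by (intro multiset_eqI) auto
          then show "?\<psi> p (replicate_mset i 0) \<otimes>\<^bsub>A\<^esub> ?\<psi> q (m - replicate_mset i 0)
              = p i \<otimes>\<^bsub>A\<^esub> q (n - i)" using sz by simp
        qed simp
        also have "\<dots> = ?\<psi> (p \<otimes>\<^bsub>UP A\<^esub> q) m" using p q True unfolding UP_def n_def by simp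
        finally show ?thesis unfolding rhs by simp
      next
        case False
        \<comment> \<open>A monomial involving another variable cannot be split into two monomials
          in the variable 0 alone, so each summand has a vanishing factor.\<close>
        have "?\<psi> p a \<otimes>\<^bsub>A\<^esub> ?\<psi> q (m - a) = \<zero>\<^bsub>A\<^esub>" if "a \<subseteq># m" for a
        proof (cases "set_mset a \<subseteq> {..<1}")
          case True
          have "m = a + (m - a)" using that by simp
          then have "set_mset m = set_mset a \<union> set_mset (m - a)" by (metis set_mset_union)
          then have "\<not> set_mset (m - a) \<subseteq> {..<1}" using True False by blast
          then show ?thesis using mem_upD[OF p] by simp
        next
          case False then show ?thesis using mem_upD[OF q] by simp
        qed
        then have "finsum A (\<lambda>a. ?\<psi> p a \<otimes>\<^bsub>A\<^esub> ?\<psi> q (m - a)) {a. a \<subseteq># m} =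
           finsum A (\<lambda>a. \<zero>\<^bsub>A\<^esub>) {a. a \<subseteq># m}" by (intro A.finsum_cong') auto
        then show ?thesis unfolding rhs using False by simp
      qed
    qed
  next
    show "?\<psi> \<one>\<^bsub>UP A\<^esub> = \<one>\<^bsub>mpoly_ring A 1\<^esub>" unfolding mpoly_ring_def UP_def by auto
    let ?\<phi> = "\<lambda>f n. f (replicate_mset n (0::nat))"
    show "bij_betw ?\<psi> (carrier (UP A)) (carrier (mpoly_ring A 1))"
    proof (rule bij_betw_byWitness[where f' = ?\<phi>])
      show "\<forall>p\<in>carrier (UP A). ?\<phi> (?\<psi> p) = p" using sz by auto
      show "\<forall>f\<in>carrier (mpoly_ring A 1). ?\<psi> (?\<phi> f) = f"
      proof
        fix f assume "f \<in> carrier (mpoly_ring A 1)"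
        then have f: "set_mset m \<subseteq> {..<1}" if "f m \<noteq> \<zero>\<^bsub>A\<^esub>" for m
          using that unfolding mpoly_ring_def by auto
        show "?\<psi> (?\<phi> f) = f"
        proof
          fix m show "?\<psi> (?\<phi> f) m = f m" using rep[of m] f[of m] by (metis (full_types))
        qed
      qed
      show "?\<psi> ` carrier (UP A) \<subseteq> carrier (mpoly_ring A 1)" using closed by blast
      show "?\<phi> ` carrier (mpoly_ring A 1) \<subseteq> carrier (UP A)" 
      proof
        fix g assume "g \<in> ?\<phi> ` carrier (mpoly_ring A 1)"
        then obtain f where f: "f \<in> carrier (mpoly_ring A 1)" "g = ?\<phi> f" by blast
        then have fin: "finite {m. f m \<noteq> \<zero>\<^bsub>A\<^esub>}" and car: "\<And>m. f m \<in> carrier A"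
          unfolding mpoly_ring_def by auto
        define b where "b = Max (insert 0 (size ` {m. f m \<noteq> \<zero>\<^bsub>A\<^esub>}))"
        have "g n = \<zero>\<^bsub>A\<^esub>" if "b < n" for n
        proof (rule ccontr)
          assume "g n \<noteq> \<zero>\<^bsub>A\<^esub>"
          then have "size (replicate_mset n (0::nat)) \<in> size ` {m. f m \<noteq> \<zero>\<^bsub>A\<^esub>}" using f by blast
          then have "n \<le> b" unfolding b_def using fin by (intro Max_ge) auto
          then show False using that by simp
        qed
        then have "bound \<zero>\<^bsub>A\<^esub> b g" by (intro bound.intro) auto
        then show "g \<in> carrier (UP A)" unfolding UP_def using car f(2) by (auto intro!: mem_upI)
      qed
    qed
  qed
qed

text \<open>Universal catenarity speaks of quotients of \<open>mpoly_ring\<close>; the quotient by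
  the zero ideal is the route by which it reaches \<open>UP A\<close>.\<close>

lemma mpoly_ring_Quot_zero:
  assumes A: "cring A"
  obtains h where "cring (mpoly_ring A 1 Quot {\<zero>\<^bsub>mpoly_ring A 1\<^esub>})"
    "ideal {\<zero>\<^bsub>mpoly_ring A 1\<^esub>} (mpoly_ring A 1)"
    "h \<in> ring_iso (mpoly_ring A 1 Quot {\<zero>\<^bsub>mpoly_ring A 1\<^esub>}) (UP A)"
proof -
  let ?M = "mpoly_ring A 1"
  interpret A: cring A by fact
  interpret U: UP_cring A "UP A" by unfold_locales auto
  note iso = mpoly_ring_one_iso[OF A]
  \<comment> \<open>Transport along the isomorphism replaces the zero of the target by the image of
    zero, which turns out to be the zero already there.\<close>
  have "cring (?M\<lparr>zero := (\<lambda>m. if set_mset m \<subseteq> {..<1} then \<zero>\<^bsub>UP A\<^esub> (size m) else \<zero>\<^bsub>A\<^esub>)\<rparr>)"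
    using U.P.ring_iso_imp_img_cring[OF iso] .
  moreover have "?M\<lparr>zero := (\<lambda>m. if set_mset m \<subseteq> {..<1} then \<zero>\<^bsub>UP A\<^esub> (size m) else \<zero>\<^bsub>A\<^esub>)\<rparr> = ?M"
    unfolding mpoly_ring_def UP_def by auto
  ultimately interpret M: cring ?M by simp
  obtain g where g: "g \<in> ring_iso (?M Quot {\<zero>\<^bsub>?M\<^esub>}) ?M"
    using M.FactRing_zeroideal(1) unfolding is_ring_iso_def by blast
  have "inv_into (carrier (UP A)) (\<lambda>p m. if set_mset m \<subseteq> {..<1} then p (size m) else \<zero>\<^bsub>A\<^esub>) \<in> ring_iso ?M (UP A)"
    by (rule ring_iso_set_sym[OF U.P.ring_axioms iso])
  from ring_iso_set_trans[OF g this]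
  show ?thesis by (rule that[OF ideal.quotient_is_cring[OF M.zeroideal M.is_cring] M.zeroideal])
qed

section \<open>Contraction of height one primes from one-element extensions\<close>

lemma (in cring) add_minus_cancel_left: "a \<in> carrier R \<Longrightarrow> b \<in> carrier R \<Longrightarrow> a \<oplus> b \<ominus> a = b"
  by algebra

locale fraction_field = ambient_field +
  fixes R
  assumes subR: "subring R K"
    and frac: "\<And>x. x \<in> carrier K \<Longrightarrow> \<exists>a\<in>R. \<exists>b\<in>R. b \<noteq> \<zero> \<and> x = a \<otimes> inv b"
begin

lemma R_carrier: "a \<in> R \<Longrightarrow> a \<in> carrier K"
  using subringE(1)[OF subR] by blast

lemma nonzero_inv: "b \<in> carrier K \<Longrightarrow> b \<noteq> \<zero> \<Longrightarrow> inv b \<in> carrier K \<and> b \<otimes> inv b = \<one> \<and> inv b \<otimes> b = \<one>"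
  using field_Units by (metis Diff_iff Units_inv_closed Units_l_inv Units_r_inv singletonD)

lemma frac_mult:
  assumes "x \<in> carrier K"
  obtains c d where "c \<in> R" "d \<in> R" "d \<noteq> \<zero>" "d \<otimes> x = c"
proof -
  obtain a b where *: "a \<in> R" "b \<in> R" "b \<noteq> \<zero>" "x = a \<otimes> inv b" using frac[OF assms] by blast
  then have "b \<otimes> x = a"
    using nonzero_inv[of b] R_carrier by (metis m_comm m_assoc r_one)
  then show ?thesis using that * by blast
qed

text \<open>Clearing the denominator of a nonzero element of \<open>Q\<close> gives a nonzero
  element of \<open>R\<close> that still lies in \<open>Q\<close>.\<close>

lemma prime_contract_nonzero:
  assumes S: "subring S K" "R \<subseteq> S" and Q: "primeideal Q (subr K S)" "Q \<noteq> {\<zero>}"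
  shows "Q \<inter> R \<noteq> {\<zero>}"
proof -
  note QD = subr_primeD[OF S(1) Q(1)]
  obtain w where w: "w \<in> Q" "w \<noteq> \<zero>" using Q(2) QD(3) by blast
  have wc: "w \<in> carrier K" using w QD(2) by blast
  obtain c d where cd: "c \<in> R" "d \<in> R" "d \<noteq> \<zero>" "d \<otimes> w = c" using frac_mult[OF wc] .
  have "c \<in> Q" using QD(7)[OF w(1)] cd S(2) by blast
  moreover have "c \<noteq> \<zero>" using cd w wc R_carrier integral_iff by blast
  ultimately show ?thesis using cd(1) by blast
qed

end

locale fraction_field_poly = fraction_field
begin

abbreviation RX :: "('a, nat \<Rightarrow> 'a) up_ring" where "RX \<equiv> UP (subr K R)"

abbreviation ev :: "'a \<Rightarrow> (nat \<Rightarrow> 'a) \<Rightarrow> 'a" where "ev x \<equiv> UnivPoly.eval (subr K R) K id x"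

lemma UP_pre: "UP_pre_univ_prop (subr K R) K id"
proof -
  have "id \<in> ring_hom (subr K R) K" using R_carrier by (auto intro: ring_hom_memI)
  then have "ring_hom_cring (subr K R) K id"
    by (rule ring_hom_cringI[OF subr_cring[OF subR] is_cring])
  then show ?thesis
    by (simp add: UP_pre_univ_prop_def UP_cring_def subr_cring[OF subR])
qed

end

sublocale fraction_field_poly \<subseteq> RX: UP_domain "subr K R" "UP (subr K R)"
  using subr_domain[OF subR] by (simp add: UP_domain_def)

sublocale fraction_field_poly \<subseteq> UP: UP_pre_univ_prop "subr K R" K id "UP (subr K R)"
  using UP_pre .

section \<open>Evaluation at an element of the field and its kernel in the polynomial ring\<close>

context fraction_field_poly
begin

lemma ev_hom: "x \<in> carrier K \<Longrightarrow> ring_hom_ring RX K (ev x)"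
  using UP.eval_ring_hom RX.P.ring_axioms ring_axioms
  by (simp add: ring_hom_ringI2)

lemma ev_const: "x \<in> carrier K \<Longrightarrow> r \<in> R \<Longrightarrow> ev x (up_ring.monom RX r 0) = r"
  using UP.eval_const[of x r] by simp

lemma ev_image:
  assumes x: "x \<in> carrier K"
  shows "ev x ` carrier RX = adjoin R x"
proof
  interpret e: ring_hom_ring RX K "ev x" using ev_hom[OF x] .
  have sub: "subring (ev x ` carrier RX) K"
    using e.img_is_subring[OF RX.P.carrier_is_subring] .
  have "R \<subseteq> ev x ` carrier RX"
  proof
    fix r assume "r \<in> R"
    then have "ev x (up_ring.monom RX r 0) = r" "up_ring.monom RX r 0 \<in> carrier RX" using ev_const[OF x] by auto
    then show "r \<in> ev x ` carrier RX" by (metis imageI)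
  qed
  moreover have "x \<in> ev x ` carrier RX"
  proof
    show "x = ev x (up_ring.monom RX \<one> 1)" using UP.eval_monom1[OF x] by simp
    show "up_ring.monom RX \<one> 1 \<in> carrier RX" using RX.monom_closed[of \<one> 1] subringE(3)[OF subR] by simp
  qed
  ultimately show "adjoin R x \<subseteq> ev x ` carrier RX" by (rule adjoin_least[OF subR x sub])
  show "ev x ` carrier RX \<subseteq> adjoin R x"
  proof
    fix y assume "y \<in> ev x ` carrier RX"
    then obtain f where f: "f \<in> carrier RX" "y = ev x f" by blast
    note T = adjoin_subring[OF subR x]
    have "finsum K (\<lambda>i. up_ring.coeff RX f i \<otimes> x [^] i) I \<in> adjoin R x" if "finite I" for I
      using that
    proof (induct I)
      case empty then show ?case using subringE(2)[OF T] by simp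
    next
      case (insert i I)
      have c: "up_ring.coeff RX f i \<in> R" for i using RX.coeff_closed[OF f(1), of i] by simp
      then have "up_ring.coeff RX f i \<otimes> x [^] i \<in> adjoin R x"
        using adjoin_contains[OF subR x] subringE(6)[OF T] subr_pow_closed[OF T] by blast
      then show ?case using insert c R_carrier x subringE(7)[OF T] by (subst finsum_insert) auto
    qed
    moreover have "y = finsum K (\<lambda>i. up_ring.coeff RX f i \<otimes> x [^] i) {..deg (subr K R) f}"
      unfolding f(2) using UP.eval_on_carrier[OF f(1), of K id x] by simp
    ultimately show "y \<in> adjoin R x" by simp
  qed
qed

lemma ev_hom_adjoin:
  assumes x: "x \<in> carrier K"
  shows "ring_hom_ring RX (subr K (adjoin R x)) (ev x)"
    and "ev x ` carrier RX = carrier (subr K (adjoin R x))"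
proof -
  interpret e: ring_hom_ring RX K "ev x" using ev_hom[OF x] .
  show "ev x ` carrier RX = carrier (subr K (adjoin R x))" using ev_image[OF x] by simp
  have "ev x \<in> ring_hom RX (subr K (adjoin R x))"
    using ev_image[OF x] e.homh unfolding ring_hom_def by auto
  then show "ring_hom_ring RX (subr K (adjoin R x)) (ev x)"
    using RX.P.ring_axioms subring_is_ring[OF adjoin_subring[OF subR x]] by (simp add: ring_hom_ringI2)
qed

text \<open>Meant for \<open>g = d X - c\<close> with \<open>x = c/d\<close>. The remainder of the
  pseudo-division is a constant that evaluation at \<open>x\<close> sends to zero, hence it is
  zero.\<close>

lemma ker_ev_pseudo_division:
  assumes x: "x \<in> carrier K" and d: "d \<in> R" "d \<noteq> \<zero>" and g: "g \<in> carrier RX" "deg (subr K R) g = 1"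
    "up_ring.coeff RX g 1 = d" "ev x g = \<zero>" and f: "f \<in> carrier RX" "ev x f = \<zero>"
  obtains q and k :: nat where "q \<in> carrier RX" "(d [^] k) \<odot>\<^bsub>RX\<^esub> f = g \<otimes>\<^bsub>RX\<^esub> q" "d [^] k \<in> R" "d [^] k \<noteq> \<zero>"
proof -
  interpret e: ring_hom_ring RX K "ev x" using ev_hom[OF x] .
  have g0: "g \<noteq> \<zero>\<^bsub>RX\<^esub>" using g(2) RX.deg_zero by auto
  obtain q r and k :: nat where *: "q \<in> carrier RX" "r \<in> carrier RX"
    "(d [^]\<^bsub>subr K R\<^esub> k) \<odot>\<^bsub>RX\<^esub> f = g \<otimes>\<^bsub>RX\<^esub> q \<oplus>\<^bsub>RX\<^esub> r" "r = \<zero>\<^bsub>RX\<^esub> \<or> deg (subr K R) r < 1"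
    using RX.long_div_theorem[OF g(1) f(1) g0] g(2,3) by auto
  have pow: "d [^]\<^bsub>subr K R\<^esub> k = d [^] k" using nat_pow_consistent by simp
  have dk: "d [^] k \<in> R" using subr_pow_closed[OF subR d(1)] .
  have dk0: "d [^] k \<noteq> \<zero>" using d R_carrier by (induct k) (auto simp: integral_iff)
  have "r = \<zero>\<^bsub>RX\<^esub>"
  proof (rule ccontr)
    assume r0: "r \<noteq> \<zero>\<^bsub>RX\<^esub>"
    then have "deg (subr K R) r = 0" using * by simp
    then have r: "r = up_ring.monom RX (up_ring.coeff RX r 0) 0" using RX.deg_zero_impl_monom *(2) by metis
    have rc: "up_ring.coeff RX r 0 \<in> R" using RX.coeff_closed[OF *(2)] by simp
    have "d [^] k \<odot>\<^bsub>RX\<^esub> f = up_ring.monom RX (d [^] k) 0 \<otimes>\<^bsub>RX\<^esub> f"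
      using RX.monom_mult_is_smult[of "d [^] k" f] dk f(1) by simp
    then have "ev x (d [^] k \<odot>\<^bsub>RX\<^esub> f) = ev x (up_ring.monom RX (d [^] k) 0) \<otimes> ev x f"
      using f dk by simp
    also have "\<dots> = \<zero>" using f dk ev_const[OF x] R_carrier by simp
    finally have "ev x (g \<otimes>\<^bsub>RX\<^esub> q \<oplus>\<^bsub>RX\<^esub> r) = \<zero>" using * pow by simp
    moreover have "ev x (g \<otimes>\<^bsub>RX\<^esub> q \<oplus>\<^bsub>RX\<^esub> r) = ev x r" using * g by simp
    moreover have "ev x r = up_ring.coeff RX r 0" using ev_const[OF x rc] r by simp
    ultimately have "up_ring.coeff RX r 0 = \<zero>" by simp
    then show False using r r0 RX.monom_zero by simp
  qed
  then have "(d [^] k) \<odot>\<^bsub>RX\<^esub> f = g \<otimes>\<^bsub>RX\<^esub> q" using * g pow by simp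
  then show ?thesis using that * dk dk0 by blast
qed

text \<open>Over \<open>K\<close> the kernel would be generated by \<open>X - x\<close>; here
  \<open>g = d X - c\<close> plays that part up to powers of \<open>d\<close>. A nonzero prime
  \<open>I\<close> inside the kernel contains \<open>g\<close>: otherwise \<open>d^k f = g q\<close>
  with \<open>f \<in> I\<close> of least degree puts \<open>q\<close> into \<open>I\<close>, one
  degree lower. It then contains the whole kernel, since no nonzero constant lies in
  \<open>I\<close>.\<close>

lemma zero_cover_ker_ev:
  assumes x: "x \<in> carrier K"
  shows "({\<zero>\<^bsub>RX\<^esub>}, hom_vimage RX (ev x) {\<zero>}) \<in> prime_cover RX"
proof (rule prime_coverI)
  interpret e: ring_hom_ring RX K "ev x" using ev_hom[OF x] .
  let ?J = "hom_vimage RX (ev x) {\<zero>}"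
  show "primeideal {\<zero>\<^bsub>RX\<^esub>} RX" using RX.zeroprimeideal .
  show Jp: "primeideal ?J RX"
    using e.primeideal_vimage[OF RX.P.is_cring zeroprimeideal] unfolding hom_vimage_def .
  obtain c d where cd: "c \<in> R" "d \<in> R" "d \<noteq> \<zero>" "d \<otimes> x = c" using frac_mult[OF x] .
  define g where "g = up_ring.monom RX d 1 \<oplus>\<^bsub>RX\<^esub> up_ring.monom RX (\<ominus> c) 0"
  have mc: "\<ominus> c \<in> R" using subringE(5)[OF subR cd(1)] .
  have g: "g \<in> carrier RX" unfolding g_def using cd mc by simp
  have g_coeff: "up_ring.coeff RX g 1 = d" unfolding g_def using cd mc R_carrier by simp
  have g_deg: "deg (subr K R) g = 1"
  proof (rule le_antisym)
    show "deg (subr K R) g \<le> 1"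
      by (rule RX.deg_aboveI[OF _ g]) (use cd mc R_carrier in \<open>simp add: g_def\<close>)
    show "1 \<le> deg (subr K R) g" by (rule RX.deg_belowI[OF _ g]) (use g_coeff cd in simp)
  qed
  have "ev x (up_ring.monom RX d 1) = c" using UP.eval_monom[of d x 1] cd x by simp
  then have g_ev: "ev x g = \<zero>"
    unfolding g_def using ev_const[OF x mc] mc cd R_carrier[OF cd(1)] by (simp add: r_neg)
  have g0: "g \<noteq> \<zero>\<^bsub>RX\<^esub>" using g_deg RX.deg_zero by auto
  note pdiv = ker_ev_pseudo_division[OF x cd(2,3) g g_deg g_coeff g_ev]
  show "{\<zero>\<^bsub>RX\<^esub>} \<subset> ?J" using g g0 g_ev e.hom_zero unfolding hom_vimage_def by auto
  fix I assume I: "primeideal I RX" "{\<zero>\<^bsub>RX\<^esub>} \<subset> I" "I \<subseteq> ?J"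
  note ID = RX.P.primeD[OF I(1)]
  note II = RX.P.idealD[OF ID(1)]
  have smult: "a \<odot>\<^bsub>RX\<^esub> f = up_ring.monom RX a 0 \<otimes>\<^bsub>RX\<^esub> f" "up_ring.monom RX a 0 \<in> carrier RX"
    if "a \<in> R" "f \<in> carrier RX" for a f
    using RX.monom_mult_is_smult[of a f] that by auto
  have "g \<in> I"
  proof (rule ccontr)
    assume gI: "g \<notin> I"
    obtain f0 where "f0 \<in> I \<and> f0 \<noteq> \<zero>\<^bsub>RX\<^esub>" using I(2) by blast
    from ex_has_least_nat[of "\<lambda>f. f \<in> I \<and> f \<noteq> \<zero>\<^bsub>RX\<^esub>", OF this, of "deg (subr K R)"]
    obtain f where f: "f \<in> I" "f \<noteq> \<zero>\<^bsub>RX\<^esub>"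
      and least: "\<And>h. h \<in> I \<Longrightarrow> h \<noteq> \<zero>\<^bsub>RX\<^esub> \<Longrightarrow> deg (subr K R) f \<le> deg (subr K R) h" by blast
    have fJ: "f \<in> carrier RX" "ev x f = \<zero>" using f I(3) unfolding hom_vimage_def by auto
    obtain q and k :: nat where q: "q \<in> carrier RX" "(d [^] k) \<odot>\<^bsub>RX\<^esub> f = g \<otimes>\<^bsub>RX\<^esub> q"
      "d [^] k \<in> R" "d [^] k \<noteq> \<zero>" using pdiv[OF fJ] .
    have "g \<otimes>\<^bsub>RX\<^esub> q \<in> I" unfolding q(2)[symmetric] smult(1)[OF q(3) fJ(1)]
      using II(5)[OF f(1) smult(2)[OF q(3) fJ(1)]] .
    then have qI: "q \<in> I" using ID(4)[OF g q(1)] gI by blast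
    have deg_f: "deg (subr K R) ((d [^] k) \<odot>\<^bsub>RX\<^esub> f) = deg (subr K R) f"
      using RX.deg_smult[of "d [^] k" f] q fJ by simp
    show False
    proof (cases "q = \<zero>\<^bsub>RX\<^esub>")
      case True
      then have "up_ring.monom RX (d [^] k) 0 \<otimes>\<^bsub>RX\<^esub> f = \<zero>\<^bsub>RX\<^esub>" using q(2) smult(1)[OF q(3) fJ(1)] g by simp
      then have "up_ring.monom RX (d [^] k) 0 = \<zero>\<^bsub>RX\<^esub>"
        using RX.integral[OF _ smult(2)[OF q(3) fJ(1)] fJ(1)] f(2) by blast
      then have "ev x (up_ring.monom RX (d [^] k) 0) = \<zero>" by simp
      then show False using ev_const[OF x q(3)] q(4) by simp
    next
      case False
      have "deg (subr K R) f = 1 + deg (subr K R) q"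
        using deg_f unfolding q(2) using RX.deg_mult[OF g0 False g q(1)] g_deg by simp
      then show False using least[OF qI False] by simp
    qed
  qed
  have "?J \<subseteq> I"
  proof
    fix f assume "f \<in> ?J"
    then have fJ: "f \<in> carrier RX" "ev x f = \<zero>" unfolding hom_vimage_def by auto
    obtain q and k :: nat where q: "q \<in> carrier RX" "(d [^] k) \<odot>\<^bsub>RX\<^esub> f = g \<otimes>\<^bsub>RX\<^esub> q"
      "d [^] k \<in> R" "d [^] k \<noteq> \<zero>" using pdiv[OF fJ] .
    have "up_ring.monom RX (d [^] k) 0 \<otimes>\<^bsub>RX\<^esub> f \<in> I"
      unfolding smult(1)[OF q(3) fJ(1), symmetric] q(2) using II(6)[OF \<open>g \<in> I\<close> q(1)] .
    moreover have "up_ring.monom RX (d [^] k) 0 \<notin> I"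
      using I(3) ev_const[OF x q(3)] q(4) unfolding hom_vimage_def by auto
    ultimately show "f \<in> I" using ID(4)[OF smult(2)[OF q(3) fJ(1)] fJ(1)] by blast
  qed
  then show "I = ?J" using I(3) by blast
qed

lemma adjoin_zero: "adjoin R \<zero> = R"
  using adjoin_least[OF subR zero_closed subR] adjoin_contains(1)[OF subR zero_closed] subringE(2)[OF subR]
  by blast

text \<open>Division by the monic polynomial \<open>X\<close> gives \<open>f = X q + a\<close> with
  \<open>a\<close> the constant term. Consequently, membership of \<open>ev x f\<close> in an ideal
  of \<open>R[x]\<close> containing \<open>x\<close> depends only on \<open>a\<close>.\<close>

lemma ev_mod:
  assumes x: "x \<in> carrier K" and f: "f \<in> carrier RX"
  shows "\<exists>t\<in>adjoin R x. ev x f = x \<otimes> t \<oplus> ev \<zero> f" and "ev \<zero> f \<in> R"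
proof -
  interpret e: ring_hom_ring RX K "ev x" using ev_hom[OF x] .
  interpret e0: ring_hom_ring RX K "ev \<zero>" using ev_hom[OF zero_closed] .
  show "ev \<zero> f \<in> R" using ev_image[OF zero_closed] adjoin_zero f by blast
  let ?X = "up_ring.monom RX \<one> 1"
  have one: "\<one> \<in> R" using subringE(3)[OF subR] .
  have g: "?X \<in> carrier RX" using one by simp
  have deg: "deg (subr K R) ?X = 1" using RX.deg_monom[of \<one> 1] one by simp
  then have "?X \<noteq> \<zero>\<^bsub>RX\<^esub>" using RX.deg_zero by auto
  from RX.long_div_theorem[OF g f this]
  obtain q r and k :: nat where *: "q \<in> carrier RX" "r \<in> carrier RX"
    "(\<one> [^]\<^bsub>subr K R\<^esub> k) \<odot>\<^bsub>RX\<^esub> f = ?X \<otimes>\<^bsub>RX\<^esub> q \<oplus>\<^bsub>RX\<^esub> r" "r = \<zero>\<^bsub>RX\<^esub> \<or> deg (subr K R) r < 1"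
    using deg one by auto
  have "\<one> [^]\<^bsub>subr K R\<^esub> k = \<one>\<^bsub>subr K R\<^esub>" using nat_pow_consistent[of \<one> k R] by simp
  then have f_eq: "f = ?X \<otimes>\<^bsub>RX\<^esub> q \<oplus>\<^bsub>RX\<^esub> r" using *(3) f RX.smult_one by simp
  have "deg (subr K R) r = 0" using *(4) RX.deg_zero by auto
  then obtain a where r: "a \<in> R" "r = up_ring.monom RX a 0"
    using RX.deg_zero_impl_monom[OF *(2)] RX.coeff_closed[OF *(2), of 0] by auto
  have "ev x f = x \<otimes> ev x q \<oplus> a"
    unfolding f_eq r(2) using * g r(1) UP.eval_monom1[OF x] ev_const[OF x r(1)] by simp
  moreover have "ev \<zero> f = a"
    unfolding f_eq r(2) using * g r(1) UP.eval_monom1[OF zero_closed] ev_const[OF zero_closed r(1)] R_carrier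
    by simp
  ultimately show "\<exists>t\<in>adjoin R x. ev x f = x \<otimes> t \<oplus> ev \<zero> f"
    using ev_image[OF x] *(1) by blast
qed

lemma contraction_height_one_aux:
  assumes uc: "universally_catenary (subr K R)" and x: "x \<in> carrier K"
    and u: "({\<zero>}, u) \<in> prime_cover (subr K (adjoin R x))" and xu: "x \<in> u"
  shows "height_one K R (u \<inter> R)"
proof -
  have noeth: "noetherian_ring (subr K R)" using uc unfolding universally_catenary_def by blast
  note T = adjoin_subring[OF subR x]
  note uD = subr_primeD[OF T prime_coverD(2)[OF u]]
  have q: "primeideal (u \<inter> R) (subr K R)"
    using subr_prime_contract[OF subR T adjoin_contains(1)[OF subR x] prime_coverD(2)[OF u]] .
  have q0: "u \<inter> R \<noteq> {\<zero>}"
    using prime_contract_nonzero[OF T adjoin_contains(1)[OF subR x] prime_coverD(2)[OF u]] prime_coverD(3)[OF u] by blast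
  have False if Q: "primeideal Q (subr K R)" "{\<zero>} \<subset> Q" "Q \<subset> u \<inter> R" for Q
  proof -
    \<comment> \<open>Such a \<open>Q\<close> yields a saturated chain with at least two steps from
      zero to \<open>u \<inter> R\<close>, hence one with at least three steps in
      \<open>R[X]\<close> after the kernel of evaluation at zero is put in front.\<close>
    have "({\<zero>}, Q) \<in> prime_lt (subr K R)" "(Q, u \<inter> R) \<in> prime_lt (subr K R)"
      using Q q subr_prime_zero[OF subR] unfolding prime_lt_def by auto
    then obtain k l where "({\<zero>}, Q) \<in> prime_cover (subr K R) ^^ Suc k"
      "(Q, u \<inter> R) \<in> prime_cover (subr K R) ^^ Suc l"
      using cring.prime_lt_imp_cover_chain[OF subr_cring[OF subR] noeth] by blast
    then have "({\<zero>}, u \<inter> R) \<in> prime_cover (subr K R) ^^ (Suc k + Suc l)"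
      unfolding relpow_add by blast
    then have "(hom_vimage RX (ev \<zero>) {\<zero>}, hom_vimage RX (ev \<zero>) (u \<inter> R)) \<in> prime_cover RX ^^ (Suc k + Suc l)"
      using ev_hom_adjoin[OF zero_closed] unfolding adjoin_zero
      by (intro prime_cover_chain_vimage[where C = "subr K R"] RX.P.is_cring subr_cring[OF subR])
    then have long: "({\<zero>\<^bsub>RX\<^esub>}, hom_vimage RX (ev \<zero>) (u \<inter> R)) \<in> prime_cover RX ^^ Suc (Suc k + Suc l)"
      by (rule relpow_Suc_I2[OF zero_cover_ker_ev[OF zero_closed]])
    \<comment> \<open>The competing chain has exactly two steps, because \<open>u\<close> covers
      zero in \<open>R[x]\<close>.\<close>
    have "(hom_vimage RX (ev x) {\<zero>}, hom_vimage RX (ev x) u) \<in> prime_cover RX"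
      by (rule prime_cover_vimage[OF ev_hom_adjoin(1)[OF x] RX.P.is_cring subr_cring[OF T] ev_hom_adjoin(2)[OF x] u])
    then have short: "({\<zero>\<^bsub>RX\<^esub>}, hom_vimage RX (ev x) u) \<in> prime_cover RX ^^ Suc (Suc 0)"
      using zero_cover_ker_ev[OF x] by auto
    \<comment> \<open>Both chains end at the same prime: evaluation at \<open>x\<close> and at zero
      agree up to multiples of \<open>x\<close>, and \<open>x\<close> lies in
      \<open>u\<close>.\<close>
    have "ev x f \<in> u \<longleftrightarrow> ev \<zero> f \<in> u \<inter> R" if f: "f \<in> carrier RX" for f
    proof -
      obtain t where t: "t \<in> adjoin R x" "ev x f = x \<otimes> t \<oplus> ev \<zero> f" using ev_mod(1)[OF x f] by blast
      have xt: "x \<otimes> t \<in> u" using uD(8)[OF xu t(1)] .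
      have car: "x \<otimes> t \<in> carrier K" "ev \<zero> f \<in> carrier K" using xt uD(2) ev_mod(2)[OF x f] R_carrier by auto
      have "ev \<zero> f = ev x f \<ominus> x \<otimes> t" unfolding t(2) using car by (simp add: add_minus_cancel_left)
      then show ?thesis using uD(5)[OF xt, of "ev \<zero> f"] uD(6)[OF _ xt, of "ev x f"] t(2) ev_mod(2)[OF x f] by auto
    qed
    then have same: "hom_vimage RX (ev \<zero>) (u \<inter> R) = hom_vimage RX (ev x) u" unfolding hom_vimage_def by blast
    let ?M = "mpoly_ring (subr K R) 1"
    let ?B = "?M Quot {\<zero>\<^bsub>?M\<^esub>}"
    obtain h where B: "cring ?B" "ideal {\<zero>\<^bsub>?M\<^esub>} ?M" and h: "h \<in> ring_iso ?B RX"
      using mpoly_ring_Quot_zero[OF subr_cring[OF subR]] .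
    have cat: "catenary ?B" using uc B(2) unfolding universally_catenary_def by blast
    have "ring_hom_ring ?B RX h" "h ` carrier ?B = carrier RX"
      using h B(1) RX.P.ring_axioms unfolding ring_iso_def bij_betw_def
      by (auto simp: cring_def ring_hom_ringI2)
    note lift = prime_cover_chain_vimage[OF this(1) B(1) RX.P.is_cring this(2)]
    show False
      using catenary_prime_cover_chain[OF cat lift[OF long] lift[OF short[folded same]]] by simp
  qed
  then show ?thesis using q q0 unfolding height_one_def Spec_def by blast
qed

end

lemma (in fraction_field) contraction_height_one:
  assumes "universally_catenary (subr K R)" "x \<in> carrier K"
    and "({\<zero>}, u) \<in> prime_cover (subr K (adjoin R x))" "x \<in> u"
  shows "height_one K R (u \<inter> R)"
proof -
  interpret fraction_field_poly K R ..
  show ?thesis using contraction_height_one_aux[OF assms] .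
qed

section \<open>Localizations and their spectra\<close>

context fraction_field
begin

text \<open>Zorn's lemma takes the place of the maximal condition, because this is applied to
  overrings that need not be Noetherian.\<close>

lemma ex_maximal_ideal_nonunit:
  assumes A: "subring A K" and a: "a \<in> A" and nonunit: "\<not> (\<exists>b\<in>A. a \<otimes> b = \<one>)"
  shows "\<exists>M. maximalideal M (subr K A) \<and> primeideal M (subr K A) \<and> a \<in> M"
proof -
  note AE = subringE[OF A]
  define F where "F = {I. ideal I (subr K A) \<and> a \<in> I \<and> \<one> \<notin> I}"
  have "ideal {a \<otimes> b | b. b \<in> A} (subr K A)"
  proof (rule subr_idealI[OF A])
    show "{a \<otimes> b | b. b \<in> A} \<subseteq> A" using AE(6) a by blast
    have "\<zero> = a \<otimes> \<zero>" using a AE(1) by auto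
    then show "\<zero> \<in> {a \<otimes> b | b. b \<in> A}" using AE(2) by blast
  next
    fix x y assume "x \<in> {a \<otimes> b | b. b \<in> A}" "y \<in> {a \<otimes> b | b. b \<in> A}"
    then obtain b c where *: "b \<in> A" "c \<in> A" "x = a \<otimes> b" "y = a \<otimes> c" by blast
    then have "x \<oplus> y = a \<otimes> (b \<oplus> c)" using a AE(1) by (simp add: r_distr subset_iff)
    then show "x \<oplus> y \<in> {a \<otimes> b | b. b \<in> A}" using AE(7)[OF *(1,2)] by blast
  next
    fix x c assume "x \<in> {a \<otimes> b | b. b \<in> A}" and c: "c \<in> A"
    then obtain b where *: "b \<in> A" "x = a \<otimes> b" by blast
    then have "c \<otimes> x = a \<otimes> (c \<otimes> b)" using a c AE(1) by (simp add: m_lcomm subset_iff)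
    then show "c \<otimes> x \<in> {a \<otimes> b | b. b \<in> A}" using AE(6)[OF c *(1)] by blast
  qed
  moreover have "a = a \<otimes> \<one>" using a AE(1) by auto
  ultimately have F_ne: "{a \<otimes> b | b. b \<in> A} \<in> F"
    unfolding F_def using nonunit AE(3) by (auto 4 3)
  have "\<exists>M\<in>F. \<forall>I\<in>F. M \<subseteq> I \<longrightarrow> I = M"
  proof (rule subset_Zorn)
    fix C assume C: "subset.chain F C"
    show "\<exists>U\<in>F. \<forall>I\<in>C. I \<subseteq> U"
    proof (cases "C = {}")
      case True then show ?thesis using F_ne by blast
    next
      case False
      have CF: "C \<subseteq> F" using C unfolding subset_chain_def by blast
      then have "subset.chain {I. ideal I (subr K A)} C"
        using C unfolding subset_chain_def F_def by blast
      then have "ideal (\<Union>C) (subr K A)"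
        using ring.chain_Union_is_ideal[OF subring_is_ring[OF A], of C] False by simp
      moreover have "a \<in> \<Union>C" using False CF unfolding F_def by blast
      moreover have "\<one> \<notin> \<Union>C" using CF unfolding F_def by blast
      ultimately have "\<Union>C \<in> F" unfolding F_def by blast
      then show ?thesis by blast
    qed
  qed
  then obtain M where M: "M \<in> F" and max: "\<And>I. I \<in> F \<Longrightarrow> M \<subseteq> I \<Longrightarrow> I = M" by metis
  have MI: "ideal M (subr K A)" "a \<in> M" "\<one> \<notin> M" using M unfolding F_def by auto
  have "maximalideal M (subr K A)"
  proof (rule maximalidealI[OF MI(1)])
    show "carrier (subr K A) \<noteq> M" using MI(3) AE(3) by auto
    fix J assume J: "ideal J (subr K A)" "M \<subseteq> J" "J \<subseteq> carrier (subr K A)"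
    show "J = M \<or> J = carrier (subr K A)"
    proof (cases "\<one> \<in> J")
      case True then show ?thesis using ideal.one_imp_carrier[OF J(1)] by simp
    next
      case False then show ?thesis using max[of J] J MI(2) unfolding F_def by blast
    qed
  qed
  then show ?thesis using cring.maximalideal_prime[OF subr_cring[OF A]] MI(2) by blast
qed

text \<open>Turns a denominator into a multiplier outside \<open>p\<close>, so that computations in
  the localization can be done by clearing denominators.\<close>

lemma loc_prime_iff:
  assumes A: "subring A K" and p: "primeideal p (subr K A)"
  shows "x \<in> loc_prime K A p \<longleftrightarrow> x \<in> carrier K \<and> (\<exists>b\<in>A - p. b \<otimes> x \<in> A)"
proof
  note AE = subringE[OF A] and pD = subr_primeD[OF A p]
  assume "x \<in> loc_prime K A p"
  then obtain a b where *: "a \<in> A" "b \<in> A - p" "x = a \<otimes> inv b" unfolding loc_def by blast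
  have car: "a \<in> carrier K" "b \<in> carrier K" "b \<noteq> \<zero>" using * AE(1) pD(3) by auto
  have "b \<otimes> x = a" unfolding *(3) using car nonzero_inv[of b] by (simp add: m_lcomm)
  then have "b \<otimes> x \<in> A" using *(1) by simp
  moreover have "x \<in> carrier K" using * car nonzero_inv[of b] by simp
  ultimately show "x \<in> carrier K \<and> (\<exists>b\<in>A - p. b \<otimes> x \<in> A)" using *(2) by blast
next
  note AE = subringE[OF A] and pD = subr_primeD[OF A p]
  assume "x \<in> carrier K \<and> (\<exists>b\<in>A - p. b \<otimes> x \<in> A)"
  then obtain b where *: "x \<in> carrier K" "b \<in> A - p" "b \<otimes> x \<in> A" by blast
  have car: "b \<in> carrier K" "b \<noteq> \<zero>" using * AE(1) pD(3) by auto
  have "x = (b \<otimes> x) \<otimes> inv b" using car nonzero_inv[of b] *(1) by (metis m_assoc m_comm l_one)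
  then show "x \<in> loc_prime K A p" unfolding loc_def using * by blast
qed

context
  fixes A p assumes A: "subring A K" and p: "primeideal p (subr K A)"
begin

lemma compl_prime_mult: "b \<in> A - p \<Longrightarrow> c \<in> A - p \<Longrightarrow> b \<otimes> c \<in> A - p"
  using subr_primeD(9)[OF A p] subringE(6)[OF A] by blast

lemma loc_prime_inv: "b \<in> A - p \<Longrightarrow> inv b \<in> loc_prime K A p"
proof -
  assume b: "b \<in> A - p"
  then have "b \<in> carrier K" "b \<noteq> \<zero>" using subringE(1)[OF A] subr_primeD(3)[OF A p] by auto
  then have "inv b \<in> carrier K" "b \<otimes> inv b \<in> A" using nonzero_inv[of b] subringE(3)[OF A] by auto
  then show ?thesis unfolding loc_prime_iff[OF A p] using b by blast
qed

lemma loc_prime_contains: "A \<subseteq> loc_prime K A p"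
proof
  fix x assume x: "x \<in> A"
  then have "\<one> \<otimes> x \<in> A" using subringE(1)[OF A] by auto
  then show "x \<in> loc_prime K A p"
    unfolding loc_prime_iff[OF A p] using x subringE(1,3)[OF A] subr_primeD(4)[OF A p] by blast
qed

lemma loc_prime_subring: "subring (loc_prime K A p) K"
proof (rule subringI)
  note AE = subringE[OF A]
  show "loc_prime K A p \<subseteq> carrier K" using loc_prime_iff[OF A p] by blast
  show "\<one> \<in> loc_prime K A p" using loc_prime_contains AE(3) by blast
  show "\<ominus> x \<in> loc_prime K A p" if "x \<in> loc_prime K A p" for x
  proof -
    from that obtain b where *: "x \<in> carrier K" "b \<in> A - p" "b \<otimes> x \<in> A" unfolding loc_prime_iff[OF A p] by blast
    have "b \<otimes> (\<ominus> x) = \<ominus> (b \<otimes> x)" using * AE(1) by (auto simp: r_minus)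
    then have "b \<otimes> (\<ominus> x) \<in> A" using AE(5)[OF *(3)] by simp
    then show ?thesis unfolding loc_prime_iff[OF A p] using * by blast
  qed
  fix x y assume "x \<in> loc_prime K A p" "y \<in> loc_prime K A p"
  then obtain b c where *: "x \<in> carrier K" "b \<in> A - p" "b \<otimes> x \<in> A"
    "y \<in> carrier K" "c \<in> A - p" "c \<otimes> y \<in> A" unfolding loc_prime_iff[OF A p] by blast
  have car: "b \<in> carrier K" "c \<in> carrier K" using * AE(1) by auto
  have "(b \<otimes> c) \<otimes> (x \<otimes> y) = (b \<otimes> x) \<otimes> (c \<otimes> y)"
    "(b \<otimes> c) \<otimes> (x \<oplus> y) = c \<otimes> (b \<otimes> x) \<oplus> b \<otimes> (c \<otimes> y)" using car *(1,4) by algebra+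
  then have "(b \<otimes> c) \<otimes> (x \<otimes> y) \<in> A" "(b \<otimes> c) \<otimes> (x \<oplus> y) \<in> A" using * AE(6,7) by auto
  then show "x \<otimes> y \<in> loc_prime K A p" "x \<oplus> y \<in> loc_prime K A p"
    unfolding loc_prime_iff[OF A p] using compl_prime_mult[OF *(2,5)] * by blast+
qed

lemma loc_prime_lift:
  assumes q: "primeideal q (subr K A)" "q \<subseteq> p"
  shows "\<exists>Q. primeideal Q (subr K (loc_prime K A p)) \<and> Q \<inter> A = q"
proof (intro exI conjI)
  note AE = subringE[OF A] and qD = subr_primeD[OF A q(1)]
  \<comment> \<open>The extension of \<open>q\<close> to the localization, again described by
    clearing denominators.\<close>
  let ?Q = "{x \<in> carrier K. \<exists>b\<in>A - p. b \<otimes> x \<in> q}"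
  have npq: "b \<notin> q" if "b \<in> A - p" for b using that q(2) by blast
  show "?Q \<inter> A = q"
  proof
    show "?Q \<inter> A \<subseteq> q" using qD(9) npq by blast
    show "q \<subseteq> ?Q \<inter> A"
    proof
      fix x assume x: "x \<in> q"
      then have "\<one> \<otimes> x \<in> q" using qD(2) by auto
      moreover have "\<one> \<in> A - p" using AE(3) subr_primeD(4)[OF A p] by blast
      ultimately show "x \<in> ?Q \<inter> A" using x qD(1,2) by blast
    qed
  qed
  show "primeideal ?Q (subr K (loc_prime K A p))"
  proof (rule subr_primeI[OF loc_prime_subring])
    show "?Q \<subseteq> loc_prime K A p" using loc_prime_iff[OF A p] qD(1) by blast
    show "\<zero> \<in> ?Q" using \<open>?Q \<inter> A = q\<close> qD(3) by blast
    show "\<one> \<notin> ?Q" using npq AE(1) by auto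
  next
    fix x y assume "x \<in> ?Q" "y \<in> ?Q"
    then obtain b c where *: "x \<in> carrier K" "b \<in> A - p" "b \<otimes> x \<in> q"
      "y \<in> carrier K" "c \<in> A - p" "c \<otimes> y \<in> q" by blast
    have car: "b \<in> carrier K" "c \<in> carrier K" using * AE(1) by auto
    have "(b \<otimes> c) \<otimes> (x \<oplus> y) = c \<otimes> (b \<otimes> x) \<oplus> b \<otimes> (c \<otimes> y)" using car *(1,4) by algebra
    then have "(b \<otimes> c) \<otimes> (x \<oplus> y) \<in> q" using * qD(5,7) by auto
    then show "x \<oplus> y \<in> ?Q" using compl_prime_mult[OF *(2,5)] * by blast
  next
    fix x y assume "x \<in> ?Q" "y \<in> loc_prime K A p"
    then obtain b c where *: "x \<in> carrier K" "b \<in> A - p" "b \<otimes> x \<in> q"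
      "y \<in> carrier K" "c \<in> A - p" "c \<otimes> y \<in> A" unfolding loc_prime_iff[OF A p] by blast
    have car: "b \<in> carrier K" "c \<in> carrier K" using * AE(1) by auto
    have "(b \<otimes> c) \<otimes> (y \<otimes> x) = (c \<otimes> y) \<otimes> (b \<otimes> x)" using car *(1,4) by algebra
    then have "(b \<otimes> c) \<otimes> (y \<otimes> x) \<in> q" using * qD(7) by auto
    then show "y \<otimes> x \<in> ?Q" using compl_prime_mult[OF *(2,5)] * by blast
  next
    fix x y assume "x \<in> loc_prime K A p" "y \<in> loc_prime K A p" "x \<otimes> y \<in> ?Q"
    then obtain b c d where *: "x \<in> carrier K" "b \<in> A - p" "b \<otimes> x \<in> A"
      "y \<in> carrier K" "c \<in> A - p" "c \<otimes> y \<in> A" "d \<in> A - p" "d \<otimes> (x \<otimes> y) \<in> q" unfolding loc_prime_iff[OF A p] by blast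
    have car: "b \<in> carrier K" "c \<in> carrier K" "d \<in> carrier K" using * AE(1) by auto
    have "d \<otimes> ((b \<otimes> x) \<otimes> (c \<otimes> y)) = (b \<otimes> c) \<otimes> (d \<otimes> (x \<otimes> y))" using car *(1,4) by algebra
    then have "d \<otimes> ((b \<otimes> x) \<otimes> (c \<otimes> y)) \<in> q" using * qD(7) compl_prime_mult[OF *(2,5)] by auto
    then have "(b \<otimes> x) \<otimes> (c \<otimes> y) \<in> q" using qD(9) * npq AE(6) by blast
    then have "b \<otimes> x \<in> q \<or> c \<otimes> y \<in> q" using qD(9) * by blast
    then show "x \<in> ?Q \<or> y \<in> ?Q" using * by blast
  qed
qed

text \<open>Elements of \<open>A\<close> outside \<open>p\<close> are units in \<open>S\<close>, so
  no prime of \<open>S\<close> contains them.\<close>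

lemma over_loc_prime_contract:
  assumes S: "subring S K" "loc_prime K A p \<subseteq> S" and Q: "primeideal Q (subr K S)"
  shows "Q \<inter> A \<subseteq> p"
proof
  fix b assume b: "b \<in> Q \<inter> A"
  show "b \<in> p"
  proof (rule ccontr)
    assume "b \<notin> p"
    then have inv: "inv b \<in> S" using loc_prime_inv b S(2) by blast
    have "b \<noteq> \<zero>" "b \<in> carrier K" using \<open>b \<notin> p\<close> subr_primeD(3)[OF A p] b subringE(1)[OF A] by auto
    then have "b \<otimes> inv b = \<one>" using nonzero_inv by blast
    then show False using subr_primeD(8)[OF S(1) Q, of b "inv b"] b inv subr_primeD(4)[OF S(1) Q] by auto
  qed
qed

text \<open>A denominator moves an element of the localization into \<open>A\<close>, and it can be
  cancelled again because no prime of \<open>S\<close> contains it.\<close>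

lemma over_loc_prime_order:
  assumes S: "subring S K" "loc_prime K A p \<subseteq> S"
    and Q: "primeideal Q1 (subr K S)" "primeideal Q2 (subr K S)" and le: "Q1 \<inter> A \<subseteq> Q2 \<inter> A"
  shows "Q1 \<inter> loc_prime K A p \<subseteq> Q2 \<inter> loc_prime K A p"
proof
  fix x assume x: "x \<in> Q1 \<inter> loc_prime K A p"
  then obtain b where b: "b \<in> A - p" "b \<otimes> x \<in> A" using loc_prime_iff[OF A p, of x] by blast
  have AS: "A \<subseteq> S" using loc_prime_contains S(2) by blast
  have "b \<otimes> x \<in> Q1" using subr_primeD(7)[OF S(1) Q(1)] x b(1) AS by blast
  then have "b \<otimes> x \<in> Q2" using le b by blast
  moreover have "b \<notin> Q2" using over_loc_prime_contract[OF S Q(2)] b by blast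
  ultimately have "x \<in> Q2" using subr_primeD(9)[OF S(1) Q(2), of b x] x S(2) b(1) AS by blast
  then show "x \<in> Q2 \<inter> loc_prime K A p" using x by blast
qed

text \<open>Eliminates the spectrum of the localization. Surjectivity becomes lifting of the primes
  of \<open>A\<close> inside \<open>p\<close>, and injectivity is order reflection used in both
  directions. Contraction to \<open>A\<close> is the convenient form because going-down, as it
  occurs in perinormality, is about \<open>R\<close> itself.\<close>

lemma spec_order_reflecting_bij_iff:
  assumes S: "subring S K" "loc_prime K A p \<subseteq> S"
  shows "spec_order_reflecting_bij K (loc_prime K A p) S \<longleftrightarrow>
    (\<forall>q. primeideal q (subr K A) \<longrightarrow> q \<subseteq> p \<longrightarrow> (\<exists>Q. primeideal Q (subr K S) \<and> Q \<inter> A = q)) \<and>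
    (\<forall>Q1 Q2. primeideal Q1 (subr K S) \<longrightarrow> primeideal Q2 (subr K S) \<longrightarrow> Q1 \<inter> A \<subseteq> Q2 \<inter> A \<longrightarrow> Q1 \<subseteq> Q2)"
    (is "?L \<longleftrightarrow> ?lift \<and> ?refl")
proof
  let ?Ap = "loc_prime K A p"
  have int: "(Q \<inter> ?Ap) \<inter> A = Q \<inter> A" for Q using loc_prime_contains by blast
  {
    assume L: ?L
    have ?lift
    proof (intro allI impI)
      fix q assume "primeideal q (subr K A)" "q \<subseteq> p"
      then obtain Q' where Q': "primeideal Q' (subr K ?Ap)" "Q' \<inter> A = q" using loc_prime_lift by blast
      have "Spec (subr K ?Ap) = (\<lambda>Q. Q \<inter> ?Ap) ` Spec (subr K S)"
        using L unfolding spec_order_reflecting_bij_def bij_betw_def by simp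
      moreover have "Q' \<in> Spec (subr K ?Ap)" using Q'(1) by (simp add: Spec_def)
      ultimately have "Q' \<in> (\<lambda>Q. Q \<inter> ?Ap) ` Spec (subr K S)" by simp
      then obtain Q where "primeideal Q (subr K S)" "Q' = Q \<inter> ?Ap" unfolding Spec_def by blast
      then show "\<exists>Q. primeideal Q (subr K S) \<and> Q \<inter> A = q" using Q'(2) int by blast
    qed
    moreover have ?refl
    proof (intro allI impI)
      fix Q1 Q2 assume Q: "primeideal Q1 (subr K S)" "primeideal Q2 (subr K S)" "Q1 \<inter> A \<subseteq> Q2 \<inter> A"
      have "Q1 \<inter> ?Ap \<subseteq> Q2 \<inter> ?Ap" by (rule over_loc_prime_order[OF S Q])
      then show "Q1 \<subseteq> Q2" using L Q(1,2) unfolding spec_order_reflecting_bij_def Spec_def by simp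
    qed
    ultimately show "?lift \<and> ?refl" ..
  }
  {
    assume "?lift \<and> ?refl"
    then have lift: "\<And>q. primeideal q (subr K A) \<Longrightarrow> q \<subseteq> p \<Longrightarrow> \<exists>Q. primeideal Q (subr K S) \<and> Q \<inter> A = q"
      and refl: "\<And>Q1 Q2. primeideal Q1 (subr K S) \<Longrightarrow> primeideal Q2 (subr K S) \<Longrightarrow>
         Q1 \<inter> A \<subseteq> Q2 \<inter> A \<Longrightarrow> Q1 \<subseteq> Q2" by auto
    have "inj_on (\<lambda>Q. Q \<inter> ?Ap) (Spec (subr K S))"
    proof (rule inj_onI)
      fix Q1 Q2 assume Q: "Q1 \<in> Spec (subr K S)" "Q2 \<in> Spec (subr K S)" "Q1 \<inter> ?Ap = Q2 \<inter> ?Ap"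
      have "Q1 \<inter> A = Q2 \<inter> A" using int[of Q1] int[of Q2] Q(3) by simp
      then show "Q1 = Q2" using refl[of Q1 Q2] refl[of Q2 Q1] Q unfolding Spec_def by simp
    qed
    moreover have "(\<lambda>Q. Q \<inter> ?Ap) ` Spec (subr K S) = Spec (subr K ?Ap)"
    proof
      show "(\<lambda>Q. Q \<inter> ?Ap) ` Spec (subr K S) \<subseteq> Spec (subr K ?Ap)"
        using subr_prime_contract[OF loc_prime_subring S] unfolding Spec_def by blast
      show "Spec (subr K ?Ap) \<subseteq> (\<lambda>Q. Q \<inter> ?Ap) ` Spec (subr K S)"
      proof
        fix Q' assume "Q' \<in> Spec (subr K ?Ap)"
        then have Q': "primeideal Q' (subr K ?Ap)" unfolding Spec_def by blast
        have "primeideal (Q' \<inter> A) (subr K A)" "Q' \<inter> A \<subseteq> p"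
          using subr_prime_contract[OF A loc_prime_subring loc_prime_contains Q']
            over_loc_prime_contract[OF loc_prime_subring subset_refl Q'] by auto
        then obtain Q where Q: "primeideal Q (subr K S)" "Q \<inter> A = Q' \<inter> A" using lift by blast
        have QA: "primeideal (Q \<inter> ?Ap) (subr K ?Ap)" using subr_prime_contract[OF loc_prime_subring S Q(1)] .
        \<comment> \<open>Primes of the localization are compared by taking the localization itself
          for \<open>S\<close> in \<open>over_loc_prime_order\<close>, whence the doubled
          intersection.\<close>
        have "Q' \<inter> ?Ap = Q \<inter> ?Ap \<inter> ?Ap"
        proof
          show "Q' \<inter> ?Ap \<subseteq> Q \<inter> ?Ap \<inter> ?Ap"
            by (rule over_loc_prime_order[OF loc_prime_subring subset_refl Q' QA]) (simp add: int Q(2))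
          show "Q \<inter> ?Ap \<inter> ?Ap \<subseteq> Q' \<inter> ?Ap"
            by (rule over_loc_prime_order[OF loc_prime_subring subset_refl QA Q']) (simp add: int Q(2))
        qed
        then have "Q' = Q \<inter> ?Ap" using subr_primeD(1)[OF loc_prime_subring Q'] by blast
        then show "Q' \<in> (\<lambda>Q. Q \<inter> ?Ap) ` Spec (subr K S)" using Q(1) unfolding Spec_def by blast
      qed
    qed
    moreover have "Q1 \<subseteq> Q2" if "Q1 \<in> Spec (subr K S)" "Q2 \<in> Spec (subr K S)" "Q1 \<inter> ?Ap \<subseteq> Q2 \<inter> ?Ap" for Q1 Q2
    proof -
      have "Q1 \<inter> A \<subseteq> Q2 \<inter> A" using that(3) loc_prime_contains by blast
      then show ?thesis using refl that(1,2) unfolding Spec_def by simp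
    qed
    ultimately show ?L unfolding spec_order_reflecting_bij_def bij_betw_def by blast
  }
qed

end

end

section \<open>Perinormality and order-reflecting bijections\<close>

context fraction_field
begin

text \<open>The prime \<open>N\<close> over \<open>p\<close> contains all primes of
  \<open>S\<close>, so \<open>S\<close> is local; going-down is lifting followed by order
  reflection. Perinormality only yields some multiplicative set \<open>M\<close>, but its elements
  are units in \<open>S\<close>, so they avoid \<open>N\<close> and therefore
  \<open>p\<close>.\<close>

lemma perinormal_imp_unique:
  assumes peri: "perinormal K R" and p: "primeideal p (subr K R)"
    and S: "subring S K" "loc_prime K R p \<subseteq> S" and bij: "spec_order_reflecting_bij K (loc_prime K R p) S"
  shows "S = loc_prime K R p"
proof -
  have RS: "R \<subseteq> S" using loc_prime_contains[OF subR p] S(2) by blast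
  have lift: "\<And>q. primeideal q (subr K R) \<Longrightarrow> q \<subseteq> p \<Longrightarrow> \<exists>Q. primeideal Q (subr K S) \<and> Q \<inter> R = q"
    and refl: "\<And>Q1 Q2. primeideal Q1 (subr K S) \<Longrightarrow> primeideal Q2 (subr K S) \<Longrightarrow>
         Q1 \<inter> R \<subseteq> Q2 \<inter> R \<Longrightarrow> Q1 \<subseteq> Q2"
    using bij unfolding spec_order_reflecting_bij_iff[OF subR p S] by auto
  have le_p: "Q \<inter> R \<subseteq> p" if "primeideal Q (subr K S)" for Q
    using over_loc_prime_contract[OF subR p S that] .
  obtain N where N: "primeideal N (subr K S)" "N \<inter> R = p" using lift[OF p] by blast
  note ND = subr_primeD[OF S(1) N(1)]
  have max_N: "M = N" if M: "maximalideal M (subr K S)" for M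
  proof -
    have Mp: "primeideal M (subr K S)" using cring.maximalideal_prime[OF subr_cring[OF S(1)] M] .
    have "M \<subseteq> N" using refl[OF Mp N(1)] le_p[OF Mp] N(2) by simp
    moreover have "N \<noteq> carrier (subr K S)" using ND(4) subringE(3)[OF S(1)] by auto
    moreover have "ideal N (subr K S)" using N(1) by (simp add: primeideal_def)
    ultimately show ?thesis using maximalideal.I_maximal[OF M, of N] ND(1) by auto
  qed
  have "\<not> (\<exists>b\<in>S. \<zero> \<otimes> b = \<one>)" using subringE(1)[OF S(1)] by auto
  then obtain M where "maximalideal M (subr K S)"
    using ex_maximal_ideal_nonunit[OF S(1) subringE(2)[OF S(1)]] by blast
  then have "local_ring (subr K S)" unfolding local_ring_def using max_N by (intro ex1I[of _ M]) auto
  moreover have "going_down K R S"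
    unfolding going_down_def Spec_def
  proof (intro ballI impI)
    fix p' q' Q assume *: "p' \<in> {P. primeideal P (subr K R)}" "q' \<in> {P. primeideal P (subr K R)}"
      "Q \<in> {P. primeideal P (subr K S)}" "p' \<subset> q' \<and> Q \<inter> R = q'"
    have "p' \<subseteq> p" using le_p[of Q] * by auto
    then obtain P where P: "primeideal P (subr K S)" "P \<inter> R = p'" using lift[of p'] * by auto
    then have "P \<subseteq> Q" using refl[of P Q] * by auto
    then show "\<exists>P\<in>{P. primeideal P (subr K S)}. P \<subseteq> Q \<and> P \<inter> R = p'" using P by blast
  qed
  ultimately have "is_localization K R S" using peri S(1) RS unfolding perinormal_def by blast
  then obtain M where M: "mult_closed K R M" "S = loc K R M" unfolding is_localization_def by blast
  have "M \<subseteq> R - p"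
  proof
    fix m assume m: "m \<in> M"
    then have mR: "m \<in> R" "m \<noteq> \<zero>" using M(1) unfolding mult_closed_def by auto
    have mc: "m \<in> carrier K" using mR R_carrier by blast
    have "\<one> \<otimes> inv m \<in> S" unfolding M(2) loc_def using m subringE(3)[OF subR] by blast
    then have inv: "inv m \<in> S" using nonzero_inv[OF mc mR(2)] by simp
    have "m \<notin> N"
    proof
      assume "m \<in> N"
      then have "m \<otimes> inv m \<in> N" using ND(8) inv by blast
      then show False using nonzero_inv[OF mc mR(2)] ND(4) by simp
    qed
    then show "m \<in> R - p" using N(2) mR(1) by blast
  qed
  then have "S \<subseteq> loc_prime K R p" unfolding M(2) loc_def by blast
  then show ?thesis using S(2) by blast
qed

text \<open>Here the contraction result and (R1) are combined. The conclusion mentions only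
  \<open>R\<close> and \<open>x\<close>, so it transfers to other overrings: in one that contains
  \<open>x\<close>, every prime over \<open>q\<close> contains \<open>b x\<close> but not
  \<open>b\<close>, hence it contains \<open>x\<close>.\<close>

lemma height_one_avoid:
  assumes uc: "universally_catenary (subr K R)" and r1: "R1 K R"
    and x: "x \<in> carrier K" "x \<noteq> \<zero>" and P: "primeideal P (subr K (adjoin R x))" "x \<in> P"
  obtains q b where "primeideal q (subr K R)" "q \<subseteq> P" "b \<in> R - q" "b \<otimes> x \<in> q"
proof -
  note T = adjoin_subring[OF subR x(1)]
  have "noetherian_ring (subr K R)" using uc unfolding universally_catenary_def by blast
  then have noeth: "noetherian_ring (subr K (adjoin R x))" by (rule adjoin_noetherian[OF subR x(1)])
  obtain u where u: "({\<zero>}, u) \<in> prime_cover (subr K (adjoin R x))" "x \<in> u" "u \<subseteq> P"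
    using domain.ex_height_one_prime[OF subr_domain[OF T] noeth P] x(2) by auto
  let ?q = "u \<inter> R"
  have ht: "height_one K R ?q" by (rule contraction_height_one[OF uc x(1) u(1,2)])
  then have q: "primeideal ?q (subr K R)" unfolding height_one_def Spec_def by blast
  note uD = subr_primeD[OF T prime_coverD(2)[OF u(1)]]
  have RT: "R \<subseteq> adjoin R x" using adjoin_contains(1)[OF subR x(1)] .
  have "valuation_domain K (loc_prime K R ?q)" using r1 ht unfolding R1_def by blast
  then have "x \<in> loc_prime K R ?q \<or> inv x \<in> loc_prime K R ?q"
    using x unfolding valuation_domain_def by blast
  then obtain b where b: "b \<in> R - ?q" "b \<otimes> x \<in> ?q"
  proof
    assume "x \<in> loc_prime K R ?q"
    then obtain b where b: "b \<in> R - ?q" "b \<otimes> x \<in> R" unfolding loc_prime_iff[OF subR q] by blast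
    then have "b \<otimes> x \<in> u" using uD(7)[OF u(2)] RT by blast
    then show ?thesis using that b by blast
  next
    \<comment> \<open>This case is contradictory: \<open>b = (b/x) x\<close> would lie in
      \<open>u\<close>.\<close>
    assume "inv x \<in> loc_prime K R ?q"
    then obtain b where b: "b \<in> R - ?q" "b \<otimes> inv x \<in> R" unfolding loc_prime_iff[OF subR q] by blast
    have "b \<in> carrier K" using b R_carrier by blast
    then have "(b \<otimes> inv x) \<otimes> x = b" using nonzero_inv[OF x] x by (simp add: m_assoc)
    moreover have "(b \<otimes> inv x) \<otimes> x \<in> u" using uD(7)[OF u(2)] b RT by blast
    ultimately show ?thesis using b by auto
  qed
  then show ?thesis using that[OF q] u(3) by blast
qed

section \<open>Integrality of an element that is polynomial in its inverse\<close>

lemma poly_span_inverse: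
  assumes A: "subring A K" and xy: "x \<in> carrier K" "y \<in> carrier K" "x \<otimes> y = \<one>"
  shows "t \<in> poly_span A y n \<Longrightarrow> t \<otimes> x [^] n \<in> poly_span A x (Suc n)"
proof (induct n arbitrary: t)
  case 0
  then show ?case using poly_span_zero[OF A xy(1), of 1] xy by simp
next
  case (Suc n)
  then obtain t' c where *: "t = t' \<oplus> c \<otimes> y [^] n" "t' \<in> poly_span A y n" "c \<in> A" by auto
  have car: "t' \<in> carrier K" "c \<in> carrier K" "x [^] n \<in> carrier K" "y [^] n \<in> carrier K"
    using * poly_span_carrier[OF A xy(2)] subringE(1)[OF A] xy by auto
  have "y [^] n \<otimes> x [^] n = \<one>"
    using xy by (metis m_comm nat_pow_distrib nat_pow_one)
  then have c_eq: "c = c \<otimes> (y [^] n \<otimes> x [^] n)" using car by simp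
  have "t \<otimes> x [^] Suc n = (t' \<otimes> x [^] n) \<otimes> x \<oplus> (c \<otimes> (y [^] n \<otimes> x [^] n)) \<otimes> x"
    unfolding *(1) nat_pow_Suc using car xy(1) by algebra
  then have eq: "t \<otimes> x [^] Suc n = (t' \<otimes> x [^] n) \<otimes> x \<oplus> c \<otimes> x" using c_eq by simp
  have "c \<otimes> x \<in> poly_span A x (Suc (Suc 0))"
    by (rule poly_span_shift[OF A xy(1) poly_span_one[OF A xy(1) *(3)]])
  then have "c \<otimes> x \<in> poly_span A x (Suc (Suc n))"
    using poly_span_mono[OF A xy(1), of "Suc (Suc 0)" "Suc (Suc n)"] by blast
  moreover have "(t' \<otimes> x [^] n) \<otimes> x \<in> poly_span A x (Suc (Suc n))"
    by (rule poly_span_shift[OF A xy(1) Suc.hyps[OF *(2)]])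
  ultimately show ?case unfolding eq using poly_span_add[OF A xy(1)] by blast
qed

text \<open>Writing \<open>x\<close> as a polynomial in \<open>y = 1/x\<close> of degree below
  \<open>n\<close> and multiplying by \<open>x^n\<close> expresses \<open>x^(n+1)\<close> through
  lower powers of \<open>x\<close>, which is a monic equation.\<close>

lemma integral_closureI:
  assumes A: "subring A K" and xy: "x \<in> carrier K" "y \<in> carrier K" "x \<otimes> y = \<one>" and mem: "x \<in> adjoin A y"
  shows "x \<in> integral_closure K A"
proof -
  obtain n where n: "x \<in> poly_span A y n" using mem unfolding adjoin_def by blast
  have "x [^] Suc n \<in> poly_span A x (Suc n)"
    using poly_span_inverse[OF A xy n] nat_pow_Suc2[OF xy(1)] by simp
  \<comment> \<open>In \<open>integral_closure\<close> the lower terms stand on the same side as the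
    leading power, so the element to expand is \<open>- x^(n+1)\<close>.\<close>
  then have "\<ominus> \<one> \<otimes> x [^] Suc n \<in> poly_span A x (Suc n)"
    using poly_span_smult[OF A xy(1)] subringE(3,5)[OF A] by blast
  then obtain c where c: "\<forall>i. c i \<in> A" "\<ominus> \<one> \<otimes> x [^] Suc n = (\<Oplus>i\<in>{..<Suc n}. c i \<otimes> x [^] i)"
    using poly_span_finsum[OF A xy(1)] by blast
  have "x [^] Suc n \<in> carrier K" using xy by simp
  then have "x [^] Suc n \<oplus> (\<Oplus>i\<in>{..<Suc n}. c i \<otimes> x [^] i) = \<zero>"
    unfolding c(2)[symmetric] by algebra
  then show ?thesis unfolding integral_closure_def using xy(1) c(1) by blast
qed

lemma unique_imp_perinormal:
  assumes uc: "universally_catenary (subr K R)" and r1: "R1 K R"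
    and uniq: "\<And>p S. primeideal p (subr K R) \<Longrightarrow> subring S K \<Longrightarrow> loc_prime K R p \<subseteq> S \<Longrightarrow>
      S \<subseteq> integral_closure K (loc_prime K R p) \<Longrightarrow> spec_order_reflecting_bij K (loc_prime K R p) S \<Longrightarrow>
      S = loc_prime K R p"
  shows "perinormal K R"
  unfolding perinormal_def
proof (intro allI impI, elim conjE)
  fix S assume S: "subring S K" and RS: "R \<subseteq> S" and loc: "local_ring (subr K S)" and gd: "going_down K R S"
  obtain N where N: "maximalideal N (subr K S)" and N_uniq: "\<And>M. maximalideal M (subr K S) \<Longrightarrow> M = N"
    using loc unfolding local_ring_def by auto
  have Np: "primeideal N (subr K S)" using cring.maximalideal_prime[OF subr_cring[OF S] N] .
  note ND = subr_primeD[OF S Np]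
  define p where "p = N \<inter> R"
  have p: "primeideal p (subr K R)" unfolding p_def by (rule subr_prime_contract[OF subR S RS Np])
  let ?A = "loc_prime K R p"
  note A = loc_prime_subring[OF subR p]
  \<comment> \<open>Elements of \<open>S\<close> outside its only maximal ideal are units, and
    \<open>N\<close> contracts to \<open>p\<close>, so \<open>S\<close> contains the inverses of all
    denominators.\<close>
  have AS: "?A \<subseteq> S"
  proof
    fix x assume "x \<in> ?A"
    then obtain b where x: "x \<in> carrier K" and b: "b \<in> R - p" "b \<otimes> x \<in> R" unfolding loc_prime_iff[OF subR p] by blast
    have bS: "b \<in> S" "b \<notin> N" using b RS unfolding p_def by auto
    then obtain c where c: "c \<in> S" "b \<otimes> c = \<one>"
      using ex_maximal_ideal_nonunit[OF S bS(1)] N_uniq by blast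
    have car: "b \<in> carrier K" "c \<in> carrier K" using bS c subringE(1)[OF S] by auto
    have "x = (b \<otimes> c) \<otimes> x" using c x by simp
    also have "\<dots> = c \<otimes> (b \<otimes> x)" using car x by algebra
    also have "\<dots> \<in> S" using c b RS subringE(6)[OF S] by blast
    finally show "x \<in> S" .
  qed
  \<comment> \<open>\<open>going_down\<close> is about strict inclusions; when \<open>q\<close> is
    the contraction of \<open>Q\<close>, the prime \<open>Q\<close> itself serves.\<close>
  have down: "\<exists>P. primeideal P (subr K S) \<and> P \<subseteq> Q \<and> P \<inter> R = q"
    if "primeideal q (subr K R)" "primeideal Q (subr K S)" "q \<subseteq> Q" for q Q
  proof (cases "q = Q \<inter> R")
    case True then show ?thesis using that by blast
  next
    case False
    have "primeideal (Q \<inter> R) (subr K R)" by (rule subr_prime_contract[OF subR S RS that(2)])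
    moreover have "q \<subset> Q \<inter> R" using False that(3) subr_primeD(1)[OF subR that(1)] by blast
    ultimately show ?thesis using gd that unfolding going_down_def Spec_def by blast
  qed
  have "spec_order_reflecting_bij K ?A S"
    unfolding spec_order_reflecting_bij_iff[OF subR p S AS]
  proof (intro conjI allI impI)
    fix q assume "primeideal q (subr K R)" "q \<subseteq> p"
    then show "\<exists>Q. primeideal Q (subr K S) \<and> Q \<inter> R = q" using down[of q N] Np unfolding p_def by blast
  next
    fix Q1 Q2 assume Q: "primeideal Q1 (subr K S)" "primeideal Q2 (subr K S)" "Q1 \<inter> R \<subseteq> Q2 \<inter> R"
    note Q1D = subr_primeD[OF S Q(1)] and Q2D = subr_primeD[OF S Q(2)]
    show "Q1 \<subseteq> Q2"
    proof
      fix x assume x: "x \<in> Q1"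
      show "x \<in> Q2"
      proof (cases "x = \<zero>")
        case True then show ?thesis using Q2D(3) by simp
      next
        case False
        have xc: "x \<in> carrier K" "x \<in> S" using x Q1D by auto
        have T: "adjoin R x \<subseteq> S" using adjoin_least[OF subR xc(1) S RS xc(2)] .
        have P: "primeideal (Q1 \<inter> adjoin R x) (subr K (adjoin R x))"
          by (rule subr_prime_contract[OF adjoin_subring[OF subR xc(1)] S T Q(1)])
        have "x \<in> Q1 \<inter> adjoin R x" using x adjoin_contains(2)[OF subR xc(1)] by blast
        then obtain q b where q: "primeideal q (subr K R)" "q \<subseteq> Q1 \<inter> adjoin R x" "b \<in> R - q" "b \<otimes> x \<in> q"
          using height_one_avoid[OF uc r1 xc(1) False P] by blast
        \<comment> \<open>As \<open>q\<close> lies below \<open>Q2\<close> as well, going-down gives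
          a prime over \<open>q\<close> inside \<open>Q2\<close>, and \<open>b \<notin> q\<close>
          forces \<open>x\<close> into it.\<close>
        have "q \<subseteq> Q2" using q(2) Q(3) subr_primeD(1)[OF subR q(1)] by blast
        then obtain P1 where P1: "primeideal P1 (subr K S)" "P1 \<subseteq> Q2" "P1 \<inter> R = q"
          using down[OF q(1) Q(2)] by blast
        have "b \<in> S" "b \<notin> P1" "b \<otimes> x \<in> P1" using q P1(3) RS by auto
        then have "x \<in> P1" using subr_primeD(9)[OF S P1(1)] xc(2) by blast
        then show ?thesis using P1(2) by blast
      qed
    qed
  qed
  moreover have "S \<subseteq> integral_closure K ?A"
  proof
    fix x assume xS: "x \<in> S"
    then have xc: "x \<in> carrier K" using subringE(1)[OF S] by blast
    show "x \<in> integral_closure K ?A"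
    proof (cases "x = \<zero>")
      case True
      have "x [^] (1::nat) \<oplus> (\<Oplus>i\<in>{..<1}. \<zero> \<otimes> x [^] (i::nat)) = \<zero>" using True by simp
      then show ?thesis unfolding integral_closure_def using xc subringE(2)[OF A]
        by (intro CollectI conjI exI[of _ "1::nat"] exI[of _ "\<lambda>_. \<zero>"]) auto
    next
      case False
      define y where "y = inv x"
      have y: "y \<in> carrier K" "x \<otimes> y = \<one>" "y \<otimes> x = \<one>" using nonzero_inv[OF xc False] unfolding y_def by auto
      have y0: "y \<noteq> \<zero>" using y xc by auto
      note Ay = adjoin_subring[OF A y(1)]
      show ?thesis
      proof (rule ccontr)
        assume "x \<notin> integral_closure K ?A"
        \<comment> \<open>So \<open>y\<close> has no inverse in \<open>adjoin ?A y\<close> and lies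
          in some prime \<open>v\<close>. The inverse is adjoined to the localization and not to
          \<open>R\<close> so that \<open>v\<close> contracts into \<open>p\<close>, where
          going-down from \<open>N\<close> applies.\<close>
        then have "x \<notin> adjoin ?A y" using integral_closureI[OF A xc y(1,2)] by blast
        then have "\<not> (\<exists>b\<in>adjoin ?A y. y \<otimes> b = \<one>)"
          using y xc subringE(1)[OF Ay] by (metis m_assoc m_comm l_one subsetD)
        then obtain v where v: "primeideal v (subr K (adjoin ?A y))" "y \<in> v"
          using ex_maximal_ideal_nonunit[OF Ay adjoin_contains(2)[OF A y(1)]] by blast
        have A_Ay: "?A \<subseteq> adjoin ?A y" using adjoin_contains(1)[OF A y(1)] .
        have R_Ay: "R \<subseteq> adjoin ?A y" using A_Ay loc_prime_contains[OF subR p] by blast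
        have T: "adjoin R y \<subseteq> adjoin ?A y"
          using adjoin_least[OF subR y(1) Ay R_Ay adjoin_contains(2)[OF A y(1)]] .
        have P: "primeideal (v \<inter> adjoin R y) (subr K (adjoin R y))"
          by (rule subr_prime_contract[OF adjoin_subring[OF subR y(1)] Ay T v(1)])
        have "y \<in> v \<inter> adjoin R y" using v(2) adjoin_contains(2)[OF subR y(1)] by blast
        then obtain q b where q: "primeideal q (subr K R)" "q \<subseteq> v \<inter> adjoin R y" "b \<in> R - q" "b \<otimes> y \<in> q"
          using height_one_avoid[OF uc r1 y(1) y0 P] by blast
        have "v \<inter> R \<subseteq> p" using over_loc_prime_contract[OF subR p Ay A_Ay v(1)] .
        then have "q \<subseteq> N" using q(2) subr_primeD(1)[OF subR q(1)] unfolding p_def by blast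
        then obtain P1 where P1: "primeideal P1 (subr K S)" "P1 \<inter> R = q" using down[OF q(1) Np] by blast
        have bc: "b \<in> carrier K" using q R_carrier by blast
        have "(b \<otimes> y) \<otimes> x = b" using bc y xc by (simp add: m_assoc)
        moreover have "(b \<otimes> y) \<otimes> x \<in> P1" using subr_primeD(8)[OF S P1(1)] q(4) P1(2) xS by blast
        ultimately show False using q(3) P1(2) by auto
      qed
    qed
  qed
  ultimately have "S = ?A" using uniq[OF p S AS] by blast
  moreover have "mult_closed K R (R - p)"
    unfolding mult_closed_def using compl_prime_mult[OF subR p] subr_primeD(3,4)[OF subR p] subringE(3)[OF subR] by blast
  ultimately show "is_localization K R S" unfolding is_localization_def by blast
qed

end

section \<open>The condition (R1)\<close>

context fraction_field
begin

lemma ex_maximal_subring_avoiding: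
  assumes A: "subring A K" "z \<notin> A"
  obtains V where "subring V K" "A \<subseteq> V" "z \<notin> V"
    "\<And>W. subring W K \<Longrightarrow> V \<subseteq> W \<Longrightarrow> z \<notin> W \<Longrightarrow> W = V"
proof -
  define F where "F = {B. subring B K \<and> A \<subseteq> B \<and> z \<notin> B}"
  have "\<exists>V\<in>F. \<forall>W\<in>F. V \<subseteq> W \<longrightarrow> W = V"
  proof (rule subset_Zorn)
    fix C assume C: "subset.chain F C"
    show "\<exists>U\<in>F. \<forall>B\<in>C. B \<subseteq> U"
    proof (cases "C = {}")
      case True
      have "A \<in> F" using A unfolding F_def by blast
      then show ?thesis using True by blast
    next
      case False
      have CF: "B \<in> F" if "B \<in> C" for B using C that unfolding subset_chain_def by blast
      have Cc: "B \<subseteq> B' \<or> B' \<subseteq> B" if "B \<in> C" "B' \<in> C" for B B'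
        using C that unfolding subset_chain_def by blast
      have sub: "subring B K" if "B \<in> C" for B using CF[OF that] unfolding F_def by blast
      have "subring (\<Union>C) K"
      proof (rule subringI)
        show "\<Union>C \<subseteq> carrier K" using sub subringE(1) by blast
        show "\<one> \<in> \<Union>C" using sub subringE(3) False by blast
        show "\<ominus> h \<in> \<Union>C" if h: "h \<in> \<Union>C" for h
        proof -
          obtain B where "B \<in> C" "h \<in> B" using h by blast
          then show ?thesis using subringE(5)[OF sub] by blast
        qed
        fix g h assume "g \<in> \<Union>C" "h \<in> \<Union>C"
        then obtain B B' where "B \<in> C" "B' \<in> C" "g \<in> B" "h \<in> B'" by blast
        then obtain B where "B \<in> C" "g \<in> B" "h \<in> B" using Cc[of B B'] by blast
        then show "g \<otimes> h \<in> \<Union>C" "g \<oplus> h \<in> \<Union>C" using subringE(6,7)[OF sub] by blast+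
      qed
      moreover have "A \<subseteq> \<Union>C" "z \<notin> \<Union>C" using False CF unfolding F_def by blast+
      ultimately have "\<Union>C \<in> F" unfolding F_def by blast
      then show ?thesis by blast
    qed
  qed
  then obtain V where V: "V \<in> F" and max: "\<And>W. W \<in> F \<Longrightarrow> V \<subseteq> W \<Longrightarrow> W = V" by metis
  show ?thesis
  proof (rule that[of V])
    show "subring V K" "A \<subseteq> V" "z \<notin> V" using V unfolding F_def by auto
    then show "W = V" if "subring W K" "V \<subseteq> W" "z \<notin> W" for W
      using max[of W] that unfolding F_def by blast
  qed
qed

text \<open>The only nonzero prime of \<open>R\<close> inside \<open>q\<close> is \<open>q\<close>.
  A nonzero \<open>d \<in> R\<close> that is not a unit in \<open>W\<close> would lie in a prime of
  \<open>W\<close> over \<open>q\<close>, which contains the unit \<open>a\<close>. Hence all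
  denominators are invertible in \<open>W\<close>.\<close>

lemma overring_of_height_one_loc:
  assumes ht: "height_one K R q" and a: "a \<in> q" "a \<noteq> \<zero>"
    and W: "subring W K" "loc_prime K R q \<subseteq> W" "inv a \<in> W"
  shows "W = carrier K"
proof
  have q: "primeideal q (subr K R)" using ht unfolding height_one_def Spec_def by blast
  note qD = subr_primeD[OF subR q]
  have RW: "R \<subseteq> W" using loc_prime_contains[OF subR q] W(2) by blast
  show "W \<subseteq> carrier K" using subringE(1)[OF W(1)] .
  show "carrier K \<subseteq> W"
  proof
    fix x assume x: "x \<in> carrier K"
    obtain c d where cd: "c \<in> R" "d \<in> R" "d \<noteq> \<zero>" "d \<otimes> x = c" using frac_mult[OF x] .
    have "\<exists>e\<in>W. d \<otimes> e = \<one>"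
    proof (rule ccontr)
      assume "\<not> ?thesis"
      then obtain M where M: "primeideal M (subr K W)" "d \<in> M"
        using ex_maximal_ideal_nonunit[OF W(1), of d] cd(2) RW by blast
      have pr: "primeideal (M \<inter> R) (subr K R)" by (rule subr_prime_contract[OF subR W(1) RW M(1)])
      have le: "M \<inter> R \<subseteq> q" by (rule over_loc_prime_contract[OF subR q W(1,2) M(1)])
      have "{\<zero>} \<subset> M \<inter> R" using M(2) cd(2,3) subr_primeD(3)[OF subR pr] by blast
      then have "M \<inter> R = q" using ht pr le unfolding height_one_def Spec_def by blast
      then have "a \<otimes> inv a \<in> M" using subr_primeD(8)[OF W(1) M(1)] a(1) W(3) by blast
      then show False using nonzero_inv[of a] a qD(2) subr_primeD(4)[OF W(1) M(1)] by auto
    qed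
    then obtain e where e: "e \<in> W" "d \<otimes> e = \<one>" by blast
    have car: "d \<in> carrier K" "e \<in> carrier K" using cd R_carrier e subringE(1)[OF W(1)] by auto
    have "x = (d \<otimes> e) \<otimes> x" using e x by simp
    also have "\<dots> = e \<otimes> (d \<otimes> x)" using car x by algebra
    also have "\<dots> \<in> W" using e cd RW subringE(6)[OF W(1)] by blast
    finally show "x \<in> W" .
  qed
qed

text \<open>The point is that \<open>V\<close> has a single nonzero prime. For a nonzero prime
  \<open>N\<close> and \<open>0 \<noteq> w \<in> N\<close>, the localization of \<open>V\<close> at
  \<open>N\<close> misses \<open>1/w\<close>, so it is proper, so it misses \<open>1/a\<close>, and
  by maximality it equals \<open>V\<close>. Thus everything in \<open>V\<close> outside
  \<open>N\<close> is a unit, and \<open>N\<close> contains every prime. Such an \<open>N\<close>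
  exists because \<open>a\<close> is a nonunit of \<open>V\<close>.\<close>

lemma spec_maximal_subring:
  assumes ht: "height_one K R q" and a: "a \<in> q" "a \<noteq> \<zero>"
    and V: "subring V K" "loc_prime K R q \<subseteq> V" "inv a \<notin> V"
    and max: "\<And>W. subring W K \<Longrightarrow> V \<subseteq> W \<Longrightarrow> inv a \<notin> W \<Longrightarrow> W = V"
  shows "spec_order_reflecting_bij K (loc_prime K R q) V"
proof -
  have q: "primeideal q (subr K R)" using ht unfolding height_one_def Spec_def by blast
  have RV: "R \<subseteq> V" using loc_prime_contains[OF subR q] V(2) by blast
  have ac: "a \<in> carrier K" using a subr_primeD(2)[OF subR q] by blast
  have units: "inv s \<in> V" if N: "primeideal N (subr K V)" "N \<noteq> {\<zero>}" and s: "s \<in> V - N" for N s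
  proof -
    note ND = subr_primeD[OF V(1) N(1)]
    obtain w where w: "w \<in> N" "w \<noteq> \<zero>" using N(2) ND(3) by blast
    have wc: "w \<in> carrier K" using w ND(2) by blast
    have "inv w \<notin> loc_prime K V N"
    proof
      assume "inv w \<in> loc_prime K V N"
      then obtain b where b: "b \<in> V - N" "b \<otimes> inv w \<in> V" unfolding loc_prime_iff[OF V(1) N(1)] by blast
      have "b \<in> carrier K" using b subringE(1)[OF V(1)] by blast
      then have "(b \<otimes> inv w) \<otimes> w = b" using nonzero_inv[OF wc w(2)] wc by (simp add: m_assoc)
      then show False using ND(7)[OF w(1) b(2)] b(1) by simp
    qed
    then have "loc_prime K V N \<noteq> carrier K" using nonzero_inv[OF wc w(2)] by blast
    moreover have V_le: "V \<subseteq> loc_prime K V N" using loc_prime_contains[OF V(1) N(1)] .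
    ultimately have "inv a \<notin> loc_prime K V N"
      using overring_of_height_one_loc[OF ht a loc_prime_subring[OF V(1) N(1)]] V(2) by blast
    then have "loc_prime K V N = V" using max[OF loc_prime_subring[OF V(1) N(1)] V_le] by blast
    then show "inv s \<in> V" using loc_prime_inv[OF V(1) N(1) s] by simp
  qed
  have le: "Q \<subseteq> N" if N: "primeideal N (subr K V)" "N \<noteq> {\<zero>}" and Q: "primeideal Q (subr K V)" for Q N
  proof
    fix s assume s: "s \<in> Q"
    show "s \<in> N"
    proof (rule ccontr)
      assume sN: "s \<notin> N"
      have sV: "s \<in> V" "s \<in> carrier K" using s subr_primeD(1,2)[OF V(1) Q] by auto
      have "s \<noteq> \<zero>" using sN subr_primeD(3)[OF V(1) N(1)] by blast
      then have "s \<otimes> inv s = \<one>" using nonzero_inv[OF sV(2)] by blast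
      moreover have "s \<otimes> inv s \<in> Q" using subr_primeD(8)[OF V(1) Q s] units[OF N] sV(1) sN by blast
      ultimately show False using subr_primeD(4)[OF V(1) Q] by simp
    qed
  qed
  show ?thesis
    unfolding spec_order_reflecting_bij_iff[OF subR q V(1,2)]
  proof (intro conjI allI impI)
    fix r assume r: "primeideal r (subr K R)" "r \<subseteq> q"
    show "\<exists>Q. primeideal Q (subr K V) \<and> Q \<inter> R = r"
    proof (cases "r = {\<zero>}")
      case True
      then show ?thesis using subr_prime_zero[OF V(1)] subringE(2)[OF subR] by blast
    next
      case False
      then have "{\<zero>} \<subset> r" using subr_primeD(3)[OF subR r(1)] by blast
      then have "r = q" using ht r unfolding height_one_def Spec_def by blast
      have "a \<in> V" using a(1) subr_primeD(1)[OF subR q] RV by blast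
      moreover have "\<not> (\<exists>b\<in>V. a \<otimes> b = \<one>)"
      proof
        assume "\<exists>b\<in>V. a \<otimes> b = \<one>"
        then obtain b where b: "b \<in> V" "a \<otimes> b = \<one>" by blast
        have "b \<in> carrier K" using b subringE(1)[OF V(1)] by blast
        then have "inv a = b" using b(2) ac comm_inv_char by blast
        then show False using b V(3) by blast
      qed
      ultimately obtain M where M: "primeideal M (subr K V)" "a \<in> M"
        using ex_maximal_ideal_nonunit[OF V(1)] by blast
      have pr: "primeideal (M \<inter> R) (subr K R)" by (rule subr_prime_contract[OF subR V(1) RV M(1)])
      have le: "M \<inter> R \<subseteq> q" by (rule over_loc_prime_contract[OF subR q V(1,2) M(1)])
      have "{\<zero>} \<subset> M \<inter> R" using M(2) a subr_primeD(3)[OF subR pr] subr_primeD(1)[OF subR q] by blast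
      then have "M \<inter> R = q" using ht pr le unfolding height_one_def Spec_def by blast
      then show ?thesis using M \<open>r = q\<close> by blast
    qed
  next
    fix Q1 Q2 assume Q: "primeideal Q1 (subr K V)" "primeideal Q2 (subr K V)" "Q1 \<inter> R \<subseteq> Q2 \<inter> R"
    show "Q1 \<subseteq> Q2"
    proof (cases "Q2 = {\<zero>}")
      case True
      have "Q1 = {\<zero>}"
      proof (rule ccontr)
        assume "Q1 \<noteq> {\<zero>}"
        then have "Q1 \<inter> R \<noteq> {\<zero>}" by (rule prime_contract_nonzero[OF V(1) RV Q(1)])
        then show False using Q(3) True subr_primeD(3)[OF V(1) Q(1)] subringE(2)[OF subR] by blast
      qed
      then show ?thesis using True by blast
    next
      case False
      then show ?thesis using le[OF Q(2) _ Q(1)] by blast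
    qed
  qed
qed

text \<open>With \<open>b\<close> a denominator of \<open>c\<close>, the element
  \<open>b (1 - a c)\<close> of \<open>R\<close> is congruent to \<open>b\<close> modulo
  \<open>q\<close>, hence it is outside \<open>q\<close> and becomes invertible.\<close>

lemma one_minus_unit:
  assumes q: "primeideal q (subr K R)" and a: "a \<in> q" and c: "c \<in> loc_prime K R q"
  shows "\<exists>f\<in>loc_prime K R q. f \<otimes> (\<one> \<ominus> a \<otimes> c) = \<one>"
proof -
  note qD = subr_primeD[OF subR q] and A = loc_prime_subring[OF subR q]
  obtain b where b: "c \<in> carrier K" "b \<in> R - q" "b \<otimes> c \<in> R" using c unfolding loc_prime_iff[OF subR q] by blast
  have car: "a \<in> carrier K" "b \<in> carrier K" using a qD(2) b R_carrier by auto
  let ?e = "\<one> \<ominus> a \<otimes> c"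
  have be: "b \<otimes> ?e = b \<ominus> (b \<otimes> c) \<otimes> a" using car b(1) by algebra
  have bca: "(b \<otimes> c) \<otimes> a \<in> q" using qD(7)[OF a b(3)] .
  have "b \<otimes> ?e \<in> R" unfolding be using subr_minus_closed[OF subR] b(2) bca qD(1) by blast
  moreover have "b \<otimes> ?e \<notin> q"
  proof
    assume "b \<otimes> ?e \<in> q"
    then have "(b \<ominus> (b \<otimes> c) \<otimes> a) \<oplus> (b \<otimes> c) \<otimes> a \<in> q" unfolding be using qD(5) bca by blast
    moreover have "(b \<ominus> (b \<otimes> c) \<otimes> a) \<oplus> (b \<otimes> c) \<otimes> a = b" using car b(1) by algebra
    ultimately show False using b(2) by simp
  qed
  ultimately have beq: "b \<otimes> ?e \<in> R - q" by blast
  then have inv: "inv (b \<otimes> ?e) \<in> loc_prime K R q" by (rule loc_prime_inv[OF subR q])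
  have "b \<otimes> ?e \<in> carrier K" "b \<otimes> ?e \<noteq> \<zero>" using beq R_carrier qD(3) by auto
  then have ii: "inv (b \<otimes> ?e) \<in> carrier K" "inv (b \<otimes> ?e) \<otimes> (b \<otimes> ?e) = \<one>" using nonzero_inv by auto
  have "(inv (b \<otimes> ?e) \<otimes> b) \<otimes> ?e = \<one>"
    using ii(2) m_assoc[OF ii(1) car(2), of ?e] car b(1) by simp
  moreover have "inv (b \<otimes> ?e) \<otimes> b \<in> loc_prime K R q"
    using subringE(6)[OF A inv] loc_prime_contains[OF subR q] b(2) by blast
  ultimately show ?thesis by blast
qed

text \<open>If neither \<open>x\<close> nor \<open>y = 1/x\<close> lies in the localization, then \<open>K\<close> is generated by each of
  them; the first makes \<open>y\<close> integral, so \<open>K\<close> is a finite module over the local ring, contradicting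
  Nakayama's lemma.\<close>

lemma maximal_subring_valuation:
  assumes q: "primeideal q (subr K R)" and a: "a \<in> q" "a \<noteq> \<zero>"
    and gen: "\<And>x. x \<in> carrier K \<Longrightarrow> x \<notin> loc_prime K R q \<Longrightarrow> adjoin (loc_prime K R q) x = carrier K"
  shows "valuation_domain K (loc_prime K R q)"
  unfolding valuation_domain_def
proof (intro conjI ballI impI)
  let ?A = "loc_prime K R q"
  show A: "subring ?A K" by (rule loc_prime_subring[OF subR q])
  fix x assume x: "x \<in> carrier K" "x \<noteq> \<zero>"
  define y where "y = inv x"
  have y: "y \<in> carrier K" "x \<otimes> y = \<one>" "y \<otimes> x = \<one>" using nonzero_inv[OF x] unfolding y_def by auto
  show "x \<in> ?A \<or> inv x \<in> ?A"
  proof (rule ccontr)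
    assume n: "\<not> ?thesis"
    note span = poly_span_carrier[OF A y(1)] poly_span_add[OF A y(1)] poly_span_smult[OF A y(1)]
    have "y \<in> adjoin ?A x" using gen[OF x(1)] n y(1) by blast
    then obtain n where "y \<in> poly_span ?A x n" unfolding adjoin_def by blast
    then have "y \<otimes> y [^] n \<in> poly_span ?A y (Suc n)" by (rule poly_span_inverse[OF A y(1) x(1) y(3)])
    then have yn: "y [^] Suc n \<in> poly_span ?A y (Suc n)" using nat_pow_Suc2[OF y(1)] by simp
    \<comment> \<open>As \<open>y^(n+1)\<close> is a combination of lower powers, this finite span
      is closed under multiplication by \<open>y\<close>; it is therefore all of
      \<open>adjoin ?A y\<close>, that is, \<open>K\<close>.\<close>
    define E where "E = poly_span ?A y (Suc n)"
    have shift: "t \<otimes> y \<in> E" if t: "t \<in> E" for t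
    proof -
      obtain t' c where *: "t = t' \<oplus> c \<otimes> y [^] n" "t' \<in> poly_span ?A y n" "c \<in> ?A"
        using t unfolding E_def by auto
      have car: "t' \<in> carrier K" "c \<in> carrier K" "y [^] n \<in> carrier K"
        using * span(1) subringE(1)[OF A] y(1) by auto
      have "t \<otimes> y = t' \<otimes> y \<oplus> c \<otimes> y [^] Suc n" unfolding * nat_pow_Suc using car y(1) by algebra
      then show ?thesis
        using span(2)[OF poly_span_shift[OF A y(1) *(2)] span(3)[OF yn *(3)]] unfolding E_def by simp
    qed
    have pow: "y [^] m \<in> E" for m :: nat
    proof (induct m)
      case 0
      have "\<one> \<in> poly_span ?A y (Suc 0)" by (rule poly_span_one[OF A y(1) subringE(3)[OF A]])
      then show ?case unfolding E_def using poly_span_mono[OF A y(1), of "Suc 0" "Suc n"] by auto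
    next
      case (Suc m) then show ?case using shift by simp
    qed
    have "poly_span ?A y m \<subseteq> E" for m
    proof (induct m)
      case 0 then show ?case
        using poly_span_zero[OF A y(1), of "Suc n"] unfolding E_def by (simp del: poly_span.simps(2))
    next
      case (Suc m)
      have "t \<oplus> c \<otimes> y [^] m \<in> E" if "t \<in> poly_span ?A y m" "c \<in> ?A" for t c
        using span(2,3) Suc pow that unfolding E_def by blast
      then show ?case by auto
    qed
    then have "carrier K \<subseteq> E" using gen[OF y(1)] n unfolding y_def[symmetric] adjoin_def by blast
    then have ex: "carrier K = poly_span ?A y (Suc n)" using span(1) unfolding E_def by blast
    \<comment> \<open>Nakayama by minimality: with the least number \<open>k\<close> of powers
      spanning \<open>K\<close>, the last power \<open>y^j\<close> turns out to be redundant. Since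
      the span is all of \<open>K\<close>, \<open>y^j\<close> can be divided by \<open>a\<close>
      before it is expanded, which supplies the factor \<open>a\<close> in
      \<open>1 - a c\<close>.\<close>
    define k where "k = (LEAST k. carrier K = poly_span ?A y k)"
    have k: "carrier K = poly_span ?A y k" unfolding k_def using ex by (rule LeastI[where P = "\<lambda>k. carrier K = poly_span ?A y k"])
    have least: "carrier K \<noteq> poly_span ?A y j" if "j < k" for j 
      using that not_less_Least[of j "\<lambda>k. carrier K = poly_span ?A y k"] unfolding k_def by blast
    have "k \<noteq> 0"
    proof
      assume "k = 0"
      then have "\<one> \<in> {\<zero>}" using k one_closed by auto
      then show False by simp
    qed
    then obtain j where j: "k = Suc j" using not0_implies_Suc by blast
    have ac: "a \<in> carrier K" using a subr_primeD(2)[OF subR q] by blast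
    have yj: "y [^] j \<in> carrier K" using y(1) by simp
    note ia = nonzero_inv[OF ac a(2)]
    have "inv a \<otimes> y [^] j \<in> poly_span ?A y (Suc j)"
      using m_closed[OF conjunct1[OF ia] yj] unfolding k[unfolded j] .
    then obtain t c where tc: "inv a \<otimes> y [^] j = t \<oplus> c \<otimes> y [^] j" "t \<in> poly_span ?A y j" "c \<in> ?A" by auto
    have car: "t \<in> carrier K" "c \<in> carrier K" using tc span(1) subringE(1)[OF A] by auto
    have "y [^] j = a \<otimes> (inv a \<otimes> y [^] j)" using ia yj ac by (simp add: m_assoc[symmetric])
    also have "\<dots> = a \<otimes> t \<oplus> (a \<otimes> c) \<otimes> y [^] j" unfolding tc(1) using car ac yj by algebra
    finally have yj_eq: "y [^] j = a \<otimes> t \<oplus> (a \<otimes> c) \<otimes> y [^] j" .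
    have "(\<one> \<ominus> a \<otimes> c) \<otimes> y [^] j = y [^] j \<ominus> (a \<otimes> c) \<otimes> y [^] j" using car ac yj by algebra
    also have "\<dots> = a \<otimes> t \<oplus> (a \<otimes> c) \<otimes> y [^] j \<ominus> (a \<otimes> c) \<otimes> y [^] j"
      by (rule arg_cong[where f = "\<lambda>z. z \<ominus> (a \<otimes> c) \<otimes> y [^] j", OF yj_eq])
    also have "\<dots> = a \<otimes> t" using car ac yj by algebra
    finally have e_yj: "(\<one> \<ominus> a \<otimes> c) \<otimes> y [^] j = a \<otimes> t" .
    obtain f where f: "f \<in> ?A" "f \<otimes> (\<one> \<ominus> a \<otimes> c) = \<one>" using one_minus_unit[OF q a(1) tc(3)] by blast
    have fc: "f \<in> carrier K" using f subringE(1)[OF A] by blast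
    have "y [^] j = f \<otimes> ((\<one> \<ominus> a \<otimes> c) \<otimes> y [^] j)"
      using f(2) fc car ac yj by (simp add: m_assoc[symmetric])
    then have "y [^] j = f \<otimes> (a \<otimes> t)" unfolding e_yj .
    moreover have "a \<in> ?A" using a(1) subr_primeD(1)[OF subR q] loc_prime_contains[OF subR q] by blast
    ultimately have yj_mem: "y [^] j \<in> poly_span ?A y j" using span(3) tc(2) f(1) by metis
    have "poly_span ?A y (Suc j) \<subseteq> poly_span ?A y j" using span(2,3) yj_mem by auto
    then have "carrier K = poly_span ?A y j" using k[unfolded j] span(1) by blast
    then show False using least[of j] j by simp
  qed
qed

text \<open>Uniqueness identifies \<open>V\<close>, maximal among the overrings that miss
  \<open>1/a\<close>, with the localization. The localization then has this maximality itself, so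
  adjoining any new element brings in \<open>1/a\<close> and gives all of \<open>K\<close>.\<close>

lemma unique_imp_R1:
  assumes uniq: "\<And>p S. primeideal p (subr K R) \<Longrightarrow> subring S K \<Longrightarrow> loc_prime K R p \<subseteq> S \<Longrightarrow>
      spec_order_reflecting_bij K (loc_prime K R p) S \<Longrightarrow> S = loc_prime K R p"
  shows "R1 K R"
  unfolding R1_def
proof (intro allI impI)
  fix q assume ht: "height_one K R q"
  have q: "primeideal q (subr K R)" and "q \<noteq> {\<zero>}" using ht unfolding height_one_def Spec_def by auto
  note qD = subr_primeD[OF subR q]
  obtain a where a: "a \<in> q" "a \<noteq> \<zero>" using \<open>q \<noteq> {\<zero>}\<close> qD(3) by blast
  have ac: "a \<in> carrier K" using a qD(2) by blast
  note ia = nonzero_inv[OF ac a(2)]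
  let ?A = "loc_prime K R q"
  note A = loc_prime_subring[OF subR q]
  have "inv a \<notin> ?A"
  proof
    assume "inv a \<in> ?A"
    then obtain b where b: "b \<in> R - q" "b \<otimes> inv a \<in> R" unfolding loc_prime_iff[OF subR q] by blast
    have "b \<in> carrier K" using b R_carrier by blast
    then have "(b \<otimes> inv a) \<otimes> a = b" using ia ac by (simp add: m_assoc)
    then show False using qD(7)[OF a(1) b(2)] b(1) by simp
  qed
  then obtain V where V: "subring V K" "?A \<subseteq> V" "inv a \<notin> V"
    and max: "\<And>W. subring W K \<Longrightarrow> V \<subseteq> W \<Longrightarrow> inv a \<notin> W \<Longrightarrow> W = V"
    using ex_maximal_subring_avoiding[OF A] by blast
  have VA: "V = ?A" by (rule uniq[OF q V(1,2) spec_maximal_subring[OF ht a V max]])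
  show "valuation_domain K ?A"
  proof (rule maximal_subring_valuation[OF q a])
    fix x assume x: "x \<in> carrier K" "x \<notin> ?A"
    note Ax = adjoin_subring[OF A x(1)] and cont = adjoin_contains[OF A x(1)]
    have "adjoin ?A x \<noteq> V" using VA x(2) cont(2) by blast
    then have "inv a \<in> adjoin ?A x" using max[OF Ax] cont(1) VA by blast
    then show "adjoin ?A x = carrier K" by (rule overring_of_height_one_loc[OF ht a Ax cont(1)])
  qed
qed

end

theorem theorem4p7:
  fixes K :: "('a, 'b) ring_scheme" and R :: "'a set"
  assumes frac: "is_fraction_field K R"
    and uc: "universally_catenary (subr K R)"
  shows "(perinormal K R
      \<longleftrightarrow> (\<forall>p \<in> Spec (subr K R). \<forall>S. subring S K \<and> loc_prime K R p \<subseteq> S \<and>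
              spec_order_reflecting_bij K (loc_prime K R p) S \<longrightarrow> S = loc_prime K R p))
    \<and> (perinormal K R
      \<longleftrightarrow> R1 K R \<and>
          (\<forall>p \<in> Spec (subr K R). \<forall>S. subring S K \<and> loc_prime K R p \<subseteq> S \<and>
              S \<subseteq> integral_closure K (loc_prime K R p) \<and>
              spec_order_reflecting_bij K (loc_prime K R p) S \<longrightarrow> S = loc_prime K R p))"
    (is "(?a \<longleftrightarrow> ?b) \<and> (?a \<longleftrightarrow> ?r1 \<and> ?c)")
proof -
  interpret fraction_field K R
  proof -
    interpret field K using frac unfolding is_fraction_field_def by blast
    show "fraction_field K R"
      using frac field_axioms unfolding is_fraction_field_def
      by (simp add: fraction_field_def fraction_field_axioms_def ambient_field_def)
  qed
  have ab: ?b if ?a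
    using perinormal_imp_unique[OF that] unfolding Spec_def by blast
  have b_r1: ?r1 if b: ?b
  proof (rule unique_imp_R1)
    fix p S assume "primeideal p (subr K R)" "subring S K" "loc_prime K R p \<subseteq> S"
      "spec_order_reflecting_bij K (loc_prime K R p) S"
    then show "S = loc_prime K R p" using b unfolding Spec_def by simp
  qed
  have bc: ?c if b: ?b
  proof (intro ballI allI impI, elim conjE)
    fix p S assume "p \<in> Spec (subr K R)" "subring S K" "loc_prime K R p \<subseteq> S"
      "spec_order_reflecting_bij K (loc_prime K R p) S"
    then show "S = loc_prime K R p" using b by simp
  qed
  have ca: ?a if ?r1 and c: ?c
  proof (rule unique_imp_perinormal[OF uc \<open>?r1\<close>])
    fix p S assume "primeideal p (subr K R)" "subring S K" "loc_prime K R p \<subseteq> S"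
      "S \<subseteq> integral_closure K (loc_prime K R p)" "spec_order_reflecting_bij K (loc_prime K R p) S"
    then show "S = loc_prime K R p" using c unfolding Spec_def by simp
  qed
  from ab b_r1 bc ca show ?thesis by blast
qed

end
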